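(* For every integer $n\ge 0$, the curve $V_n\subset M$ corresponds to $\frac{n}{2n+1}\in\mathbb{Q}$. That is, $V_n$ is isotopic in $M$ to a simple closed curve lying in a fiber $F_\cup\times\{\frac12\}\cong F_\cup$ of $M$ whose restriction of the projection $\pi:F_\cup\to S^2$ is a homeomorphism onto a simple closed curve in the 4-punctured sphere $P$ of index $\frac{n}{2n+1}$.
   Context: **The surface $F_\cup$ and the manifold $M$.** Let $F_\cup$ be the closed oriented genus 2 surface obtained from the annulus $(\mathbb{R}/6\mathbb{Z})\times[0,1]$, with coordinates $(\theta,s)$, by the following identifications on each of the boundary circles $s=0$ (inner hexagon) and $s=1$ (outer hexagon): for each $k\in\mathbb{Z}/6$ and $u\in[0,1]$, $(k+u,s)\sim(k+4-u,s)$. (This identifies opposite sides of a hexagon by translation.) Let $\rho:F_\cup\to F_\cup$ be $\rho(\theta,s)=(\theta+1,s)$ (rotation of the hexagons by $\pi/3$). Let $M=F_\cup\times[0,1]/\big((x,1)\sim(\rho(x),0)\big)$. This $M$ is the 3-manifold obtained by $0$-framed surgery on the square knot $Q\subset S^3$, and $F_\cup$ is the genus 2 Seifert surface of $Q$ capped off by a disk. Isotopies in $M$ of a curve correspond to isotopies in $S^3-Q$ and handle slides over $Q$. **Projection to the 4-punctured sphere.** The quotient of $F_\cup$ by the $\mathbb{Z}_3$-action generated by $\rho^2$ is a 3-fold branched cover $\pi:F_\cup\to S^2$ with four branch points. The quotient $S^2$ is $\{(\theta,s):\theta\in\mathbb{R}/2\mathbb{Z},\ s\in[0,1]\}$ with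 $(\theta,s)\sim(-\theta,s)$ for $s\in\{0,1\}$. It is also the "pillowcase" $\mathbb{R}^2/\Gamma$, where $\Gamma$ is the group generated by the rotations by $\pi$ about the points of $\mathbb{Z}^2$. The branch points are the images of $\mathbb{Z}^2$, and $P=S^2-\{\text{branch points}\}$. A simple closed curve in $P$ has *index* $\frac pq\in\mathbb{Q}\cup\{\infty\}$ ($p,q$ coprime) if it is isotopic in $P$ to the image of a straight line in $\mathbb{R}^2-\mathbb{Z}^2$ with direction vector $(p,q)$ in the coordinates $(\theta,s)$. This is the reciprocal of the apparent slope. Essential simple closed curves in $P$ are classified up to isotopy by their index, and such a curve lifts homeomorphically to $F_\cup$ if and only if $q$ is odd. **The curves $V_n$.** Let $V_0\subset F_\cup\times\{\frac12\}\subset M$ be the simple closed curve $\big(\{\frac14\}\times[0,1]\big)\cup\big(\{\frac{15}4\}\times[0,1]\big)$ in $F_\cup$; it has index $0$. Let $D\subset F_\cup$ be the full preimage under $\pi$ of the image in $P$ of the line $s=2\theta+\frac12$. Then $D$ is a single simple closed curve, $\rho(D)=D$, and $\rho|_D$ is an orientation-preserving periodic map of order 6 (conjugate to a rotation by one sixth of the way around $D$). The image of $D\times[0,1]$ in $M$ is a torus $T$, which $V_0$ meets transversely in two points. (Equivalently, $T$ is obtained from the mapping torus of the core circle $s=\frac12$ by a Dehn twist along the Klein bottle that is the mapping torus of the three circles $\{j+\frac12,\,j+\frac72\}\times[0,1]$, $j=0,1,2$.) Let $\alpha\subset T$ be the closed curve consisting of a vertical arc $\{x\}\times[0,1]$,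 traversed upward from $(x,0)$ to $(x,1)\sim(\rho(x),0)$, followed by the arc in $D\times\{0\}$ from $\rho(x)$ to $x$ that runs only one sixth of the way around $D$. The curve $D$ separates $F_\cup$ into an inner side (containing the vertices of the inner hexagon $s=0$) and an outer side (containing the vertices of the outer hexagon $s=1$). Accordingly $T$ separates $M$ into an inner and an outer side. Let $h:M\to M$ be the Dehn twist along $T$ in the direction $\alpha$: it is the identity outside a collar $T\times[0,1]$ of $T$ and, as the collar is crossed from the outer side to the inner side, points are pushed along the torus parallel to $\alpha$, once around in the direction of the orientation of $\alpha$. Define $V_n=h^n(V_0)$ for $n\ge 0$. The link $L_n=Q\cup V_n\subset S^3$ (defined up to handle slides of $V_n$ over $Q$) is obtained by isotoping $V_n$ in $M$ off the core of the surgery solid torus. *)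

theory Defs
  imports "HOL-Analysis.Analysis"
begin

section \<open>Quotient spaces, simple closed curves, isotopy\<close>

definition cls :: "('a \<Rightarrow> 'a \<Rightarrow> bool) \<Rightarrow> 'a \<Rightarrow> 'a set" where
  "cls R x = {y. equivclp R x y}"

definition quotient_by :: "'a topology \<Rightarrow> ('a \<Rightarrow> 'a \<Rightarrow> bool) \<Rightarrow> 'a set topology" where
  "quotient_by X R =
     topology (\<lambda>U. U \<subseteq> cls R ` topspace X \<and> openin X {x \<in> topspace X. cls R x \<in> U})"

lemma cls_eq_iff: "cls R x = cls R y \<longleftrightarrow> equivclp R x y"
  unfolding cls_def by (blast intro: equivclp_trans equivclp_sym equivclp_refl)

lemma openin_quotient_by:
  "openin (quotient_by X R) U \<longleftrightarrow>
     U \<subseteq> cls R ` topspace X \<and> openin X {x \<in> topspace X. cls R x \<in> U}"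
proof -
  have "istopology (\<lambda>U. U \<subseteq> cls R ` topspace X \<and> openin X {x \<in> topspace X. cls R x \<in> U})"
    unfolding istopology_def
  proof (intro conjI allI impI)
    fix S T
    assume "S \<subseteq> cls R ` topspace X \<and> openin X {x \<in> topspace X. cls R x \<in> S}"
      and "T \<subseteq> cls R ` topspace X \<and> openin X {x \<in> topspace X. cls R x \<in> T}"
    then have "openin X ({x \<in> topspace X. cls R x \<in> S} \<inter> {x \<in> topspace X. cls R x \<in> T})"
      by blast
    moreover have "{x \<in> topspace X. cls R x \<in> S} \<inter> {x \<in> topspace X. cls R x \<in> T} =
        {x \<in> topspace X. cls R x \<in> S \<inter> T}" by auto
    ultimately show "openin X {x \<in> topspace X. cls R x \<in> S \<inter> T}" by simp
  next
    fix K
    assume "\<forall>U\<in>K. U \<subseteq> cls R ` topspace X \<and> openin X {x \<in> topspace X. cls R x \<in> U}"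
    then have "openin X (\<Union>U\<in>K. {x \<in> topspace X. cls R x \<in> U})" by blast
    moreover have "(\<Union>U\<in>K. {x \<in> topspace X. cls R x \<in> U}) =
        {x \<in> topspace X. cls R x \<in> \<Union>K}" by auto
    ultimately show "openin X {x \<in> topspace X. cls R x \<in> \<Union>K}" by simp
  qed auto
  then show ?thesis
    by (simp add: quotient_by_def topology_inverse')
qed

lemma topspace_quotient_by: "topspace (quotient_by X R) = cls R ` topspace X"
proof -
  have "{x \<in> topspace X. cls R x \<in> cls R ` topspace X} = topspace X" by auto
  then have "openin (quotient_by X R) (cls R ` topspace X)"
    by (simp add: openin_quotient_by)
  then show ?thesis
    by (metis openin_quotient_by openin_subset openin_topspace subset_antisym)
qed

lemma quotient_map_cls: "quotient_map X (quotient_by X R) (cls R)"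
  by (auto simp: quotient_map_def topspace_quotient_by openin_quotient_by)

definition simple_closed_curve :: "'a topology \<Rightarrow> 'a set \<Rightarrow> bool" where
  "simple_closed_curve X C \<longleftrightarrow>
     C \<subseteq> topspace X \<and>
     subtopology X C homeomorphic_space top_of_set (sphere (0::complex) 1)"

text \<open>Isotopy of (unoriented) curves means ambient isotopy: in the topological category an
  isotopy through embeddings alone does not preserve knot types.\<close>

definition isotopic_in :: "'a topology \<Rightarrow> 'a set \<Rightarrow> 'a set \<Rightarrow> bool" where
  "isotopic_in X A B \<longleftrightarrow>
     (\<exists>H. continuous_map (prod_topology (top_of_set {0..1::real}) X) X (\<lambda>(t, x). H t x) \<and>
          (\<forall>t\<in>{0..1}. homeomorphic_map X X (H t)) \<and>
          (\<forall>x\<in>topspace X. H 0 x = x) \<and>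
          H 1 ` A = B)"

section \<open>The surface and its mapping torus\<close>

inductive F_glue :: "real \<times> real \<Rightarrow> real \<times> real \<Rightarrow> bool" where
  annulus: "F_glue (\<theta>, s) (\<theta> + 6, s)"
| hexagon: "s \<in> {0, 1} \<Longrightarrow> u \<in> {0..1} \<Longrightarrow> F_glue (of_int k + u, s) (of_int k + 4 - u, s)"

definition F_surface :: "(real \<times> real) set topology" where
  "F_surface = quotient_by (top_of_set (UNIV \<times> {0..1})) F_glue"

abbreviation Fpt :: "real \<Rightarrow> real \<Rightarrow> (real \<times> real) set" where
  "Fpt \<theta> s \<equiv> cls F_glue (\<theta>, s)"

text \<open>A point of the surface is a subset of the strip, so maps induced on the quotient are
  given by images (or unions); see \<open>rho_Fpt\<close> and \<open>proj_Fpt\<close>.\<close>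

definition rho :: "(real \<times> real) set \<Rightarrow> (real \<times> real) set" where
  "rho x = (\<lambda>(\<theta>, s). (\<theta> + 1, s)) ` x"

inductive M_glue :: "(real \<times> real) set \<times> real \<Rightarrow> (real \<times> real) set \<times> real \<Rightarrow> bool" where
  "x \<in> topspace F_surface \<Longrightarrow> M_glue (x, 1) (rho x, 0)"

definition M_space :: "((real \<times> real) set \<times> real) set topology" where
  "M_space = quotient_by (prod_topology F_surface (top_of_set {0..1})) M_glue"

abbreviation Mpt :: "(real \<times> real) set \<Rightarrow> real \<Rightarrow> ((real \<times> real) set \<times> real) set" where
  "Mpt x t \<equiv> cls M_glue (x, t)"

lemma F_glue_shift:
  "F_glue p q \<Longrightarrow> F_glue (fst p + of_int j, snd p) (fst q + of_int j, snd q)"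
proof (induction rule: F_glue.induct)
  case (annulus \<theta> s)
  then show ?case using F_glue.annulus[of "\<theta> + of_int j" s] by (simp add: algebra_simps)
next
  case (hexagon s u k)
  then show ?case using F_glue.hexagon[of s u "k + j"] by (simp add: algebra_simps)
qed

lemma equivclp_F_glue_shift:
  "equivclp F_glue p q \<Longrightarrow>
   equivclp F_glue (fst p + of_int j, snd p) (fst q + of_int j, snd q)"
proof (induction rule: equivclp_induct)
  case base
  then show ?case by simp
next
  case (step y z)
  then have "F_glue y z \<or> F_glue z y" by blast
  then have "equivclp F_glue (fst y + of_int j, snd y) (fst z + of_int j, snd z)"
    by (meson F_glue_shift equivclp_sym r_into_equivclp)
  then show ?case using step equivclp_trans by meson
qed

lemma rho_Fpt: "rho (Fpt \<theta> s) = Fpt (\<theta> + 1) s"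
proof (rule set_eqI)
  fix q :: "real \<times> real"
  have "q \<in> rho (Fpt \<theta> s) \<longleftrightarrow> equivclp F_glue (\<theta>, s) (fst q + of_int (-1), snd q)"
  proof
    assume "equivclp F_glue (\<theta>, s) (fst q + of_int (-1), snd q)"
    then show "q \<in> rho (Fpt \<theta> s)"
      unfolding rho_def cls_def
      by (intro image_eqI[of _ _ "(fst q + of_int (-1), snd q)"]) auto
  qed (auto simp: rho_def cls_def)
  also have "\<dots> \<longleftrightarrow> equivclp F_glue (\<theta> + 1, s) q"
    using equivclp_F_glue_shift[of "(\<theta>, s)" "(fst q + of_int (-1), snd q)" 1]
      equivclp_F_glue_shift[of "(\<theta> + 1, s)" q "-1"]
    by auto
  finally show "q \<in> rho (Fpt \<theta> s) \<longleftrightarrow> q \<in> Fpt (\<theta> + 1) s"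
    by (simp add: cls_def)
qed

section \<open>The pillowcase and the index of a curve\<close>

text \<open>Generators of \<open>\<Gamma>\<close>: the rotations by \<open>\<pi>\<close> about the points \<open>(a, b)\<close> of the integer
  lattice.  The classes of \<open>Gamma_rel\<close> are the \<open>\<Gamma>\<close>-orbits.\<close>

inductive Gamma_rel :: "real \<times> real \<Rightarrow> real \<times> real \<Rightarrow> bool" where
  "Gamma_rel (x, y) (2 * of_int a - x, 2 * of_int b - y)"

definition pillowcase :: "(real \<times> real) set topology" where
  "pillowcase = quotient_by euclidean Gamma_rel"

definition P_space :: "(real \<times> real) set topology" where
  "P_space = subtopology pillowcase (topspace pillowcase - cls Gamma_rel ` (\<int> \<times> \<int>))"

text \<open>The projection is induced by the inclusion of the strip \<open>0 \<le> s \<le> 1\<close> into the plane.\<close>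

definition proj :: "(real \<times> real) set \<Rightarrow> (real \<times> real) set" where
  "proj x = (\<Union>p\<in>x. cls Gamma_rel p)"

lemma equivclp_Gamma_translate:
  "equivclp Gamma_rel (x, y) (x + 2 * of_int a, y + 2 * of_int b)"
proof -
  have "Gamma_rel (x, y) (2 * of_int 0 - x, 2 * of_int 0 - y)" by (rule Gamma_rel.intros)
  moreover have "Gamma_rel (- x, - y) (2 * of_int a - (- x), 2 * of_int b - (- y))"
    by (rule Gamma_rel.intros)
  ultimately show ?thesis
    by (metis (no_types, lifting) diff_minus_eq_add diff_0 mult_zero_right of_int_0
        add.commute equivclp_trans r_into_equivclp)
qed

lemma F_glue_imp_Gamma: "F_glue p q \<Longrightarrow> equivclp Gamma_rel p q"
proof (induction rule: F_glue.induct)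
  case (annulus \<theta> s)
  then show ?case using equivclp_Gamma_translate[of \<theta> s 3 0] by simp
next
  case (hexagon s u k)
  obtain b :: int where b: "s = of_int b"
    using hexagon by (metis empty_iff insert_iff of_int_0 of_int_1)
  have "Gamma_rel (of_int k + u, s) (2 * of_int (k + 2) - (of_int k + u), 2 * of_int b - s)"
    by (rule Gamma_rel.intros)
  also have "(2 * of_int (k + 2) - (of_int k + u), 2 * of_int b - s) = (of_int k + 4 - u, s)"
    using b by simp
  finally show ?case by (rule r_into_equivclp)
qed

lemma proj_Fpt: "proj (Fpt \<theta> s) = cls Gamma_rel (\<theta>, s)"
proof -
  have "equivclp Gamma_rel p q" if "equivclp F_glue p q" for p q
    using that
  proof (induction rule: equivclp_induct)
    case (step y z)
    then show ?case by (meson F_glue_imp_Gamma equivclp_sym equivclp_trans)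
  qed simp
  then have "cls Gamma_rel p = cls Gamma_rel (\<theta>, s)" if "p \<in> Fpt \<theta> s" for p
    using that by (metis cls_def cls_eq_iff mem_Collect_eq)
  moreover have "(\<theta>, s) \<in> Fpt \<theta> s" by (simp add: cls_def)
  ultimately show ?thesis unfolding proj_def by blast
qed

definition line_through :: "real \<times> real \<Rightarrow> real \<times> real \<Rightarrow> (real \<times> real) set" where
  "line_through c v = range (\<lambda>r. c + r *\<^sub>R v)"

text \<open>\<open>has_index C p q\<close> says that \<open>C\<close> has index \<open>p / q\<close>, where \<open>q = 0\<close> stands for \<open>\<infinity>\<close>.\<close>

definition has_index :: "(real \<times> real) set set \<Rightarrow> int \<Rightarrow> int \<Rightarrow> bool" where
  "has_index C p q \<longleftrightarrow>
     simple_closed_curve P_space C \<and> coprime p q \<and>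
     (\<exists>c. line_through c (of_int p, of_int q) \<inter> (\<int> \<times> \<int>) = {} \<and>
          isotopic_in P_space C (cls Gamma_rel ` line_through c (of_int p, of_int q)))"

section \<open>The Dehn twist\<close>

definition V0 :: "((real \<times> real) set \<times> real) set set" where
  "V0 = {Mpt (Fpt \<theta> s) (1/2) | \<theta> s. \<theta> \<in> {1/4, 15/4} \<and> s \<in> {0..1}}"

definition D_curve :: "(real \<times> real) set set" where
  "D_curve = {x \<in> topspace F_surface. proj x \<in> cls Gamma_rel ` {(\<theta>, s). s = 2 * \<theta> + 1/2}}"

definition T_torus :: "((real \<times> real) set \<times> real) set set" where
  "T_torus = {Mpt x t | x t. x \<in> D_curve \<and> t \<in> {0..1}}"

text \<open>\<open>\<delta>\<close> identifies \<open>D\<close> with the unit circle so that \<open>\<rho>\<close> becomes the rotation by one sixth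
  of a turn.  This condition determines the orientation of \<open>D\<close> that \<open>\<delta>\<close> induces.\<close>

definition D_param :: "(complex \<Rightarrow> (real \<times> real) set) \<Rightarrow> bool" where
  "D_param \<delta> \<longleftrightarrow>
     homeomorphic_map (top_of_set (sphere 0 1)) (subtopology F_surface D_curve) \<delta> \<and>
     (\<forall>z\<in>sphere 0 1. rho (\<delta> z) = \<delta> (cis (pi / 3) * z))"

text \<open>The closed curve \<open>\<alpha>\<close> on the torus, on the parameter interval \<open>0 \<le> r \<le> 1\<close>, in the copy
  based at \<open>(x, t)\<close> with \<open>x = \<delta> z\<close>.  For \<open>r \<le> 1/2\<close> it moves vertically upward from \<open>(x, t)\<close>
  once around \<open>M\<close>, through \<open>(x, 1) \<sim> (\<rho> x, 0)\<close>, to \<open>(\<rho> x, t)\<close>; for \<open>r \<ge> 1/2\<close> it returns from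
  \<open>\<rho> x\<close> to \<open>x\<close> in \<open>D \<times> {t}\<close> through one sixth of \<open>D\<close>.\<close>

definition alpha ::
    "(complex \<Rightarrow> (real \<times> real) set) \<Rightarrow> complex \<Rightarrow> real \<Rightarrow> real
      \<Rightarrow> ((real \<times> real) set \<times> real) set" where
  "alpha \<delta> z t r =
     (if r \<le> 1/2
      then (if t + 2 * r \<le> 1 then Mpt (\<delta> z) (t + 2 * r) else Mpt (rho (\<delta> z)) (t + 2 * r - 1))
      else Mpt (\<delta> (cis (pi / 3 * (2 - 2 * r)) * z)) t)"

definition M_side :: "(real \<times> real) set \<Rightarrow> ((real \<times> real) set \<times> real) set set" where
  "M_side v = {Mpt x t | x t. t \<in> {0..1} \<and>
     x \<in> connected_component_of_set (subtopology F_surface (topspace F_surface - D_curve)) v}"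

definition inner_side :: "((real \<times> real) set \<times> real) set set" where
  "inner_side = M_side (Fpt 0 0)"

definition outer_side :: "((real \<times> real) set \<times> real) set set" where
  "outer_side = M_side (Fpt 0 1)"

text \<open>A collar \<open>\<kappa>\<close> of the torus, running from the outer towards the inner side.  The torus is
  the level \<open>c\<close>; it may be interior to the collar or one of its two ends.\<close>

definition T_collar ::
    "(((real \<times> real) set \<times> real) set \<times> real \<Rightarrow> ((real \<times> real) set \<times> real) set) \<Rightarrow> bool" where
  "T_collar \<kappa> \<longleftrightarrow>
     embedding_map (prod_topology (subtopology M_space T_torus) (top_of_set {0..1})) M_space \<kappa> \<and>
     openin M_space (\<kappa> ` (T_torus \<times> {0<..<1})) \<and>
     (\<exists>c\<in>{0..1}. (\<forall>y\<in>T_torus. \<kappa> (y, c) = y) \<and>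
        \<kappa> ` (T_torus \<times> {0..<c}) \<subseteq> outer_side \<and>
        \<kappa> ` (T_torus \<times> {c<..1}) \<subseteq> inner_side)"

text \<open>The Dehn twist is unique only up to isotopy (it depends on the collar and on the
  parametrization of \<open>D\<close>), so it is specified by a predicate: the level \<open>r\<close> of the collar,
  counted from the outer side, is pushed along \<open>\<alpha>\<close> up to the parameter \<open>r\<close>.\<close>

definition dehn_twist ::
    "(((real \<times> real) set \<times> real) set \<Rightarrow> ((real \<times> real) set \<times> real) set) \<Rightarrow> bool" where
  "dehn_twist h \<longleftrightarrow>
     (\<exists>\<delta> \<kappa>. D_param \<delta> \<and> T_collar \<kappa> \<and>
        (\<forall>z\<in>sphere 0 1. \<forall>t\<in>{0..1}. \<forall>r\<in>{0..1}.
           h (\<kappa> (Mpt (\<delta> z) t, r)) = \<kappa> (alpha \<delta> z t r, r)) \<and>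
        (\<forall>m\<in>topspace M_space - \<kappa> ` (T_torus \<times> {0..1}). h m = m))"

end

theory Submission
  imports Defs
begin

text \<open>The image of \<open>D \<times> [0, 1]\<close> in \<open>M\<close> is a torus whose neighbourhood is best described in sheared
  coordinates.  The surface has a second presentation as an annulus with folded boundary hexagons, with
  coordinates \<open>(\<theta>, w)\<close> where \<open>w = s - 2 \<theta>\<close> in the plane that develops the pillowcase.  In it \<open>D\<close> is the
  core circle \<open>w = 1/2\<close>, \<open>\<rho>\<close> is still the shift of \<open>\<theta>\<close> by \<open>1\<close>, and \<open>V\<^sub>0\<close> still consists of vertical arcs
  (lemma \<open>Lpt_V0\<close>).  Together with the fibre coordinate \<open>t\<close> this gives coordinates \<open>(\<theta>, w, t)\<close> on \<open>M\<close>, with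
  \<open>(\<theta>, w, t + 1) = (\<theta> + 1, w, t)\<close>; the torus is the level \<open>w = 1/2\<close>, the inner side is \<open>w < 1/2\<close>.

  The power \<open>h\<^sup>n\<close> moves the level \<open>r\<close> of the collar by a homeomorphism of the torus that lifts to a map
  \<open>(\<theta>, t) \<mapsto> (B\<^sub>r \<theta>, t + q\<^sub>r)\<close> of the plane, where \<open>B\<^sub>r\<close> is an increasing homeomorphism of the line commuting
  with the shift by \<open>1\<close>.  The path of these lifts starts at the identity and ends at
  \<open>(\<theta>, t) \<mapsto> (\<theta> - n, t + n)\<close>, which is a deck transformation.  Such lifts form a convex set, so
  any two paths with these ends yield isotopic twists (\<open>twist_along_isotopic\<close>).  This removes the dependence
  on the parametrization of \<open>D\<close>, and it also allows the twisting to be slid from one part of a collar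
  to another.  Joining an arbitrary collar on one side of \<open>T\<close> with the coordinate collar on
  the other side, the twist is slid into the latter and then spread over all of \<open>M\<close>
  (\<open>twist_along_collar_isotopic_std\<close>).

  So \<open>h\<^sup>n\<close> may be replaced by \<open>(\<theta>, w, t) \<mapsto> (\<theta> - n (1 - w), w, t + n (1 - w))\<close>.  The vertical
  flow is defined on all of \<open>M\<close>, so the displacement of \<open>t\<close> can be undone by an isotopy
  (\<open>vertical_shear_isotopic\<close>), and what remains is a shear of the fibres.  It takes the vertical arcs of
  \<open>V\<^sub>0\<close> to straight arcs in the direction \<open>(n, 1)\<close> of the coordinates \<open>(\<theta>, w)\<close>, that is \<open>(n, 2n + 1)\<close> in the
  coordinates \<open>(\<theta>, s)\<close>, and these close up to a curve that projects homeomorphically to a straight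
  curve in the pillowcase.\<close>

section \<open>Continuity on pieces, quotients and isotopies\<close>

lemma continuous_map_compose_on:
  assumes "continuous_map (top_of_set S) X f" "continuous_on R g" "g ` R \<subseteq> S"
  shows "continuous_map (top_of_set R) X (\<lambda>x. f (g x))"
proof -
  have "continuous_map (top_of_set R) (top_of_set S) g"
    using assms(2,3) by (simp add: continuous_map_in_subtopology image_subset_iff_funcset)
  from continuous_map_compose[OF this assms(1)] show ?thesis by (simp add: o_def)
qed

lemma continuous_map_union_closed:
  assumes "closedin X A" "closedin X B" "topspace X \<subseteq> A \<union> B"
    and "continuous_map (subtopology X A) Y f" "continuous_map (subtopology X B) Y f"
  shows "continuous_map X Y f"
proof (rule pasting_lemma_closed[of "{True, False}" X "\<lambda>b. if b then A else B" Y "\<lambda>_. f" f])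
  show "\<exists>j. j \<in> {True, False} \<and> x \<in> (if j then A else B) \<and> f x = f x" if "x \<in> topspace X" for x
  proof -
    have "x \<in> A \<or> x \<in> B" using assms(3) that by blast
    then show ?thesis by (metis insertCI)
  qed
qed (use assms in \<open>auto split: if_splits\<close>)

text \<open>The slabs form a locally finite closed cover.  This is the form of pasting suited to maps defined
  through the integer part of a coordinate.\<close>

lemma continuous_map_slabs:
  fixes g :: "'a \<Rightarrow> real"
  assumes g: "continuous_map X euclideanreal g"
    and slab: "\<And>k::int. continuous_map
      (subtopology X {x \<in> topspace X. of_int k \<le> g x \<and> g x \<le> of_int k + 1}) Y f"
  shows "continuous_map X Y f"
proof (rule pasting_lemma_locally_finite[of X UNIV
      "\<lambda>k::int. {x \<in> topspace X. of_int k \<le> g x \<and> g x \<le> of_int k + 1}" Y "\<lambda>_. f" f])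
  fix x assume x: "x \<in> topspace X"
  let ?V = "{y \<in> topspace X. g y \<in> {g x - 1<..<g x + 1}}"
  have "openin X ?V"
    by (rule openin_continuous_map_preimage[OF g]) simp
  moreover have "finite {k::int. {y \<in> topspace X. of_int k \<le> g y \<and> g y \<le> of_int k + 1} \<inter> ?V \<noteq> {}}"
  proof (rule finite_subset)
    show "{k::int. {y \<in> topspace X. of_int k \<le> g y \<and> g y \<le> of_int k + 1} \<inter> ?V \<noteq> {}}
        \<subseteq> {\<lfloor>g x - 2\<rfloor>..\<lceil>g x + 1\<rceil>}"
    proof
      fix k :: int
      assume "k \<in> {k. {y \<in> topspace X. of_int k \<le> g y \<and> g y \<le> of_int k + 1} \<inter> ?V \<noteq> {}}"
      then obtain y where "of_int k \<le> g y" "g y \<le> of_int k + 1" "g x - 1 < g y" "g y < g x + 1"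
        by auto
      then show "k \<in> {\<lfloor>g x - 2\<rfloor>..\<lceil>g x + 1\<rceil>}"
        by (simp add: floor_le_iff le_ceiling_iff) linarith
    qed
  qed simp
  ultimately show "\<exists>V. openin X V \<and> x \<in> V \<and> finite {k \<in> UNIV.
      {y \<in> topspace X. real_of_int k \<le> g y \<and> g y \<le> of_int k + 1} \<inter> V \<noteq> {}}"
    using x by (intro exI[of _ ?V]) auto
next
  fix k :: int
  have "closedin X {x \<in> topspace X. g x \<in> {of_int k..of_int k + 1}}"
    by (rule closedin_continuous_map_preimage[OF g]) simp
  then show "closedin X {x \<in> topspace X. of_int k \<le> g x \<and> g x \<le> of_int k + 1}"
    by simp
next
  fix x assume "x \<in> topspace X"
  then show "\<exists>j. j \<in> UNIV \<and> x \<in> {x \<in> topspace X. real_of_int j \<le> g x \<and> g x \<le> real_of_int j + 1} \<and> f x = f x"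
    using of_int_floor_le[of "g x"] real_of_int_floor_add_one_ge[of "g x"]
    by (intro exI[of _ "\<lfloor>g x\<rfloor>"]) simp
qed (use slab in auto)

text \<open>A continuous surjection from a compact space onto a Hausdorff space is a quotient map.\<close>

lemma continuous_map_induced:
  assumes "compact_space Z" "Hausdorff_space X" "continuous_map Z X p" "p ` topspace Z = topspace X"
    and "continuous_map Z Y (\<lambda>z. g (p z))"
  shows "continuous_map X Y g"
  using continuous_compose_quotient_map[OF continuous_imp_quotient_map[OF assms(3,1,2,4)]] assms(5)
  by (simp add: o_def)

lemma homeomorphic_space_same_fibres:
  assumes Z: "compact_space Z" and X: "Hausdorff_space X" "continuous_map Z X p" "p ` topspace Z = topspace X"
    and Y: "Hausdorff_space Y" "continuous_map Z Y q" "q ` topspace Z = topspace Y"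
    and fib: "\<And>z z'. z \<in> topspace Z \<Longrightarrow> z' \<in> topspace Z \<Longrightarrow> p z = p z' \<longleftrightarrow> q z = q z'"
  shows "X homeomorphic_space Y"
proof -
  define u where "u x = q (inv_into (topspace Z) p x)" for x
  define v where "v y = p (inv_into (topspace Z) q y)" for y
  have u: "u (p z) = q z" if "z \<in> topspace Z" for z
  proof -
    have "p z \<in> p ` topspace Z" using that by blast
    from f_inv_into_f[OF this] inv_into_into[OF this] show ?thesis
      using fib that by (simp add: u_def)
  qed
  have v: "v (q z) = p z" if "z \<in> topspace Z" for z
  proof -
    have "q z \<in> q ` topspace Z" using that by blast
    from f_inv_into_f[OF this] inv_into_into[OF this] show ?thesis
      using fib that by (simp add: v_def)
  qed
  have "continuous_map X Y u"
    by (rule continuous_map_induced[OF Z X])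
      (rule continuous_map_eq[OF Y(2)], simp add: u)
  moreover have "continuous_map Y X v"
    by (rule continuous_map_induced[OF Z Y])
      (rule continuous_map_eq[OF X(2)], simp add: v)
  moreover have "v (u x) = x" if "x \<in> topspace X" for x
    using that u v unfolding X(3)[symmetric] by auto
  moreover have "u (v x) = x" if "x \<in> topspace Y" for x
    using that u v unfolding Y(3)[symmetric] by auto
  ultimately show ?thesis
    unfolding homeomorphic_space_def homeomorphic_maps_def by blast
qed

lemma isotopic_in_trans:
  assumes "isotopic_in X A B" "isotopic_in X B C"
  shows "isotopic_in X A C"
proof -
  let ?I = "top_of_set {0..1::real}"
  obtain H where H: "continuous_map (prod_topology ?I X) X (\<lambda>(t, x). H t x)"
      "\<forall>t\<in>{0..1}. homeomorphic_map X X (H t)" "\<forall>x\<in>topspace X. H 0 x = x" "H 1 ` A = B"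
    using assms(1) unfolding isotopic_in_def by blast
  obtain G where G: "continuous_map (prod_topology ?I X) X (\<lambda>(t, x). G t x)"
      "\<forall>t\<in>{0..1}. homeomorphic_map X X (G t)" "\<forall>x\<in>topspace X. G 0 x = x" "G 1 ` B = C"
    using assms(2) unfolding isotopic_in_def by blast
  have "continuous_map (prod_topology ?I X) (prod_topology ?I X) (\<lambda>z. (fst z, (\<lambda>(t, x). H t x) z))"
    using H(1) by (intro continuous_map_pairedI continuous_map_fst)
  from continuous_map_compose[OF this G(1)]
  have "continuous_map (prod_topology ?I X) X (\<lambda>(t, x). G t (H t x))"
    by (simp add: o_def case_prod_unfold)
  moreover have "homeomorphic_map X X (\<lambda>x. G t (H t x))" if "t \<in> {0..1}" for t
    using homeomorphic_map_compose[of X X "H t" X "G t"] H(2) G(2) that by (simp add: o_def)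
  moreover have "(\<lambda>x. G 1 (H 1 x)) ` A = C"
    using H(4) G(4) by (metis image_image)
  ultimately show ?thesis
    unfolding isotopic_in_def using H(3) G(3)
    by (intro exI[of _ "\<lambda>t x. G t (H t x)"]) auto
qed

text \<open>Every \<open>G s\<close> is a homeomorphism because the space is compact Hausdorff, and \<open>G s \<circ> (G 0)\<inverse>\<close> is an
  ambient isotopy that starts at the identity.\<close>

lemma isotopic_in_family:
  assumes X: "compact_space X" "Hausdorff_space X"
    and G: "continuous_map (prod_topology (top_of_set {0..1::real}) X) X (\<lambda>(s, x). G s x)"
    and bij: "\<And>s. s \<in> {0..1} \<Longrightarrow> bij_betw (G s) (topspace X) (topspace X)"
    and A: "A \<subseteq> topspace X"
  shows "isotopic_in X (G 0 ` A) (G 1 ` A)"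
proof -
  let ?I = "top_of_set {0..1::real}"
  have cont: "continuous_map X X (G s)" if "s \<in> {0..1}" for s
  proof -
    have "continuous_map X (prod_topology ?I X) (\<lambda>x. (s, x))"
      using that by (intro continuous_map_pairedI) auto
    from continuous_map_compose[OF this G] show ?thesis by (simp add: o_def)
  qed
  have homeo: "homeomorphic_map X X (G s)" if "s \<in> {0..1}" for s
    using cont[OF that] bij[OF that] X
    by (intro continuous_imp_homeomorphic_map) (auto simp: bij_betw_def)
  then obtain g where g: "homeomorphic_maps X X (G 0) g"
    using homeomorphic_map_maps by fastforce
  then have gX: "homeomorphic_map X X g"
    by (metis homeomorphic_maps_map homeomorphic_maps_sym)
  have "continuous_map (prod_topology ?I X) (prod_topology ?I X) (\<lambda>z. (fst z, g (snd z)))"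
    using g by (intro continuous_map_pairedI continuous_map_fst)
      (auto simp: homeomorphic_maps_def intro!: continuous_map_of_snd[unfolded o_def, THEN iffD2])
  from continuous_map_compose[OF this G]
  have "continuous_map (prod_topology ?I X) X (\<lambda>(s, x). G s (g x))"
    by (simp add: o_def case_prod_unfold)
  moreover have "homeomorphic_map X X (\<lambda>x. G s (g x))" if "s \<in> {0..1}" for s
    using homeomorphic_map_compose[OF gX homeo[OF that]] by (simp add: o_def)
  moreover have "(\<lambda>x. G 1 (g x)) ` (G 0 ` A) = G 1 ` A"
  proof -
    have "g (G 0 x) = x" if "x \<in> A" for x
      using g A that unfolding homeomorphic_maps_def by blast
    then show ?thesis by (simp add: image_image)
  qed
  ultimately show ?thesis
    unfolding isotopic_in_def using g
    by (intro exI[of _ "\<lambda>s x. G s (g x)"]) (auto simp: homeomorphic_maps_def)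
qed

section \<open>Twists along tubes of tori\<close>

text \<open>The torus \<open>T\<close> is the plane of pairs \<open>(u, t)\<close> modulo the lattice generated by \<open>(6, 0)\<close> and \<open>(-1, 1)\<close>:
  \<open>u\<close> runs around \<open>D\<close> with period 6, and raising \<open>t\<close> by one full turn of the fibration applies \<open>\<rho>\<close>.\<close>

definition lattice_equiv :: "real \<Rightarrow> real \<Rightarrow> real \<Rightarrow> real \<Rightarrow> bool" where
  "lattice_equiv u t u' t' \<longleftrightarrow> (\<exists>j k::int. t' = t + of_int j \<and> u' = u - of_int j + 6 * of_int k)"

abbreviation layers :: "real set \<Rightarrow> (real \<times> real \<times> real) set" where
  "layers R \<equiv> UNIV \<times> UNIV \<times> R"

text \<open>A collar of a torus, written in the coordinates of the universal cover of the torus.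
  Injectivity is demanded for the interior levels only.  The levels 0 and 1 may be collapsed, so
  that the sheared coordinates on the whole of \<open>M\<close> also form a tube.\<close>

definition tube :: "'m topology \<Rightarrow> (real \<times> real \<times> real \<Rightarrow> 'm) \<Rightarrow> bool" where
  "tube M K \<longleftrightarrow>
     continuous_map (top_of_set (layers {0..1})) M K \<and>
     (\<forall>u t u' t' r. r \<in> {0..1} \<longrightarrow> lattice_equiv u t u' t' \<longrightarrow> K (u, t, r) = K (u', t', r)) \<and>
     (\<forall>u t r u' t' r'. r \<in> {0<..<1} \<longrightarrow> r' \<in> {0..1} \<longrightarrow> K (u, t, r) = K (u', t', r') \<longrightarrow>
        r = r' \<and> lattice_equiv u t u' t') \<and>
     openin M (K ` (layers {0<..<1}))"

text \<open>The level \<open>r\<close> of a tube is to be moved by \<open>(u, t) \<mapsto> (B r u, t + q r)\<close>.  At \<open>r = 0\<close> this is the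
  identity and at \<open>r = 1\<close> the lattice translation by \<open>(-n, n)\<close>.\<close>

definition twist_path :: "int \<Rightarrow> (real \<Rightarrow> real \<Rightarrow> real) \<Rightarrow> (real \<Rightarrow> real) \<Rightarrow> bool" where
  "twist_path n B q \<longleftrightarrow>
     continuous_on ({0..1} \<times> UNIV) (\<lambda>(r, u). B r u) \<and> continuous_on {0..1} q \<and>
     (\<forall>r\<in>{0..1}. strict_mono (B r) \<and> (\<forall>u. B r (u + 1) = B r u + 1)) \<and>
     (\<forall>u. B 0 u = u \<and> B 1 u = u - of_int n) \<and> q 0 = 0 \<and> q 1 = of_int n"

text \<open>The choice is between different coordinates of one point; \<open>twist_along_tube\<close> shows that the value is
  the same for all of them.\<close>

definition twist_along ::
    "(real \<times> real \<times> real \<Rightarrow> 'm) \<Rightarrow> (real \<Rightarrow> real \<Rightarrow> real) \<Rightarrow> (real \<Rightarrow> real) \<Rightarrow> 'm \<Rightarrow> 'm" where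
  "twist_along K B q m =
     (if m \<in> K ` (layers {0..1})
      then SOME y. \<exists>u t r. r \<in> {0..1} \<and> m = K (u, t, r) \<and> y = K (B r u, t + q r, r)
      else m)"

lemma lattice_equiv_refl: "lattice_equiv u t u t"
  unfolding lattice_equiv_def by (intro exI[of _ 0]) simp

lemma lattice_equiv_box:
  obtains u' t' where "u' \<in> {0..6}" "t' \<in> {0..1}" "lattice_equiv u t u' t'"
proof
  let ?t = "t - of_int \<lfloor>t\<rfloor>" and ?a = "u + of_int \<lfloor>t\<rfloor>"
  let ?k = "\<lfloor>?a / 6\<rfloor>"
  have "of_int ?k \<le> ?a / 6" "?a / 6 \<le> of_int ?k + 1" by linarith+
  then show "?a - 6 * of_int ?k \<in> {0..6}" by (simp add: field_simps)
  have "of_int \<lfloor>t\<rfloor> \<le> t" "t \<le> of_int \<lfloor>t\<rfloor> + 1" by linarith+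
  then have "0 \<le> ?t" "?t \<le> 1" by linarith+
  then show "?t \<in> {0..1}" by (simp del: diff_ge_0_iff_ge)
  show "lattice_equiv u t (?a - 6 * of_int ?k) ?t"
    unfolding lattice_equiv_def by (intro exI[of _ "- \<lfloor>t\<rfloor>"] exI[of _ "- ?k"]) simp
qed

lemma twist_path_int:
  assumes "twist_path n B q" "r \<in> {0..1}"
  shows "B r (u + of_int j) = B r u + of_int j"
proof (induction j rule: int_induct[of _ 0])
  case base
  then show ?case by simp
next
  case (step1 i)
  have "B r (u + of_int i + 1) = B r (u + of_int i) + 1"
    using assms unfolding twist_path_def by blast
  with step1 show ?case by (simp add: algebra_simps)
next
  case (step2 i)
  have "B r (u + of_int (i - 1) + 1) = B r (u + of_int (i - 1)) + 1"
    using assms unfolding twist_path_def by blast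
  with step2 show ?case by (simp add: algebra_simps)
qed

lemma twist_path_inj:
  assumes "twist_path n B q" "r \<in> {0..1}"
  shows "B r u = B r u' \<longleftrightarrow> u = u'"
  using assms unfolding twist_path_def by (meson strict_mono_eq)

lemma twist_path_surj:
  assumes P: "twist_path n B q" "r \<in> {0..1}"
  obtains u where "B r u = y"
proof -
  have "continuous_on UNIV (\<lambda>u. (\<lambda>(r, u). B r u) (r, u))"
    by (rule continuous_on_compose2[of "{0..1} \<times> UNIV"])
      (use P in \<open>auto simp: twist_path_def intro!: continuous_intros\<close>)
  then have cont: "continuous_on A (B r)" for A
    by (simp add: continuous_on_subset[OF _ subset_UNIV])
  define j where "j = \<lfloor>y - B r 0\<rfloor>"
  have "B r (of_int j) = B r 0 + of_int j" "B r (of_int j + 1) = B r 0 + of_int j + 1"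
    using twist_path_int[OF P, of 0 j] twist_path_int[OF P, of 0 "j + 1"] by simp_all
  moreover have "of_int j \<le> y - B r 0" "y - B r 0 \<le> of_int j + 1"
    unfolding j_def by linarith+
  ultimately have "\<exists>u\<ge>of_int j. u \<le> of_int j + 1 \<and> B r u = y"
    by (intro IVT' cont) auto
  with that show ?thesis by blast
qed

text \<open>Since \<open>B r\<close> commutes with integer shifts and is injective, the map of the plane descends to
  an injective map of the torus.\<close>

lemma lattice_equiv_twist_path:
  assumes "twist_path n B q" "r \<in> {0..1}"
  shows "lattice_equiv (B r u) (t + q r) (B r u') (t' + q r) \<longleftrightarrow> lattice_equiv u t u' t'"
proof -
  have "B r u - of_int j + 6 * of_int k = B r (u - of_int j + 6 * of_int k)" for j k
    using twist_path_int[OF assms, of u "- j + 6 * k"] by (simp add: algebra_simps)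
  then show ?thesis
    unfolding lattice_equiv_def using twist_path_inj[OF assms] by auto
qed

lemma twist_path_ends:
  assumes P: "twist_path n B q" and r: "r = 0 \<or> r = 1"
  shows "lattice_equiv u t (B r u) (t + q r)"
  using r
proof
  assume "r = 0"
  then show ?thesis using P lattice_equiv_refl by (simp add: twist_path_def)
next
  assume "r = 1"
  then show ?thesis using P unfolding twist_path_def lattice_equiv_def
    by (intro exI[of _ n] exI[of _ 0]) simp
qed

text \<open>Increasing functions that commute with the shift by 1 form a convex set.  This is why a twist is
  determined up to isotopy by \<open>n\<close> alone.\<close>

lemma twist_path_convex:
  assumes P: "twist_path n B q" and P': "twist_path n B' q'" and s: "s \<in> {0..1}"
  shows "twist_path n (\<lambda>r u. (1 - s) * B r u + s * B' r u) (\<lambda>r. (1 - s) * q r + s * q' r)"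
proof -
  have "strict_mono (\<lambda>u. (1 - s) * B r u + s * B' r u)" if r: "r \<in> {0..1}" for r
  proof (rule strict_monoI)
    fix x y :: real assume "x < y"
    then have "B r x < B r y" "B' r x < B' r y"
      using P P' r by (auto simp: twist_path_def strict_mono_def)
    then show "(1 - s) * B r x + s * B' r x < (1 - s) * B r y + s * B' r y"
      using s by (cases "s = 0") (auto intro!: add_le_less_mono mult_left_mono mult_strict_left_mono)
  qed
  moreover have "continuous_on ({0..1} \<times> UNIV) (\<lambda>(r, u). (1 - s) * B r u + s * B' r u)"
    using P P' unfolding twist_path_def case_prod_unfold by (intro continuous_intros) auto
  moreover have "continuous_on {0..1} (\<lambda>r. (1 - s) * q r + s * q' r)"
    using P P' unfolding twist_path_def by (intro continuous_intros) auto
  moreover have "(1 - s) * x + s * x = x" for x by (simp add: algebra_simps)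
  moreover have "(1 - s) * (x + 1) + s * (y + 1) = (1 - s) * x + s * y + 1" for x y
    by (simp add: algebra_simps)
  ultimately show ?thesis
    using P P' unfolding twist_path_def by simp
qed

lemma twist_path_compose:
  assumes P: "twist_path n B q" and P': "twist_path n' B' q'"
  shows "twist_path (n + n') (\<lambda>r u. B r (B' r u)) (\<lambda>r. q r + q' r)"
proof -
  have "continuous_on ({0..1} \<times> UNIV) (\<lambda>z. (\<lambda>(r, u). B r u) (fst z, (\<lambda>(r, u). B' r u) z))"
    by (rule continuous_on_compose2[of "{0..1} \<times> UNIV"])
      (use P P' in \<open>auto simp: twist_path_def intro!: continuous_intros\<close>)
  then have "continuous_on ({0..1} \<times> UNIV) (\<lambda>(r, u). B r (B' r u))"
    by (simp add: case_prod_unfold)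
  moreover have "continuous_on {0..1} (\<lambda>r. q r + q' r)"
    using P P' unfolding twist_path_def by (intro continuous_intros) auto
  moreover have "strict_mono (\<lambda>u. B r (B' r u))" if "r \<in> {0..1}" for r
    using P P' that unfolding twist_path_def strict_mono_def by blast
  ultimately show ?thesis
    using P P' unfolding twist_path_def by simp
qed

text \<open>The reparametrized path does all its twisting in the levels between \<open>a\<close> and \<open>b\<close>.\<close>

lemma twist_path_delay:
  assumes P: "twist_path n B q" and ab: "0 \<le> a" "a < b" "b \<le> 1"
  defines "\<phi> \<equiv> \<lambda>r. max 0 (min 1 ((r - a) / (b - a)))"
  shows "twist_path n (\<lambda>r. B (\<phi> r)) (\<lambda>r. q (\<phi> r))"
proof -
  have \<phi>: "\<phi> r \<in> {0..1}" for r unfolding \<phi>_def by auto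
  have \<phi>c: "continuous_on A \<phi>" for A
    unfolding \<phi>_def using ab by (intro continuous_intros) auto
  have \<phi>c': "continuous_on A (\<lambda>z. \<phi> (fst z))" for A :: "(real \<times> real) set"
    by (rule continuous_on_compose2[OF \<phi>c[of UNIV]]) (auto intro: continuous_intros)
  have "continuous_on ({0..1} \<times> UNIV) (\<lambda>z. (\<lambda>(r, u). B r u) (\<phi> (fst z), snd z))"
    by (rule continuous_on_compose2[of "{0..1} \<times> UNIV"])
      (use P \<phi> \<phi>c' in \<open>auto simp: twist_path_def simp del: atLeastAtMost_iff intro!: continuous_intros\<close>)
  moreover have "continuous_on {0..1} (\<lambda>r. q (\<phi> r))"
    by (rule continuous_on_compose2[of "{0..1}" q])
      (use P \<phi> \<phi>c in \<open>auto simp: twist_path_def simp del: atLeastAtMost_iff\<close>)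
  moreover have "\<phi> 0 = 0" "\<phi> 1 = 1"
    unfolding \<phi>_def using ab by (auto simp: max_def min_def field_simps)
  ultimately show ?thesis
    using P \<phi> unfolding twist_path_def by (auto simp: case_prod_unfold)
qed

lemma tubeD:
  assumes "tube M K"
  shows tube_continuous: "continuous_map (top_of_set (layers {0..1})) M K"
    and tube_lattice: "r \<in> {0..1} \<Longrightarrow> lattice_equiv u t u' t' \<Longrightarrow> K (u, t, r) = K (u', t', r)"
    and tube_inj: "r \<in> {0<..<1} \<Longrightarrow> r' \<in> {0..1} \<Longrightarrow> K (u, t, r) = K (u', t', r') \<Longrightarrow>
        r = r' \<and> lattice_equiv u t u' t'"
    and tube_open: "openin M (K ` (layers {0<..<1}))"
  using assms unfolding tube_def by blast+

lemma tube_in_space: "tube M K \<Longrightarrow> r \<in> {0..1} \<Longrightarrow> K (u, t, r) \<in> topspace M"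
  using tube_continuous[of M K] by (auto simp: continuous_map_def)

lemma tube_image_box:
  assumes K: "tube M K" and ab: "0 \<le> a" "b \<le> 1"
  shows "K ` (layers {a..b}) = K ` ({0..6} \<times> {0..1} \<times> {a..b})"
proof
  show "K ` (layers {a..b}) \<subseteq> K ` ({0..6} \<times> {0..1} \<times> {a..b})"
  proof clarify
    fix u t r :: real assume r: "r \<in> {a..b}"
    obtain u' t' where "u' \<in> {0..6}" "t' \<in> {0..1}" "lattice_equiv u t u' t'"
      by (rule lattice_equiv_box)
    moreover have "r \<in> {0..1}" using r ab by simp
    ultimately show "K (u, t, r) \<in> K ` ({0..6} \<times> {0..1} \<times> {a..b})"
      using tube_lattice[OF K] r by (intro image_eqI[of _ _ "(u', t', r)"]) auto
  qed
qed auto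

lemma tube_closed:
  assumes K: "tube M K" and M: "Hausdorff_space M" and ab: "0 \<le> a" "b \<le> 1"
  shows "closedin M (K ` (layers {a..b}))"
proof -
  have "compactin (top_of_set (layers {0..1})) ({0..6::real} \<times> {0..1::real} \<times> {a..b})"
    using ab by (auto simp: compactin_subtopology intro!: compact_Times)
  from image_compactin[OF this tube_continuous[OF K]] show ?thesis
    using compactin_imp_closedin[OF M] by (simp add: tube_image_box[OF K ab])
qed

lemma tube_eq_cases:
  assumes K: "tube M K" and r: "r \<in> {0..1}" "r' \<in> {0..1}" and eq: "K (u, t, r) = K (u', t', r')"
  obtains "r = r'" "lattice_equiv u t u' t'" | "r = 0 \<or> r = 1" "r' = 0 \<or> r' = 1"
  using tube_inj[OF K, of r r' u t u' t'] tube_inj[OF K, of r' r u' t' u t] eq r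
  by fastforce

lemma tube_twist_ends:
  assumes K: "tube M K" and P: "twist_path n B q" and r: "r = 0 \<or> r = 1"
  shows "K (B r u, t + q r, r) = K (u, t, r)"
  using tube_lattice[OF K, OF _ twist_path_ends[OF P r, of u t]] r by auto

lemma twist_along_tube:
  assumes K: "tube M K" and P: "twist_path n B q" and r: "r \<in> {0..1}"
  shows "twist_along K B q (K (u, t, r)) = K (B r u, t + q r, r)"
proof -
  have "y = K (B r u, t + q r, r)"
    if r': "r' \<in> {0..1}" and eq: "K (u, t, r) = K (u', t', r')" and y: "y = K (B r' u', t' + q r', r')"
    for y u' t' r'
    using K r r' eq
  proof (cases rule: tube_eq_cases)
    case 1
    then show ?thesis
      using tube_lattice[OF K r] lattice_equiv_twist_path[OF P r] y by metis
  next
    case 2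
    then show ?thesis using tube_twist_ends[OF K P] eq y by metis
  qed
  then have uniq: "y = K (B r u, t + q r, r)"
    if "\<exists>u' t' r'. r' \<in> {0..1} \<and> K (u, t, r) = K (u', t', r') \<and> y = K (B r' u', t' + q r', r')" for y
    using that by blast
  have img: "K (u, t, r) \<in> K ` (layers {0..1})" using r by auto
  show ?thesis
    unfolding twist_along_def if_P[OF img]
  proof (rule some_equality)
    show "\<exists>u' t' r'. r' \<in> {0..1} \<and> K (u, t, r) = K (u', t', r')
        \<and> K (B r u, t + q r, r) = K (B r' u', t' + q r', r')"
      using r by blast
  qed (rule uniq)
qed

lemma twist_along_outside:
  assumes K: "tube M K" and P: "twist_path n B q" and m: "m \<notin> K ` (layers {0<..<1})"
  shows "twist_along K B q m = m"
proof (cases "m \<in> K ` (layers {0..1})")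
  case True
  then obtain u t r where r: "r \<in> {0..1}" "m = K (u, t, r)" by auto
  then have "r \<notin> {0<..<1}" using m by auto
  then have "r = 0 \<or> r = 1" using r by auto
  then show ?thesis
    using twist_along_tube[OF K P r(1)] tube_twist_ends[OF K P] r by simp
qed (simp add: twist_along_def)

lemma twist_along_bij:
  assumes K: "tube M K" and P: "twist_path n B q"
  shows "bij_betw (twist_along K B q) (topspace M) (topspace M)"
proof -
  let ?A = "K ` (layers {0..1})" and ?h = "twist_along K B q"
  have A: "?A \<subseteq> topspace M" using tube_in_space[OF K] by auto
  have inA: "?h m \<in> ?A" if "m \<in> ?A" for m
    using that twist_along_tube[OF K P] by auto
  have out: "?h m = m" if "m \<notin> ?A" for m
    using that by (simp add: twist_along_def)
  have "?A \<subseteq> ?h ` ?A"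
  proof clarify
    fix u t r :: real assume r: "r \<in> {0..1}"
    obtain x where "B r x = u" using twist_path_surj[OF P r] .
    then have "K (u, t, r) = ?h (K (x, t - q r, r))"
      using twist_along_tube[OF K P r] by simp
    then show "K (u, t, r) \<in> ?h ` ?A" using r by blast
  qed
  then have "?h ` topspace M = topspace M"
  proof (intro equalityI subsetI)
    fix m assume "m \<in> ?h ` topspace M"
    then obtain x where x: "x \<in> topspace M" "m = ?h x" by blast
    then show "m \<in> topspace M" using A inA[of x] out[of x] by (cases "x \<in> ?A") auto
  next
    fix m assume "m \<in> topspace M"
    then show "m \<in> ?h ` topspace M"
      using \<open>?A \<subseteq> ?h ` ?A\<close> A out[of m] image_mono[OF A, of ?h] by (cases "m \<in> ?A") (blast, metis imageI)
  qed
  moreover have "inj_on ?h ?A"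
  proof (rule inj_onI, clarify)
    fix u t r u' t' r' :: real
    assume r: "r \<in> {0..1}" "r' \<in> {0..1}" and "?h (K (u, t, r)) = ?h (K (u', t', r'))"
    then have eq: "K (B r u, t + q r, r) = K (B r' u', t' + q r', r')"
      using twist_along_tube[OF K P] by simp
    show "K (u, t, r) = K (u', t', r')"
      using K r eq
    proof (cases rule: tube_eq_cases)
      case 1
      then show ?thesis
        using tube_lattice[OF K r(1)] lattice_equiv_twist_path[OF P r(1)] by metis
    next
      case 2
      then show ?thesis using tube_twist_ends[OF K P] eq by metis
    qed
  qed
  then have "inj_on ?h (topspace M)"
    using inA out unfolding inj_on_def by metis
  ultimately show ?thesis by (simp add: bij_betw_def)
qed

text \<open>The straight line between the two paths consists of twist paths.  Continuity in the parameter
  and the point is checked on two closed sets: the image of the tube, which is a quotient of a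
  compact box of coordinates, and the complement of the interior levels, where nothing moves.\<close>

lemma twist_along_isotopic:
  assumes M: "compact_space M" "Hausdorff_space M" and K: "tube M K"
    and P: "twist_path n B q" and P': "twist_path n B' q'" and V: "V \<subseteq> topspace M"
  shows "isotopic_in M (twist_along K B q ` V) (twist_along K B' q' ` V)"
proof -
  define C where "C s r u = (1 - s) * B r u + s * B' r u" for s r u
  define p where "p s r = (1 - s) * q r + s * q' r" for s r
  have C: "twist_path n (C s) (p s)" if "s \<in> {0..1}" for s
    using twist_path_convex[OF P P' that] unfolding C_def p_def .
  let ?I = "top_of_set {0..1::real}" and ?A = "K ` (layers {0..1})"
  let ?U = "K ` (layers {0<..<1})" and ?G = "\<lambda>(s, m). twist_along K (C s) (p s) m"
  have A: "closedin M ?A" by (rule tube_closed[OF K M(2)]) auto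
  have "continuous_map (prod_topology ?I M) M ?G"
  proof (rule continuous_map_union_closed)
    show "closedin (prod_topology ?I M) ({0..1} \<times> ?A)"
      using A by (simp add: closedin_prod_Times_iff)
    show "closedin (prod_topology ?I M) ({0..1} \<times> (topspace M - ?U))"
      using tube_open[OF K] by (simp add: closedin_prod_Times_iff closedin_diff)
    show "topspace (prod_topology ?I M) \<subseteq> {0..1} \<times> ?A \<union> {0..1} \<times> (topspace M - ?U)"
      by auto
    have "continuous_map (subtopology (prod_topology ?I M) ({0..1} \<times> (topspace M - ?U))) M snd"
      by (intro continuous_map_from_subtopology continuous_map_snd)
    then show "continuous_map (subtopology (prod_topology ?I M) ({0..1} \<times> (topspace M - ?U))) M ?G"
      by (rule continuous_map_eq) (use twist_along_outside[OF K C] in auto)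
    let ?Z = "{0..1::real} \<times> {0..6::real} \<times> {0..1::real} \<times> {0..1::real}"
    let ?k = "\<lambda>(s, u, t, r). (s, K (u, t, r))"
    have k: "continuous_map (top_of_set ?Z) M (\<lambda>z. K (snd z))"
      by (rule continuous_map_compose_on[OF tube_continuous[OF K]]) (auto intro!: continuous_intros)
    show "continuous_map (subtopology (prod_topology ?I M) ({0..1} \<times> ?A)) M ?G"
    proof (rule continuous_map_induced)
      show "compact_space (top_of_set ?Z)"
        by (simp add: compact_space_subtopology compact_Times)
      show "Hausdorff_space (subtopology (prod_topology ?I M) ({0..1} \<times> ?A))"
        using M(2) by (simp add: Hausdorff_space_subtopology Hausdorff_space_prod_topology)
      have "continuous_map (top_of_set ?Z) ?I fst"
        by (simp add: continuous_map_in_subtopology continuous_on_fst Pi_iff)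
      then have "continuous_map (top_of_set ?Z) (prod_topology ?I M) (\<lambda>z. (fst z, K (snd z)))"
        using k by (intro continuous_map_pairedI)
      then show "continuous_map (top_of_set ?Z) (subtopology (prod_topology ?I M) ({0..1} \<times> ?A)) ?k"
        by (auto simp: continuous_map_in_subtopology case_prod_unfold)
      have "?k ` ?Z = {0..1} \<times> K ` ({0..6} \<times> {0..1} \<times> {0..1})"
        by force
      then show "?k ` topspace (top_of_set ?Z) = topspace (subtopology (prod_topology ?I M) ({0..1} \<times> ?A))"
        using tube_image_box[OF K, of 0 1] tube_in_space[OF K] by auto
      have "continuous_on ?Z (\<lambda>z. (\<lambda>(r, u). B r u) (snd (snd (snd z)), fst (snd z)))"
        by (rule continuous_on_compose2[of "{0..1} \<times> UNIV"])
          (use P in \<open>auto simp: twist_path_def intro!: continuous_intros\<close>)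
      moreover have "continuous_on ?Z (\<lambda>z. (\<lambda>(r, u). B' r u) (snd (snd (snd z)), fst (snd z)))"
        by (rule continuous_on_compose2[of "{0..1} \<times> UNIV"])
          (use P' in \<open>auto simp: twist_path_def intro!: continuous_intros\<close>)
      moreover have "continuous_on ?Z (\<lambda>z. q (snd (snd (snd z))))"
        by (rule continuous_on_compose2[of "{0..1}" q])
          (use P in \<open>auto simp: twist_path_def intro!: continuous_intros\<close>)
      moreover have "continuous_on ?Z (\<lambda>z. q' (snd (snd (snd z))))"
        by (rule continuous_on_compose2[of "{0..1}" q'])
          (use P' in \<open>auto simp: twist_path_def intro!: continuous_intros\<close>)
      ultimately have "continuous_on ?Z (\<lambda>(s, u, t, r). (C s r u, t + p s r, r))"
        unfolding C_def p_def case_prod_unfold by (intro continuous_intros) auto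
      then have "continuous_map (top_of_set ?Z) M (\<lambda>z. K ((\<lambda>(s, u, t, r). (C s r u, t + p s r, r)) z))"
        by (rule continuous_map_compose_on[OF tube_continuous[OF K]]) auto
      then show "continuous_map (top_of_set ?Z) M (\<lambda>z. ?G (?k z))"
        by (rule continuous_map_eq) (use twist_along_tube[OF K C] in auto)
    qed
  qed
  from isotopic_in_family[OF M this twist_along_bij[OF K C] V]
  show ?thesis
    by (simp add: C_def[abs_def] p_def[abs_def])
qed

text \<open>The image of the levels between \<open>a\<close> and \<open>b\<close> is open because it arises from the open image of all
  interior levels by removing the compact images of the levels up to \<open>a\<close> and from \<open>b\<close> on.\<close>

lemma subtube:
  assumes K: "tube M K" and M: "Hausdorff_space M" and ab: "0 \<le> a" "a < b" "b \<le> 1"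
  shows "tube M (\<lambda>(u, t, r). K (u, t, a + (b - a) * r))"
proof -
  have r: "a + (b - a) * r \<in> {a..b}" if "r \<in> {0..1}" for r
  proof -
    have "(b - a) * r \<le> b - a" using that ab by (intro mult_left_le) auto
    moreover have "0 \<le> (b - a) * r" using that ab by simp
    ultimately show ?thesis by simp
  qed
  then have r01: "a + (b - a) * r \<in> {0..1}" if "r \<in> {0..1}" for r
    using that ab by force
  have ro: "a + (b - a) * r \<in> {a<..<b}" if "r \<in> {0<..<1}" for r
  proof -
    have "(b - a) * r < (b - a) * 1" using that ab by (intro mult_strict_left_mono) auto
    then have "(b - a) * r < b - a" by (simp only: mult_1_right)
    moreover have "0 < (b - a) * r" using that ab by simp
    ultimately have "a < a + (b - a) * r" "a + (b - a) * r < b" by linarith+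
    then show ?thesis unfolding greaterThanLessThan_iff by blast
  qed
  have cont: "continuous_map (top_of_set (layers {0..1})) M (\<lambda>z. K ((\<lambda>(u, t, r). (u, t, a + (b - a) * r)) z))"
    by (rule continuous_map_compose_on[OF tube_continuous[OF K]])
      (use r01 in \<open>auto simp: case_prod_unfold simp del: atLeastAtMost_iff intro!: continuous_intros\<close>)
  have img: "(\<lambda>(u, t, r). K (u, t, a + (b - a) * r)) ` (layers {0<..<1})
      = K ` (layers {a<..<b})"
  proof
    show "K ` (layers {a<..<b}) \<subseteq> (\<lambda>(u, t, r). K (u, t, a + (b - a) * r)) ` (layers {0<..<1})"
    proof clarify
      fix u t r :: real assume r: "r \<in> {a<..<b}"
      have "a + (b - a) * ((r - a) / (b - a)) = r" "(r - a) / (b - a) \<in> {0<..<1}"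
        using r ab by (auto simp: field_simps)
      then show "K (u, t, r) \<in> (\<lambda>(u, t, r). K (u, t, a + (b - a) * r)) ` (layers {0<..<1})"
        by (intro image_eqI[of _ _ "(u, t, (r - a) / (b - a))"]) auto
    qed
  qed (use ro in auto)
  have "K ` (layers {a<..<b}) =
      K ` (layers {0<..<1}) - (K ` (layers {0..a}) \<union> K ` (layers {b..1}))"
    (is "?L = ?R")
  proof
    show "?L \<subseteq> ?R"
    proof
      fix m assume "m \<in> ?L"
      then obtain u t r where r: "r \<in> {a<..<b}" and m: "m = K (u, t, r)" by auto
      then have r01: "r \<in> {0<..<1}" using ab by auto
      have "m \<noteq> K (u', t', r')" if "r' \<in> {0..a} \<union> {b..1}" for u' t' r'
        using tube_inj[OF K r01, of r' u t u' t'] that r ab unfolding m by auto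
      then have "m \<notin> K ` (layers {0..a})" "m \<notin> K ` (layers {b..1})"
        by blast+
      moreover have "m \<in> K ` (layers {0<..<1})" using r01 m by blast
      ultimately show "m \<in> ?R" by blast
    qed
    show "?R \<subseteq> ?L" by force
  qed
  also have "openin M \<dots>"
    using ab by (intro openin_diff closedin_Un tube_closed[OF K M] tube_open[OF K]) auto
  finally have op: "openin M (K ` (layers {a<..<b}))" .
  show ?thesis
    unfolding tube_def
  proof (intro conjI allI impI)
    show "continuous_map (top_of_set (layers {0..1})) M (\<lambda>(u, t, r). K (u, t, a + (b - a) * r))"
      using cont by (simp add: case_prod_unfold)
  next
    fix u t r u' t' r' :: real
    assume *: "r \<in> {0<..<1}" "r' \<in> {0..1}"
      "(case (u, t, r) of (u, t, r) \<Rightarrow> K (u, t, a + (b - a) * r)) =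
       (case (u', t', r') of (u, t, r) \<Rightarrow> K (u, t, a + (b - a) * r))"
    have "a + (b - a) * r \<in> {0<..<1}" using ro[OF *(1)] ab by auto
    from tube_inj[OF K this r01[OF *(2)]] * ab
    show "r = r'" "lattice_equiv u t u' t'" by auto
  qed (use tube_lattice[OF K] r01 op img in auto)
qed

text \<open>A twist along part of a tube is a twist along the whole tube with a delayed path.\<close>

lemma twist_along_subtube_isotopic:
  assumes M: "compact_space M" "Hausdorff_space M" and K: "tube M K" and ab: "0 \<le> a" "a < b" "b \<le> 1"
    and P: "twist_path n B q" and P': "twist_path n B' q'" and V: "V \<subseteq> topspace M"
  shows "isotopic_in M (twist_along K B' q' ` V)
      (twist_along (\<lambda>(u, t, r). K (u, t, a + (b - a) * r)) B q ` V)"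
    and "isotopic_in M (twist_along (\<lambda>(u, t, r). K (u, t, a + (b - a) * r)) B q ` V)
      (twist_along K B' q' ` V)"
proof -
  define \<phi> where "\<phi> r = max 0 (min 1 ((r - a) / (b - a)))" for r
  let ?K = "\<lambda>(u, t, r). K (u, t, a + (b - a) * r)"
  have D: "twist_path n (\<lambda>r. B (\<phi> r)) (\<lambda>r. q (\<phi> r))"
    unfolding \<phi>_def using twist_path_delay[OF P ab] .
  have K': "tube M ?K" by (rule subtube[OF K M(2) ab])
  have r01: "a + (b - a) * r \<in> {0..1}" if "r \<in> {0..1}" for r
  proof -
    have "(b - a) * r \<le> b - a" using that ab by (intro mult_left_le) auto
    moreover have "0 \<le> (b - a) * r" using that ab by simp
    ultimately have "0 \<le> a + (b - a) * r" "a + (b - a) * r \<le> 1" using ab by linarith+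
    then show ?thesis by simp
  qed
  have eq: "twist_along K (\<lambda>r. B (\<phi> r)) (\<lambda>r. q (\<phi> r)) m = twist_along ?K B q m" for m
  proof (cases "m \<in> ?K ` (layers {0..1})")
    case True
    then obtain u t r where r: "r \<in> {0..1}" and m: "m = K (u, t, a + (b - a) * r)" by auto
    have "\<phi> (a + (b - a) * r) = r" using r ab unfolding \<phi>_def by auto
    then show ?thesis
      using twist_along_tube[OF K D r01[OF r], of u t] twist_along_tube[OF K' P r, of u t] m by simp
  next
    case False
    show ?thesis
    proof (cases "m \<in> K ` (layers {0..1})")
      case True
      then obtain u t r where r: "r \<in> {0..1}" and m: "m = K (u, t, r)" by auto
      have "r \<notin> {a..b}"
      proof
        assume "r \<in> {a..b}"
        then have "(r - a) / (b - a) \<in> {0..1}" "a + (b - a) * ((r - a) / (b - a)) = r"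
          using ab by (auto simp: field_simps)
        then have "m \<in> ?K ` (layers {0..1})"
          using m by (intro image_eqI[of _ _ "(u, t, (r - a) / (b - a))"]) auto
        with False show False by simp
      qed
      then have "\<phi> r = 0 \<or> \<phi> r = 1" using ab unfolding \<phi>_def by (auto simp: max_def min_def field_simps)
      then have "K (B (\<phi> r) u, t + q (\<phi> r), r) = K (u, t, r)"
        using tube_lattice[OF K r twist_path_ends[OF P]] by metis
      then show ?thesis
        using twist_along_tube[OF K D r, of u t] False m by (simp add: twist_along_def)
    qed (use False in \<open>simp add: twist_along_def\<close>)
  qed
  show "isotopic_in M (twist_along K B' q' ` V) (twist_along ?K B q ` V)"
    using twist_along_isotopic[OF M K P' D V] by (simp add: eq)
  show "isotopic_in M (twist_along ?K B q ` V) (twist_along K B' q' ` V)"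
    using twist_along_isotopic[OF M K D P' V] by (simp add: eq)
qed

lemma tube_reverse:
  assumes K: "tube M K"
  shows "tube M (\<lambda>(u, t, r). K (u, t, 1 - r))"
proof -
  have cont: "continuous_map (top_of_set (layers {0..1})) M (\<lambda>z. K ((\<lambda>(u, t, r). (u, t, 1 - r)) z))"
    by (rule continuous_map_compose_on[OF tube_continuous[OF K]])
      (auto simp: case_prod_unfold intro!: continuous_intros)
  have img: "(\<lambda>(u, t, r). K (u, t, 1 - r)) ` (layers {0<..<1}) = K ` (layers {0<..<1})"
  proof
    show "K ` (layers {0<..<1}) \<subseteq> (\<lambda>(u, t, r). K (u, t, 1 - r)) ` (layers {0<..<1})"
    proof clarify
      fix u t r :: real assume "r \<in> {0<..<1}"
      then show "K (u, t, r) \<in> (\<lambda>(u, t, r). K (u, t, 1 - r)) ` (layers {0<..<1})"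
        by (intro image_eqI[of _ _ "(u, t, 1 - r)"]) auto
    qed
  qed auto
  show ?thesis
    unfolding tube_def
  proof (intro conjI allI impI)
    show "continuous_map (top_of_set (layers {0..1})) M (\<lambda>(u, t, r). K (u, t, 1 - r))"
      using cont by (simp add: case_prod_unfold)
  next
    fix u t r u' t' r' :: real
    assume *: "r \<in> {0<..<1}" "r' \<in> {0..1}"
      "(case (u, t, r) of (u, t, r) \<Rightarrow> K (u, t, 1 - r)) =
       (case (u', t', r') of (u, t, r) \<Rightarrow> K (u, t, 1 - r))"
    then show "r = r'" "lattice_equiv u t u' t'"
      using tube_inj[OF K, of "1 - r" "1 - r'" u t u' t'] by auto
  qed (use tube_lattice[OF K] tube_open[OF K] img in auto)
qed

text \<open>The tube fills a whole one-sided neighbourhood of its end level: where \<open>f\<close> is positive and smaller than on the far end of the tube, the image of the interior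
  levels is both open and closed, and this region is connected.\<close>

lemma tube_one_sided_neighbourhood:
  assumes M: "Hausdorff_space M" and K: "tube M K"
    and f: "continuous_map M euclideanreal f"
    and f1: "\<And>u t. f (K (u, t, 1)) = 0"
    and fpos: "\<And>u t r. 0 \<le> r \<Longrightarrow> r < 1 \<Longrightarrow> 0 < f (K (u, t, r))"
    and conn: "\<And>e. 0 < e \<Longrightarrow> e \<le> 1 \<Longrightarrow> connectedin M {m \<in> topspace M. 0 < f m \<and> f m < e}"
  obtains e where "0 < e" "{m \<in> topspace M. 0 < f m \<and> f m < e} \<subseteq> K ` (layers {0<..<1})"
proof -
  let ?U = "K ` (layers {0<..<1})" and ?A = "K ` (layers {0..1})"
  have fK: "continuous_map (top_of_set (layers {0..1})) euclideanreal (\<lambda>z. f (K z))"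
    using continuous_map_compose[OF tube_continuous[OF K] f] by (simp add: o_def)
  then have fKc: "continuous_on (layers {0..1}) (\<lambda>z. f (K z))" by simp
  obtain z0 where z0: "z0 \<in> {0..6} \<times> {0..1} \<times> {0}"
    and min: "\<forall>z\<in>{0..6} \<times> {0..1} \<times> {0}. f (K z0) \<le> f (K z)"
  proof -
    have "compact ({0..6::real} \<times> {0..1::real} \<times> {0::real})" by (intro compact_Times) auto
    moreover have "{0..6::real} \<times> {0..1::real} \<times> {0::real} \<noteq> {}" by auto
    moreover have "continuous_on ({0..6} \<times> {0..1} \<times> {0}) (\<lambda>z. f (K z))"
      by (rule continuous_on_subset[OF fKc]) auto
    ultimately show ?thesis using continuous_attains_inf that by metis
  qed
  \<comment> \<open>\<open>e\<close> is at most the minimum of \<open>f\<close> on the far end, attained at \<open>z0\<close>.\<close>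
  define e where "e = min 1 (f (K z0))"
  have e: "0 < e" "e \<le> 1" using z0 fpos unfolding e_def by auto
  have ge: "e \<le> f (K (u, t, 0))" for u t
  proof -
    obtain u' t' where *: "u' \<in> {0..6}" "t' \<in> {0..1}" "lattice_equiv u t u' t'"
      by (rule lattice_equiv_box)
    then show ?thesis
      using min tube_lattice[OF K _ *(3), of 0] unfolding e_def by force
  qed
  let ?R = "{m \<in> topspace M. 0 < f m \<and> f m < e}"
  have RA: "?R \<inter> ?A = ?R \<inter> ?U"
  proof -
    have "r \<in> {0<..<1}" if "r \<in> {0..1}" "0 < f (K (u, t, r))" "f (K (u, t, r)) < e" for u t r
      using that ge[of u t] f1[of u t] by (cases "r = 0 \<or> r = 1") auto
    then show ?thesis by (auto intro!: imageI)
  qed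
  have "openin (subtopology M ?R) (?R \<inter> ?U)"
    using tube_open[OF K] by (rule openin_subtopology_Int2)
  moreover have "closedin (subtopology M ?R) (?R \<inter> ?U)"
    unfolding RA[symmetric] by (intro closedin_subtopology_Int_closed tube_closed[OF K M]) auto
  moreover have "connected_space (subtopology M ?R)"
    using conn[OF e] by (simp add: connectedin_def)
  ultimately have "?R \<inter> ?U = {} \<or> ?R \<inter> ?U = topspace (subtopology M ?R)"
    unfolding connected_space_clopen_in by blast
  moreover have "?R \<inter> ?U \<noteq> {}"
  proof -
    have "continuous_on {0..1} (\<lambda>r. f (K (0, 0, r)))"
      by (rule continuous_on_compose2[OF fKc]) (auto intro!: continuous_intros)
    then have "\<exists>r\<ge>0. r \<le> 1 \<and> f (K (0, 0, r)) = e / 2"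
      using ge[of 0 0] e f1 by (intro IVT2') auto
    then obtain r where r: "0 \<le> r" "r \<le> 1" "f (K (0, 0, r)) = e / 2" by blast
    then have "K (0, 0, r) \<in> ?R \<inter> ?A"
      using e tube_in_space[OF K] by auto
    then show ?thesis using RA by auto
  qed
  ultimately have "?R \<subseteq> ?U" by auto
  with that e show ?thesis by blast
qed

text \<open>Two tubes that meet in their common end level \<open>f = 0\<close> and lie on different sides of it form
  one tube.  The point is that the joint interior is open near the common level.\<close>

lemma tube_join:
  assumes M: "Hausdorff_space M" and K: "tube M K" and K': "tube M K'"
    and f: "continuous_map M euclideanreal f"
    and conn: "\<And>e. 0 < e \<Longrightarrow> e \<le> 1 \<Longrightarrow> connectedin M {m \<in> topspace M. 0 < f m \<and> f m < e}"
      "\<And>e. 0 < e \<Longrightarrow> e \<le> 1 \<Longrightarrow> connectedin M {m \<in> topspace M. 0 < - f m \<and> - f m < e}"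
    and f0: "\<And>m. m \<in> topspace M \<Longrightarrow> f m = 0 \<Longrightarrow> \<exists>u t. m = K (u, t, 1)"
    and K1: "\<And>u t. f (K (u, t, 1)) = 0" "\<And>u t. K' (u, t, 0) = K (u, t, 1)"
    and fK: "\<And>u t r. 0 \<le> r \<Longrightarrow> r < 1 \<Longrightarrow> f (K (u, t, r)) < 0"
    and fK': "\<And>u t r. 0 < r \<Longrightarrow> r \<le> 1 \<Longrightarrow> 0 < f (K' (u, t, r))"
    and inj: "\<And>u t u' t'. K (u, t, 1) = K (u', t', 1) \<Longrightarrow> lattice_equiv u t u' t'"
  defines "J \<equiv> \<lambda>(u, t, r). if r \<le> 1/2 then K (u, t, 2 * r) else K' (u, t, 2 * r - 1)"
  shows "tube M J"
  unfolding tube_def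
proof (intro conjI allI impI)
  let ?X = "top_of_set (layers {0..1}) :: (real \<times> real \<times> real) topology"
  have J1: "J (u, t, r) = K (u, t, 2 * r)" if "r \<le> 1/2" for u t r
    using that by (simp add: J_def)
  have J2: "J (u, t, r) = K' (u, t, 2 * r - 1)" if "r \<ge> 1/2" for u t r
  proof (cases "r \<le> 1/2")
    case True
    then have r: "r = 1/2" using that by simp
    show ?thesis unfolding r by (simp add: J_def K1(2))
  qed (simp add: J_def)
  show "continuous_map ?X M J"
  proof (rule continuous_map_union_closed)
    show "closedin ?X (layers {0..1/2})" "closedin ?X (layers {1/2..1})"
      by (auto intro!: closed_subset closed_Times)
    show "topspace ?X \<subseteq> UNIV \<times> UNIV \<times> {0..1/2} \<union> UNIV \<times> UNIV \<times> {1/2..1}" by auto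
    have "continuous_map (top_of_set (layers {0..1/2})) M (\<lambda>z. K ((\<lambda>(u, t, r). (u, t, 2 * r)) z))"
      by (rule continuous_map_compose_on[OF tube_continuous[OF K]])
        (auto simp: case_prod_unfold intro!: continuous_intros)
    moreover have "subtopology ?X (layers {0..1/2}) = top_of_set (layers {0..1/2})"
      by (simp add: subtopology_subtopology Times_Int_Times)
    ultimately have "continuous_map (subtopology ?X (layers {0..1/2})) M
        (\<lambda>z. K ((\<lambda>(u, t, r). (u, t, 2 * r)) z))" by simp
    then show "continuous_map (subtopology ?X (layers {0..1/2})) M J"
      by (rule continuous_map_eq) (use J1 in auto)
    have "continuous_map (top_of_set (layers {1/2..1})) M (\<lambda>z. K' ((\<lambda>(u, t, r). (u, t, 2 * r - 1)) z))"
      by (rule continuous_map_compose_on[OF tube_continuous[OF K']])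
        (auto simp: case_prod_unfold intro!: continuous_intros)
    moreover have "subtopology ?X (layers {1/2..1}) = top_of_set (layers {1/2..1})"
      by (simp add: subtopology_subtopology Times_Int_Times)
    ultimately have "continuous_map (subtopology ?X (layers {1/2..1})) M
        (\<lambda>z. K' ((\<lambda>(u, t, r). (u, t, 2 * r - 1)) z))" by simp
    then show "continuous_map (subtopology ?X (layers {1/2..1})) M J"
      by (rule continuous_map_eq) (use J2 in auto)
  qed
  show "J (u, t, r) = J (u', t', r)" if "r \<in> {0..1}" "lattice_equiv u t u' t'" for u t u' t' r
    using that tube_lattice[OF K _ that(2), of "2 * r"] tube_lattice[OF K' _ that(2), of "2 * r - 1"]
    by (cases "r \<le> 1/2") (auto simp: J_def)
  have sgn: "sgn (f (J (u, t, r))) = sgn (r - 1/2)" if "r \<in> {0..1}" for u t r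
  proof (cases r "1/2 :: real" rule: linorder_cases)
    case less
    then show ?thesis using that fK[of "2 * r" u t] J1[of r u t] by simp
  next
    case equal
    show ?thesis unfolding equal using K1(1)[of u t] J1[of "1/2" u t] by simp
  next
    case greater
    then show ?thesis using that fK'[of "2 * r - 1" u t] J2[of r u t] by simp
  qed
  have "r = r' \<and> lattice_equiv u t u' t'"
    if r: "r \<in> {0<..<1}" "r' \<in> {0..1}" and eq: "J (u, t, r) = J (u', t', r')" for u t r u' t' r'
  proof -
    have s: "sgn (r - 1/2) = sgn (r' - 1/2)"
      using sgn[of r u t] sgn[of r' u' t'] eq r by simp
    consider "r < 1/2" | "r = 1/2" | "1/2 < r" by linarith
    then show ?thesis
    proof cases
      case 1
      then have "r' < 1/2" using s by (auto simp: sgn_if split: if_splits)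
      then show ?thesis
        using tube_inj[OF K, of "2 * r" "2 * r'" u t u' t'] eq r 1 J1 by auto
    next
      case 2
      then have "r' = 1/2" using s by (auto simp: sgn_if split: if_splits)
      then have "K (u, t, 1) = K (u', t', 1)" 
        using eq J1[of "1/2" u t] J1[of "1/2" u' t'] unfolding 2 \<open>r' = 1/2\<close> by simp
      then show ?thesis using inj \<open>r' = 1/2\<close> 2 by blast
    next
      case 3
      then have "r' > 1/2" using s by (auto simp: sgn_if split: if_splits)
      then show ?thesis
        using tube_inj[OF K', of "2 * r - 1" "2 * r' - 1" u t u' t'] eq r 3 J2 by auto
    qed
  qed
  then show "r = r'" "lattice_equiv u t u' t'"
    if "r \<in> {0<..<1}" "r' \<in> {0..1}" "J (u, t, r) = J (u', t', r')" for u t r u' t' r'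
    using that by blast+
  let ?U = "K ` (layers {0<..<1})" and ?U' = "K' ` (layers {0<..<1})"
  obtain e where e: "0 < e" "{m \<in> topspace M. 0 < - f m \<and> - f m < e} \<subseteq> ?U"
    using tube_one_sided_neighbourhood[OF M K, of "\<lambda>m. - f m"] f K1 fK conn(2)
    by (auto intro: continuous_map_minus)
  obtain e' where e': "0 < e'" "{m \<in> topspace M. 0 < f m \<and> f m < e'}
      \<subseteq> (\<lambda>(u, t, r). K' (u, t, 1 - r)) ` (layers {0<..<1})"
    using tube_one_sided_neighbourhood[OF M tube_reverse[OF K'] f] K1 fK' conn(1) by auto
  have "(\<lambda>(u, t, r). K' (u, t, 1 - r)) ` (layers {0<..<1}) \<subseteq> ?U'" by auto
  then have e'': "{m \<in> topspace M. 0 < f m \<and> f m < e'} \<subseteq> ?U'" using e'(2) by blast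
  let ?W = "{m \<in> topspace M. f m \<in> {-e<..<e'}}"
  have UJ: "?U \<subseteq> J ` (layers {0<..<1})"
  proof clarify
    fix u t r :: real assume "r \<in> {0<..<1}"
    then show "K (u, t, r) \<in> J ` (layers {0<..<1})"
      using J1[of "r / 2" u t] by (intro image_eqI[of _ _ "(u, t, r / 2)"]) auto
  qed
  have UJ': "?U' \<subseteq> J ` (layers {0<..<1})"
  proof clarify
    fix u t r :: real assume "r \<in> {0<..<1}"
    then show "K' (u, t, r) \<in> J ` (layers {0<..<1})"
      using J2[of "(r + 1) / 2" u t]
      by (intro image_eqI[of _ _ "(u, t, (r + 1) / 2)"]) (auto simp: field_simps)
  qed
  have TJ: "K (u, t, 1) \<in> J ` (layers {0<..<1})" for u t
    using J1[of "1 / 2" u t] by (intro image_eqI[of _ _ "(u, t, 1 / 2)"]) auto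
  have "J ` (layers {0<..<1}) = ?U \<union> ?U' \<union> ?W"
  proof (intro equalityI subsetI)
    fix m assume "m \<in> ?U \<union> ?U' \<union> ?W"
    moreover have "m \<in> J ` (layers {0<..<1})" if "m \<in> ?W"
    proof (cases "f m" "0 :: real" rule: linorder_cases)
      case less
      then have "m \<in> {m \<in> topspace M. 0 < - f m \<and> - f m < e}" using that by auto
      then show ?thesis using e(2) UJ by blast
    next
      case equal
      then show ?thesis using that f0[of m] TJ by auto
    next
      case greater
      then have "m \<in> {m \<in> topspace M. 0 < f m \<and> f m < e'}" using that by auto
      then show ?thesis using e'' UJ' by blast
    qed
    ultimately show "m \<in> J ` (layers {0<..<1})" using UJ UJ' by blast
  next
    fix m assume "m \<in> J ` (layers {0<..<1})"
    then obtain u t r where r: "r \<in> {0<..<1}" and m: "m = J (u, t, r)" by auto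
    consider "r < 1/2" | "r = 1/2" | "1/2 < r" by linarith
    then show "m \<in> ?U \<union> ?U' \<union> ?W"
    proof cases
      case 1
      then have "m \<in> ?U" using r m J1 by auto
      then show ?thesis by blast
    next
      case 2
      have "m = K (u, t, 1)" using m J1[of "1/2" u t] unfolding 2 by simp
      then have "m \<in> ?W"
        using K1(1) e(1) e'(1) tube_in_space[OF K, of 1 u t] by auto
      then show ?thesis by blast
    next
      case 3
      then have "m \<in> ?U'" using r m J2 by auto
      then show ?thesis by blast
    qed
  qed
  moreover have "openin M ?W" by (rule openin_continuous_map_preimage[OF f]) simp
  ultimately show "openin M (J ` (layers {0<..<1}))"
    using tube_open[OF K] tube_open[OF K'] by (simp add: openin_Un)
qed

section \<open>Separating functions on the surface and the mapping torus\<close>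

lemma cls_eq_imp_eq:
  assumes "\<And>p q. R p q \<Longrightarrow> f p = f q" "cls R x = cls R y"
  shows "f x = f y"
proof -
  have "equivclp R x y" using assms(2) by (simp add: cls_eq_iff)
  then show ?thesis
  proof (induction rule: equivclp_induct)
    case (step y z)
    then show ?case using assms(1)[of y z] assms(1)[of z y] by auto
  qed simp
qed

lemma self_in_cls: "x \<in> cls R x"
  by (simp add: cls_def)

text \<open>Functions that respect the relation are evaluated on a class through the image of that class.\<close>

lemma the_elem_image_cls:
  assumes "\<And>p q. R p q \<Longrightarrow> f p = f q"
  shows "the_elem (f ` cls R x) = f x"
proof -
  have "f y = f x" if "y \<in> cls R x" for y
  proof -
    have "cls R x = cls R y" using that unfolding cls_eq_iff by (simp add: cls_def)
    then show ?thesis using cls_eq_imp_eq[of R f x y] assms by simp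
  qed
  then have "f ` cls R x \<subseteq> {f x}" by blast
  moreover have "f x \<in> f ` cls R x" by (rule imageI[OF self_in_cls])
  ultimately have "f ` cls R x = {f x}" by blast
  then show ?thesis by simp
qed

lemma continuous_map_from_quotient:
  assumes "continuous_map X Y (\<lambda>p. g (cls R p))"
  shows "continuous_map (quotient_by X R) Y g"
  by (rule continuous_compose_quotient_map[OF quotient_map_cls]) (use assms in \<open>simp add: o_def\<close>)

lemma continuous_map_cls: "continuous_map X (quotient_by X R) (cls R)"
  using quotient_map_cls quotient_imp_continuous_map by blast

lemma Hausdorff_space_quotient_by:
  assumes f: "continuous_map X Y f" "Hausdorff_space Y" "\<And>p q. R p q \<Longrightarrow> f p = f q"
    and inj: "\<And>x y. x \<in> topspace X \<Longrightarrow> y \<in> topspace X \<Longrightarrow> f x = f y \<Longrightarrow> cls R x = cls R y"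
  shows "Hausdorff_space (quotient_by X R)"
proof (rule Hausdorff_space_injective_preimage[OF f(2)])
  have el: "the_elem (f ` cls R x) = f x" for x
    by (rule the_elem_image_cls) (rule f(3))
  show "continuous_map (quotient_by X R) Y (\<lambda>c. the_elem (f ` c))"
    by (rule continuous_map_from_quotient) (simp only: el f(1))
  show "inj_on (\<lambda>c. the_elem (f ` c)) (topspace (quotient_by X R))"
  proof (rule inj_onI)
    fix c d assume "c \<in> topspace (quotient_by X R)" "d \<in> topspace (quotient_by X R)"
    then obtain x y where xy: "x \<in> topspace X" "c = cls R x" "y \<in> topspace X" "d = cls R y"
      unfolding topspace_quotient_by by blast
    assume "the_elem (f ` c) = the_elem (f ` d)"
    then have "f x = f y" unfolding xy el .
    then show "c = d" unfolding xy by (rule inj[OF xy(1,3)])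
  qed
qed

lemma cis_eq_cis_iff: "cis x = cis y \<longleftrightarrow> (\<exists>n::int. x = y + 2 * pi * of_int n)"
  using sin_cos_eq_iff[of x y] by (auto simp: complex_eq_iff)

text \<open>On the boundary circles the gluing identifies the edge \<open>k\<close> with the edge \<open>k + 3\<close>, reversed, so the
  number of the edge modulo 3 is an invariant.  The factor \<open>sin\<^sup>2\<close>, symmetric under the reversal, makes it
  continuous at the vertices.\<close>

definition edge_code :: "real \<Rightarrow> complex" where
  "edge_code \<theta> = (sin (pi * \<theta>))\<^sup>2 *\<^sub>R cis (2 * pi * of_int \<lfloor>\<theta>\<rfloor> / 3)"

text \<open>The surface embedded in a Euclidean space.  The second component determines the angle away from the
  boundary circles; on them the last two components determine the point.\<close>

definition F_code :: "real \<times> real \<Rightarrow> real \<times> complex \<times> real \<times> complex" where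
  "F_code = (\<lambda>(\<theta>, s). (s, (s * (1 - s)) *\<^sub>R cis (pi * \<theta> / 3), cos (pi * \<theta>), edge_code \<theta>))"

lemma sin_pi_shift_int: "(sin (pi * (x + of_int k)))\<^sup>2 = (sin (pi * x))\<^sup>2"
  by (simp add: distrib_left sin_add power_mult_distrib)

lemma F_code_glue: "F_glue p q \<Longrightarrow> F_code p = F_code q"
proof (induction rule: F_glue.induct)
  case (annulus \<theta> s)
  have "cis (pi * (\<theta> + 6) / 3) = cis (pi * \<theta> / 3)"
    unfolding cis_eq_cis_iff by (intro exI[of _ 1]) (simp add: field_simps)
  moreover have "cos (pi * (\<theta> + 6)) = cos (pi * \<theta>)"
    using cos_npi_int[of 6] sin_npi_int[of 6] by (simp add: distrib_left cos_add)
  moreover have "cis (2 * pi * of_int \<lfloor>\<theta> + 6\<rfloor> / 3) = cis (2 * pi * of_int \<lfloor>\<theta>\<rfloor> / 3)"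
    unfolding cis_eq_cis_iff by (intro exI[of _ 2]) (simp add: field_simps)
  moreover have "(sin (pi * (\<theta> + 6)))\<^sup>2 = (sin (pi * \<theta>))\<^sup>2"
    using sin_pi_shift_int[of \<theta> 6] by simp
  ultimately show ?case by (simp add: F_code_def edge_code_def)
next
  case (hexagon s u k)
  have "cos (pi * (of_int k + 4 - u)) = cos (pi * (- (of_int k + u)) + 2 * pi * of_int (k + 2))"
    by (simp add: algebra_simps)
  also have "\<dots> = cos (- (pi * (of_int k + u)))"
    using sin_cos_eq_iff[of "pi * (- (of_int k + u)) + 2 * pi * of_int (k + 2)" "pi * (- (of_int k + u))"]
    by (metis mult_minus_right)
  finally have c: "cos (pi * (of_int k + 4 - u)) = cos (pi * (of_int k + u))" by simp
  have "edge_code (of_int k + 4 - u) = edge_code (of_int k + u)"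
  proof (cases "u = 0 \<or> u = 1")
    case True
    then have "sin (pi * (of_int k + u)) = 0" "sin (pi * (of_int k + 4 - u)) = 0"
      using sin_npi_int[of k] sin_npi_int[of "k + 1"] sin_npi_int[of "k + 4"] sin_npi_int[of "k + 3"]
      by (auto simp: algebra_simps)
    then show ?thesis by (simp add: edge_code_def)
  next
    case False
    then have "\<lfloor>of_int k + u\<rfloor> = k" "\<lfloor>of_int k + 4 - u\<rfloor> = k + 3"
      using hexagon by (auto simp: floor_eq_iff)
    moreover have "cis (2 * pi * of_int (k + 3) / 3) = cis (2 * pi * of_int k / 3)"
      unfolding cis_eq_cis_iff by (intro exI[of _ 1]) (simp add: field_simps)
    moreover have "(sin (pi * (of_int k + 4 - u)))\<^sup>2 = (sin (pi * (of_int k + u)))\<^sup>2"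
      using c by (simp add: sin_squared_eq)
    ultimately show ?thesis by (simp add: edge_code_def)
  qed
  with c hexagon show ?case by (auto simp: F_code_def)
qed

lemma Fpt_annulus: "Fpt (\<theta> + 6 * of_int k) s = Fpt \<theta> s"
proof (induction k rule: int_induct[of _ 0])
  case (step1 i)
  have "Fpt (\<theta> + 6 * of_int i) s = Fpt (\<theta> + 6 * of_int i + 6) s"
    unfolding cls_eq_iff by (intro r_into_equivclp F_glue.annulus)
  with step1 show ?case by (simp add: algebra_simps)
next
  case (step2 i)
  have "Fpt (\<theta> + 6 * of_int (i - 1)) s = Fpt (\<theta> + 6 * of_int (i - 1) + 6) s"
    unfolding cls_eq_iff by (intro r_into_equivclp F_glue.annulus)
  with step2 show ?case by (simp add: algebra_simps)
qed simp

lemma Fpt_hexagon: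
  assumes "s \<in> {0, 1}" "of_int k \<le> \<theta>" "\<theta> \<le> of_int k + 1"
  shows "Fpt \<theta> s = Fpt (2 * of_int k + 4 - \<theta>) s"
proof -
  have "F_glue (of_int k + (\<theta> - of_int k), s) (of_int k + 4 - (\<theta> - of_int k), s)"
    using assms by (intro F_glue.hexagon) auto
  then show ?thesis unfolding cls_eq_iff by (simp add: r_into_equivclp algebra_simps)
qed

lemma Fpt_vertex:
  assumes "s \<in> {0, 1}"
  shows "Fpt (of_int k + 2 * of_int m) s = Fpt (of_int k) s"
proof (induction m rule: int_induct[of _ 0])
  have *: "Fpt (of_int i) s = Fpt (of_int i + 2) s" for i :: int
    using Fpt_hexagon[OF assms, of "i - 1" "of_int i"] by simp
  {
    case (step1 i)
    then show ?case using *[of "k + 2 * i"] by (simp add: algebra_simps)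
  next
    case (step2 i)
    then show ?case using *[of "k + 2 * (i - 1)"] by (simp add: algebra_simps)
  }
qed simp

text \<open>On a boundary circle \<open>cos (\<pi> \<theta>)\<close> determines \<open>\<theta>\<close> up to sign and even integers, and the edge number
  modulo 3 leaves exactly the identifications that are made.\<close>

lemma F_code_eq_imp:
  assumes s: "s \<in> {0..1}" and eq: "F_code (\<theta>, s) = F_code (\<theta>', s')"
  shows "Fpt \<theta> s = Fpt \<theta>' s'"
proof -
  have s': "s' = s" and c1: "(s * (1 - s)) *\<^sub>R cis (pi * \<theta> / 3) = (s * (1 - s)) *\<^sub>R cis (pi * \<theta>' / 3)"
    and c2: "cos (pi * \<theta>') = cos (pi * \<theta>)" and c3: "edge_code \<theta> = edge_code \<theta>'"
    using eq by (auto simp: F_code_def)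
  show ?thesis
  proof (cases "s \<in> {0, 1}")
    case False
    then have "cis (pi * \<theta> / 3) = cis (pi * \<theta>' / 3)" using c1 s by auto
    then obtain n :: int where "pi * \<theta> / 3 = pi * \<theta>' / 3 + 2 * pi * of_int n"
      unfolding cis_eq_cis_iff by blast
    then have "pi * \<theta> = pi * (\<theta>' + 6 * of_int n)" by (simp add: field_simps)
    then have "\<theta> = \<theta>' + 6 * of_int n" by simp
    then show ?thesis using Fpt_annulus s' by simp
  next
    case s: True
    obtain m :: int where "pi * \<theta>' = pi * \<theta> + 2 * of_int m * pi \<or> pi * \<theta>' = - (pi * \<theta>) + 2 * of_int m * pi"
      using c2 unfolding cos_eq by (auto elim!: Ints_cases)
    then have "pi * \<theta>' = pi * (\<theta> + 2 * of_int m) \<or> pi * \<theta>' = pi * (- \<theta> + 2 * of_int m)"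
      by (auto simp: algebra_simps)
    then have m: "\<theta>' = \<theta> + 2 * of_int m \<or> \<theta>' = - \<theta> + 2 * of_int m"
      by simp
    define k where "k = \<lfloor>\<theta>\<rfloor>"
    show ?thesis
    proof (cases "\<theta> \<in> \<int>")
      case True
      then have "\<theta> = of_int k" unfolding k_def by (auto elim: Ints_cases)
      with m have "\<theta>' = of_int k + 2 * of_int m \<or> \<theta>' = of_int k + 2 * of_int (m - k)" by auto
      then obtain m' :: int where "\<theta>' = of_int k + 2 * of_int m'" by blast
      then show ?thesis using Fpt_vertex[OF s] \<open>\<theta> = of_int k\<close> s' by simp
    next
      case False
      have k: "of_int k < \<theta>" "\<theta> < of_int k + 1"
        using False of_int_floor_le[of \<theta>] unfolding k_def
        by (metis Ints_of_int less_eq_real_def, linarith)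
      have "(sin (pi * \<theta>))\<^sup>2 = (sin (pi * \<theta>'))\<^sup>2" using c2 by (simp add: sin_squared_eq)
      moreover have "sin (pi * \<theta>) \<noteq> 0"
      proof
        assume "sin (pi * \<theta>) = 0"
        then obtain i :: int where "pi * \<theta> = of_int i * pi" unfolding sin_zero_iff_int2 by blast
        then have "\<theta> = of_int i" by simp
        with False show False by simp
      qed
      moreover from calculation have "sin (pi * \<theta>') \<noteq> 0" by auto
      ultimately have "cis (2 * pi * of_int k / 3) = cis (2 * pi * of_int \<lfloor>\<theta>'\<rfloor> / 3)"
        using c3 by (simp add: edge_code_def k_def)
      then obtain n :: int where "2 * pi * of_int k / 3 = 2 * pi * of_int \<lfloor>\<theta>'\<rfloor> / 3 + 2 * pi * of_int n"
        unfolding cis_eq_cis_iff by blast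
      then have "pi * of_int k = pi * of_int (\<lfloor>\<theta>'\<rfloor> + 3 * n)" by (simp add: field_simps)
      then have n: "k = \<lfloor>\<theta>'\<rfloor> + 3 * n" by (metis mult_cancel_left of_int_eq_iff pi_neq_zero)
      from m show ?thesis
      proof
        assume *: "\<theta>' = \<theta> + 2 * of_int m"
        then have "\<lfloor>\<theta>'\<rfloor> = k + 2 * m" unfolding floor_eq_iff using k by simp
        then have "m = 3 * (m + n)" using n by presburger
        then have "real_of_int m = of_int (3 * (m + n))" by (rule arg_cong)
        then have th: "\<theta>' = \<theta> + 6 * of_int (m + n)" using * by simp
        show ?thesis unfolding th s' by (rule Fpt_annulus[symmetric])
      next
        assume *: "\<theta>' = - \<theta> + 2 * of_int m"
        then have "\<lfloor>\<theta>'\<rfloor> = 2 * m - k - 1" unfolding floor_eq_iff using k by simp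
        \<comment> \<open>The reflected angle lies on the edge glued to the edge \<open>k\<close>.\<close>
        then have "2 * k = 2 * m - 1 + 3 * n" using n by presburger
        then have "\<exists>i. m = k + 2 + 3 * i" by presburger
        then obtain i where i: "m = k + 2 + 3 * i" by blast
        have "Fpt \<theta> s = Fpt (2 * of_int k + 4 - \<theta>) s"
          using k by (intro Fpt_hexagon[OF s]) auto
        also have "\<dots> = Fpt (2 * of_int k + 4 - \<theta> + 6 * of_int i) s" by (simp add: Fpt_annulus)
        also have "2 * of_int k + 4 - \<theta> + 6 * of_int i = \<theta>'" using * i by simp
        finally show ?thesis using s' by simp
      qed
    qed
  qed
qed

lemma Fpt_eq_iff_code: "s \<in> {0..1} \<Longrightarrow> Fpt \<theta> s = Fpt \<theta>' s' \<longleftrightarrow> F_code (\<theta>, s) = F_code (\<theta>', s')"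
  using F_code_eq_imp cls_eq_imp_eq[of F_glue F_code] F_code_glue by blast

lemma continuous_edge_code: "continuous_map (top_of_set S) euclidean (\<lambda>p. edge_code (fst p))"
  for S :: "(real \<times> real) set"
proof (rule continuous_map_slabs[of _ fst])
  show "continuous_map (top_of_set S) euclideanreal fst" by (simp add: continuous_on_fst)
  fix k :: int
  let ?S = "{x \<in> topspace (top_of_set S). real_of_int k \<le> fst x \<and> fst x \<le> real_of_int k + 1}"
  have c: "continuous_on ?S (\<lambda>p. (sin (pi * fst p))\<^sup>2 *\<^sub>R cis (2 * pi * of_int k / 3))"
    by (intro continuous_intros)
  have e: "(sin (pi * fst p))\<^sup>2 *\<^sub>R cis (2 * pi * of_int k / 3) = edge_code (fst p)" if "p \<in> ?S" for p
  proof (cases "fst p = of_int k + 1")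
    case True
    then have "sin (pi * fst p) = 0" using sin_npi_int[of "k + 1"] by simp
    then show ?thesis by (simp add: edge_code_def)
  next
    case False
    then have "\<lfloor>fst p\<rfloor> = k" using that by (simp add: floor_eq_iff)
    then show ?thesis by (simp add: edge_code_def)
  qed
  have "continuous_on ?S (\<lambda>p. edge_code (fst p))"
    by (rule continuous_on_eq[OF c e])
  moreover have "subtopology (top_of_set S) ?S = top_of_set ?S"
    unfolding subtopology_subtopology by (rule arg_cong[of _ _ top_of_set]) auto
  ultimately show "continuous_map (subtopology (top_of_set S) ?S) euclidean (\<lambda>p. edge_code (fst p))"
    by simp
qed

lemma continuous_F_code: "continuous_on S F_code"
proof -
  have "continuous_on S (\<lambda>p. edge_code (fst p))" using continuous_edge_code[of S] by simp
  then show ?thesis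
    unfolding F_code_def case_prod_unfold by (intro continuous_intros) auto
qed

lemma topspace_F: "topspace F_surface = {Fpt \<theta> s | \<theta> s. s \<in> {0..1}}"
  unfolding F_surface_def topspace_quotient_by
  by (simp add: set_eq_iff image_iff Bex_def split_paired_Ex conj_commute)

lemma Fpt_in_F: "s \<in> {0..1} \<Longrightarrow> Fpt \<theta> s \<in> topspace F_surface"
  unfolding topspace_F by blast

lemma continuous_Fpt: "continuous_map (top_of_set (UNIV \<times> {0..1})) F_surface (cls F_glue)"
  unfolding F_surface_def by (rule continuous_map_cls)

lemma Hausdorff_F: "Hausdorff_space F_surface"
  unfolding F_surface_def
proof (rule Hausdorff_space_quotient_by[of _ euclidean F_code])
  show "continuous_map (top_of_set (UNIV \<times> {0..1})) euclidean F_code"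
    by (simp add: continuous_F_code)
  show "cls F_glue x = cls F_glue y" if "x \<in> topspace (top_of_set (UNIV \<times> {0..1}))" "F_code x = F_code y" for x y
    using that F_code_eq_imp[of "snd x" "fst x" "fst y" "snd y"] by (simp add: mem_Times_iff)
qed (simp_all add: F_code_glue)

lemma rho_F: "x \<in> topspace F_surface \<Longrightarrow> rho x \<in> topspace F_surface"
proof -
  assume "x \<in> topspace F_surface"
  then obtain \<theta> s where "x = Fpt \<theta> s" "s \<in> {0..1}" unfolding topspace_F by blast
  then show ?thesis by (simp add: rho_Fpt Fpt_in_F)
qed

lemma Fpt_shift: "Fpt \<theta> s = Fpt \<theta>' s' \<Longrightarrow> Fpt (\<theta> + of_int j) s = Fpt (\<theta>' + of_int j) s'"
  using equivclp_F_glue_shift[of "(\<theta>, s)" "(\<theta>', s')" j] by (simp add: cls_eq_iff)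

lemma continuous_rho: "continuous_map F_surface F_surface rho"
proof -
  have "continuous_map (top_of_set (UNIV \<times> {0..1})) F_surface (\<lambda>p. cls F_glue ((\<lambda>p. (fst p + 1, snd p)) p))"
    by (rule continuous_map_compose_on[OF continuous_Fpt]) (auto intro!: continuous_intros)
  moreover have "cls F_glue (fst p + 1, snd p) = rho (cls F_glue p)" for p
    using rho_Fpt[of "fst p" "snd p"] by simp
  ultimately show ?thesis
    unfolding F_surface_def by (intro continuous_map_from_quotient) (simp add: F_surface_def)
qed

definition F_coord :: "(real \<times> real) set \<Rightarrow> real \<times> complex \<times> real \<times> complex" where
  "F_coord x = the_elem (F_code ` x)"

lemma F_coord_Fpt: "F_coord (cls F_glue p) = F_code p"
  unfolding F_coord_def by (rule the_elem_image_cls) (rule F_code_glue)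

lemma continuous_F_coord: "continuous_map F_surface euclidean F_coord"
  unfolding F_surface_def
  by (rule continuous_map_from_quotient) (simp add: F_coord_Fpt continuous_F_code)

lemma F_coord_inj: "x \<in> topspace F_surface \<Longrightarrow> y \<in> topspace F_surface \<Longrightarrow> F_coord x = F_coord y \<Longrightarrow> x = y"
proof -
  assume "x \<in> topspace F_surface" "y \<in> topspace F_surface" "F_coord x = F_coord y"
  moreover from this obtain \<theta> s \<theta>' s' where "x = Fpt \<theta> s" "s \<in> {0..1}" "y = Fpt \<theta>' s'"
    unfolding topspace_F by blast
  ultimately show ?thesis using F_code_eq_imp[of s \<theta> \<theta>' s'] by (simp add: F_coord_Fpt)
qed

text \<open>Interpolating from \<open>F_coord x\<close> to \<open>F_coord (rho x)\<close> respects the gluing of \<open>(x, 1)\<close> to \<open>(rho x, 0)\<close>.  It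
  determines the point in the fibre \<open>t = 0\<close>; in the other fibres the second component does.\<close>

definition M_code :: "(real \<times> real) set \<times> real \<Rightarrow> complex \<times> (real \<times> complex \<times> real \<times> complex) \<times> (real \<times> complex \<times> real \<times> complex)" where
  "M_code = (\<lambda>(x, t). (cis (2 * pi * t), (t * (1 - t)) *\<^sub>R F_coord x,
     (1 - t) *\<^sub>R F_coord x + t *\<^sub>R F_coord (rho x)))"

lemma M_code_glue: "M_glue p q \<Longrightarrow> M_code p = M_code q"
  by (induction rule: M_glue.induct) (simp add: M_code_def)

lemma Mpt_1: "x \<in> topspace F_surface \<Longrightarrow> Mpt x 1 = Mpt (rho x) 0"
  unfolding cls_eq_iff by (intro r_into_equivclp M_glue.intros)

lemma cis_2pi_eq:
  assumes "cis (2 * pi * t) = cis (2 * pi * t')" "t \<in> {0..1}" "t' \<in> {0..1}"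
  shows "t = t' \<or> (t = 0 \<and> t' = 1) \<or> (t = 1 \<and> t' = 0)"
proof -
  obtain n :: int where "2 * pi * t = 2 * pi * t' + 2 * pi * of_int n"
    using assms(1) unfolding cis_eq_cis_iff by blast
  then have "2 * pi * t = 2 * pi * (t' + of_int n)" by (simp add: algebra_simps)
  then have t: "t = t' + of_int n" by simp
  then have "-1 \<le> real_of_int n" "real_of_int n \<le> 1" using assms by auto
  then have "n = -1 \<or> n = 0 \<or> n = 1" by linarith
  then show ?thesis using t assms by auto
qed

lemma M_code_eq_imp:
  assumes x: "x \<in> topspace F_surface" "y \<in> topspace F_surface" and t: "t \<in> {0..1}" "t' \<in> {0..1}"
    and eq: "M_code (x, t) = M_code (y, t')"
  shows "Mpt x t = Mpt y t'"
proof -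
  from eq have c: "cis (2 * pi * t) = cis (2 * pi * t')"
    and a: "(t * (1 - t)) *\<^sub>R F_coord x = (t' * (1 - t')) *\<^sub>R F_coord y"
    and b: "(1 - t) *\<^sub>R F_coord x + t *\<^sub>R F_coord (rho x) = (1 - t') *\<^sub>R F_coord y + t' *\<^sub>R F_coord (rho y)"
    by (auto simp: M_code_def)
  consider "t = 0" "t' = 0" | "t = 1" "t' = 1" | "t = 0" "t' = 1" | "t = 1" "t' = 0"
    | "t = t'" "t \<noteq> 0" "t \<noteq> 1"
    using cis_2pi_eq[OF c t] by blast
  then show ?thesis
  proof cases
    case 1
    then show ?thesis using F_coord_inj[of x y] x b by simp
  next
    case 2
    then show ?thesis using F_coord_inj[of "rho x" "rho y"] rho_F x b by (simp add: Mpt_1)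
  next
    case 3
    then show ?thesis using F_coord_inj[of x "rho y"] rho_F x b by (simp add: Mpt_1)
  next
    case 4
    then show ?thesis using F_coord_inj[of "rho x" y] rho_F x b by (simp add: Mpt_1)
  next
    case 5
    then show ?thesis using F_coord_inj[of x y] x a by simp
  qed
qed

lemma Mpt_inject:
  assumes x: "x \<in> topspace F_surface" "y \<in> topspace F_surface" and t: "t \<in> {0..<1}" "t' \<in> {0..<1}"
    and eq: "Mpt x t = Mpt y t'"
  shows "x = y" "t = t'"
proof -
  have "M_code (x, t) = M_code (y, t')"
    using cls_eq_imp_eq[of M_glue M_code] M_code_glue eq by blast
  then have c: "cis (2 * pi * t) = cis (2 * pi * t')"
    and a: "(t * (1 - t)) *\<^sub>R F_coord x = (t' * (1 - t')) *\<^sub>R F_coord y"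
    and b: "(1 - t) *\<^sub>R F_coord x + t *\<^sub>R F_coord (rho x) = (1 - t') *\<^sub>R F_coord y + t' *\<^sub>R F_coord (rho y)"
    by (auto simp: M_code_def)
  show "t = t'" using cis_2pi_eq[OF c] t by auto
  with a b t have "F_coord x = F_coord y" by (cases "t = 0") auto
  then show "x = y" using F_coord_inj x by blast
qed

lemma topspace_M: "topspace M_space = {Mpt x t | x t. x \<in> topspace F_surface \<and> t \<in> {0..1}}"
  unfolding M_space_def topspace_quotient_by
  by (simp add: set_eq_iff image_iff Bex_def split_paired_Ex conj_commute conj_left_commute)

lemma continuous_Mpt: "continuous_map (prod_topology F_surface (top_of_set {0..1})) M_space (cls M_glue)"
  unfolding M_space_def by (rule continuous_map_cls)

lemma Hausdorff_M: "Hausdorff_space M_space"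
  unfolding M_space_def
proof (rule Hausdorff_space_quotient_by[of _ euclidean M_code])
  let ?X = "prod_topology F_surface (top_of_set {0..1::real})"
  have 1: "continuous_map ?X euclidean (\<lambda>z. F_coord (fst z))"
    using continuous_map_compose[OF continuous_map_fst continuous_F_coord] by (simp add: o_def)
  have 2: "continuous_map ?X euclidean (\<lambda>z. F_coord (rho (fst z)))"
    using continuous_map_compose[OF continuous_map_fst continuous_map_compose[OF continuous_rho continuous_F_coord]]
    by (simp add: o_def)
  have 3: "continuous_map ?X euclideanreal snd"
    by (rule continuous_map_into_fulltopology[OF continuous_map_snd])
  have 4: "continuous_map ?X (prod_topology euclideanreal (prod_topology euclidean euclidean))
      (\<lambda>z. (snd z, F_coord (fst z), F_coord (rho (fst z))))"
    using 1 2 3 by (intro continuous_map_pairedI)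
  have 5: "continuous_on UNIV (\<lambda>(t, a, b :: real \<times> complex \<times> real \<times> complex). (cis (2 * pi * t), (t * (1 - t)) *\<^sub>R a, (1 - t) *\<^sub>R a + t *\<^sub>R b))"
    unfolding case_prod_unfold by (intro continuous_intros)
  have "continuous_map ?X euclidean ((\<lambda>(t, a, b). (cis (2 * pi * t), (t * (1 - t)) *\<^sub>R a,
      (1 - t) *\<^sub>R a + t *\<^sub>R b)) \<circ> (\<lambda>z. (snd z, F_coord (fst z), F_coord (rho (fst z)))))"
    by (rule continuous_map_compose[OF 4]) (use 5 in simp)
  then show "continuous_map ?X euclidean M_code"
    by (simp add: M_code_def case_prod_unfold o_def)
  show "cls M_glue x = cls M_glue y" if "x \<in> topspace ?X" "y \<in> topspace ?X" "M_code x = M_code y" for x y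
    using that M_code_eq_imp[of "fst x" "fst y" "snd x" "snd y"] by (simp add: mem_Times_iff)
qed (simp_all add: M_code_glue)

section \<open>Sheared coordinates on the surface\<close>

text \<open>A lift to the surface of the projection of the plane to the pillowcase, on the strip
  \<open>0 \<le> s - 2 \<theta> \<le> 1\<close>, whose interior contains no lattice points.  When the strip crosses a line of integer
  height, the lift runs through an edge of a hexagon and continues, turned by \<open>\<pi>\<close>, at the glued edge.\<close>

definition fold_pt :: "real \<Rightarrow> real \<Rightarrow> (real \<times> real) set" where
  "fold_pt \<theta> s = (let j = real_of_int \<lfloor>s / 2\<rfloor> in
     if s \<le> 2 * j + 1 then Fpt \<theta> (s - 2 * j) else Fpt (4 + 2 * j - \<theta>) (2 * j + 2 - s))"

text \<open>The point with sheared coordinates \<open>(\<theta>, w)\<close>.  The shear \<open>(\<theta>, w) \<mapsto> (\<theta>, w + 2 \<theta>)\<close> preserves the integer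
  lattice, and it turns out to be compatible with the gluing: sheared coordinates present the surface
  in the same way as the original ones.\<close>

definition Lpt :: "real \<Rightarrow> real \<Rightarrow> (real \<times> real) set" where
  "Lpt \<theta> w = fold_pt \<theta> (w + 2 * \<theta>)"

lemma floor_half_eq: "2 * of_int j \<le> (s::real) \<Longrightarrow> s < 2 * of_int j + 2 \<Longrightarrow> \<lfloor>s / 2\<rfloor> = j"
  by (simp add: floor_eq_iff)

text \<open>At the upper end of each piece both formulas for the lift are available, here and in \<open>Lpt_odd\<close>; their
  agreement is the gluing of the hexagons.\<close>

lemma Lpt_even:
  assumes "2 * of_int j \<le> w + 2 * \<theta>" "w + 2 * \<theta> \<le> 2 * of_int j + 1"
  shows "Lpt \<theta> w = Fpt \<theta> (w + 2 * \<theta> - 2 * of_int j)"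
proof -
  have "\<lfloor>(w + 2 * \<theta>) / 2\<rfloor> = j" using assms by (intro floor_half_eq) auto
  then show ?thesis using assms by (simp add: Lpt_def fold_pt_def Let_def)
qed

lemma Lpt_odd:
  assumes "2 * of_int j + 1 \<le> w + 2 * \<theta>" "w + 2 * \<theta> \<le> 2 * of_int j + 2" and w: "w \<in> {0..1}"
  shows "Lpt \<theta> w = Fpt (4 + 2 * of_int j - \<theta>) (2 * of_int j + 2 - (w + 2 * \<theta>))"
proof -
  let ?s = "w + 2 * \<theta>"
  consider "?s = 2 * of_int j + 1" | "?s = 2 * of_int j + 2"
    | "2 * of_int j + 1 < ?s" "?s < 2 * of_int j + 2" using assms by linarith
  then show ?thesis
  proof cases
    case 1
    then have \<theta>: "of_int j \<le> \<theta>" "\<theta> \<le> of_int j + 1" using w by auto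
    have "Lpt \<theta> w = Fpt \<theta> 1" using Lpt_even[of j w \<theta>] 1 by simp
    also have "\<dots> = Fpt (2 * of_int j + 4 - \<theta>) 1" by (rule Fpt_hexagon) (use \<theta> in auto)
    finally show ?thesis using 1 by (simp add: add.commute)
  next
    case 2
    then have \<theta>: "of_int j \<le> \<theta>" "\<theta> \<le> of_int j + 1" using w by auto
    have "Lpt \<theta> w = Fpt \<theta> 0" using Lpt_even[of "j + 1" w \<theta>] 2 by simp
    also have "\<dots> = Fpt (2 * of_int j + 4 - \<theta>) 0" by (rule Fpt_hexagon) (use \<theta> in auto)
    finally show ?thesis using 2 by (simp add: add.commute)
  next
    case 3
    then have "\<lfloor>?s / 2\<rfloor> = j" by (intro floor_half_eq) auto
    then show ?thesis using 3 by (simp add: Lpt_def fold_pt_def Let_def)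
  qed
qed

lemma Lpt_cases:
  fixes w \<theta> :: real
  assumes w: "w \<in> {0..1}"
  obtains j :: int where "2 * of_int j \<le> w + 2 * \<theta>" "w + 2 * \<theta> \<le> 2 * of_int j + 1"
    | j :: int where "2 * of_int j + 1 \<le> w + 2 * \<theta>" "w + 2 * \<theta> \<le> 2 * of_int j + 2"
proof -
  define j where "j = \<lfloor>(w + 2 * \<theta>) / 2\<rfloor>"
  have "of_int j \<le> (w + 2 * \<theta>) / 2" "(w + 2 * \<theta>) / 2 \<le> of_int j + 1"
    unfolding j_def by linarith+
  then have "2 * of_int j \<le> w + 2 * \<theta>" "w + 2 * \<theta> \<le> 2 * of_int j + 2"
    by auto
  then show ?thesis
  proof (cases "w + 2 * \<theta> \<le> 2 * of_int j + 1")
    case True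
    with \<open>2 * of_int j \<le> w + 2 * \<theta>\<close> show ?thesis by (rule that(1))
  next
    case False
    then have "2 * of_int j + 1 \<le> w + 2 * \<theta>" by simp
    then show ?thesis using \<open>w + 2 * \<theta> \<le> 2 * of_int j + 2\<close> by (rule that(2))
  qed
qed

lemma Gamma_translate: "cls Gamma_rel (x + 2 * of_int a, y + 2 * of_int b) = cls Gamma_rel (x, y)"
  using equivclp_Gamma_translate[of x y a b] by (simp add: cls_eq_iff equivclp_sym)

lemma Gamma_rotate: "cls Gamma_rel (2 * of_int a - x, 2 * of_int b - y) = cls Gamma_rel (x, y)"
  unfolding cls_eq_iff by (intro equivclp_sym[OF r_into_equivclp] Gamma_rel.intros)

text \<open>The group \<open>\<Gamma>\<close> consists of the translations by even vectors and the rotations by \<open>\<pi>\<close>.\<close>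

lemma Gamma_orbit:
  assumes "cls Gamma_rel (x, y) = cls Gamma_rel (x', y')"
  shows "\<exists>a b::int. (x' = x + 2 * of_int a \<and> y' = y + 2 * of_int b) \<or>
    (x' = 2 * of_int a - x \<and> y' = 2 * of_int b - y)"
proof -
  let ?E = "\<lambda>p q. \<exists>a b::int. (fst q = fst p + 2 * of_int a \<and> snd q = snd p + 2 * of_int b) \<or>
    (fst q = 2 * of_int a - fst p \<and> snd q = 2 * of_int b - snd p)"
  have step: "\<exists>a b::int. fst q = 2 * of_int a - fst p \<and> snd q = 2 * of_int b - snd p"
    if "Gamma_rel p q \<or> Gamma_rel q p" for p q :: "real \<times> real"
    using that by (force elim!: Gamma_rel.cases)
  have "equivclp Gamma_rel (x, y) (x', y')" using assms by (simp add: cls_eq_iff)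
  then have "?E (x, y) (x', y')"
  proof (induction rule: equivclp_induct)
    case base
    show ?case by (intro exI[of _ 0]) simp
  next
    case (step p q)
    obtain a b :: int where ab: "fst q = 2 * of_int a - fst p" "snd q = 2 * of_int b - snd p"
      using step(2) \<open>\<And>q p. Gamma_rel p q \<or> Gamma_rel q p \<Longrightarrow> _\<close> by blast
    from step(3) obtain c d :: int where
      "(fst p = x + 2 * of_int c \<and> snd p = y + 2 * of_int d) \<or> (fst p = 2 * of_int c - x \<and> snd p = 2 * of_int d - y)"
      by auto
    then show ?case
    proof
      assume "fst p = x + 2 * of_int c \<and> snd p = y + 2 * of_int d"
      then show ?thesis using ab by (intro exI[of _ "a - c"] exI[of _ "b - d"]) simp
    next
      assume "fst p = 2 * of_int c - x \<and> snd p = 2 * of_int d - y"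
      then show ?thesis using ab by (intro exI[of _ "a - c"] exI[of _ "b - d"]) simp
    qed
  qed
  then show ?thesis by simp
qed

text \<open>The representation in original coordinates can be chosen uniformly for all integer shifts, so
  that shifting \<open>\<theta>\<close> is the action of \<open>\<rho>\<close> in both presentations.\<close>

lemma Lpt_Fpt:
  assumes w: "w \<in> {0..1}"
  shows "\<exists>\<phi> \<sigma>. \<sigma> \<in> {0..1} \<and> (\<forall>i::int. Lpt (\<theta> + of_int i) w = Fpt (\<phi> + of_int i) \<sigma>) \<and>
    cls Gamma_rel (\<phi>, \<sigma>) = cls Gamma_rel (\<theta>, w + 2 * \<theta>)"
proof (rule Lpt_cases[OF w, of \<theta>])
  fix j :: int assume j: "2 * of_int j \<le> w + 2 * \<theta>" "w + 2 * \<theta> \<le> 2 * of_int j + 1"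
  show ?thesis
  proof (intro exI conjI allI)
    show "Lpt (\<theta> + of_int i) w = Fpt (\<theta> + of_int i) (w + 2 * \<theta> - 2 * of_int j)" for i :: int
      using Lpt_even[of "j + i" w "\<theta> + of_int i"] j by (simp add: algebra_simps)
    show "cls Gamma_rel (\<theta>, w + 2 * \<theta> - 2 * of_int j) = cls Gamma_rel (\<theta>, w + 2 * \<theta>)"
      using Gamma_translate[of \<theta> 0 "w + 2 * \<theta>" "- j"] by simp
    show "w + 2 * \<theta> - 2 * of_int j \<in> {0..1}" using j by simp
  qed
next
  fix j :: int assume j: "2 * of_int j + 1 \<le> w + 2 * \<theta>" "w + 2 * \<theta> \<le> 2 * of_int j + 2"
  show ?thesis
  proof (intro exI conjI allI)
    show "Lpt (\<theta> + of_int i) w = Fpt (4 + 2 * of_int j - \<theta> + of_int i) (2 * of_int j + 2 - (w + 2 * \<theta>))" for i :: int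
      using Lpt_odd[of "j + i" w "\<theta> + of_int i"] j w by (simp add: algebra_simps)
    show "cls Gamma_rel (4 + 2 * of_int j - \<theta>, 2 * of_int j + 2 - (w + 2 * \<theta>)) = cls Gamma_rel (\<theta>, w + 2 * \<theta>)"
      using Gamma_rotate[of "2 + j" \<theta> "j + 1" "w + 2 * \<theta>"] by (simp add: algebra_simps)
    show "2 * of_int j + 2 - (w + 2 * \<theta>) \<in> {0..1}" using j by simp
  qed
qed

lemma Lpt_in_F: "w \<in> {0..1} \<Longrightarrow> Lpt \<theta> w \<in> topspace F_surface"
  using Lpt_Fpt[of w \<theta>] Fpt_in_F by (metis add_0_right of_int_0)

lemma proj_Lpt: "w \<in> {0..1} \<Longrightarrow> proj (Lpt \<theta> w) = cls Gamma_rel (\<theta>, w + 2 * \<theta>)"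
  using Lpt_Fpt[of w \<theta>] proj_Fpt by (metis add_0_right of_int_0)

lemma rho_Lpt:
  assumes "w \<in> {0..1}"
  shows "rho (Lpt \<theta> w) = Lpt (\<theta> + 1) w"
proof -
  obtain \<phi> \<sigma> where *: "\<forall>i::int. Lpt (\<theta> + of_int i) w = Fpt (\<phi> + of_int i) \<sigma>"
    using Lpt_Fpt[OF assms] by blast
  show ?thesis using *[rule_format, of 0] *[rule_format, of 1] by (simp add: rho_Fpt)
qed

lemma Lpt_shift:
  assumes w: "w \<in> {0..1}" and eq: "Lpt \<theta> w = Lpt \<theta>' w"
  shows "Lpt (\<theta> + of_int i) w = Lpt (\<theta>' + of_int i) w"
proof -
  obtain \<phi> \<sigma> where 1: "\<forall>i::int. Lpt (\<theta> + of_int i) w = Fpt (\<phi> + of_int i) \<sigma>"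
    using Lpt_Fpt[OF w] by blast
  obtain \<phi>' \<sigma>' where 2: "\<forall>i::int. Lpt (\<theta>' + of_int i) w = Fpt (\<phi>' + of_int i) \<sigma>'"
    using Lpt_Fpt[OF w] by blast
  show ?thesis
    using eq 1[rule_format, of 0] 2[rule_format, of 0] 1[rule_format, of i] 2[rule_format, of i] Fpt_shift[of \<phi> \<sigma> \<phi>' \<sigma>' i] by simp
qed

lemma Lpt_period:
  assumes w: "w \<in> {0..1}"
  shows "Lpt (\<theta> + 6 * of_int k) w = Lpt \<theta> w"
proof -
  obtain \<phi> \<sigma> where 1: "\<forall>i::int. Lpt (\<theta> + of_int i) w = Fpt (\<phi> + of_int i) \<sigma>"
    using Lpt_Fpt[OF w] by blast
  show ?thesis using 1[rule_format, of 0] 1[rule_format, of "6 * k"] Fpt_annulus[of \<phi> k \<sigma>] by simp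
qed

text \<open>Equal points have equal projections.  For \<open>0 < w < 1\<close> a rotation in \<open>\<Gamma>\<close> is excluded, as it would make \<open>w\<close> an integer, and a translation of \<open>\<theta>\<close> by \<open>2a\<close> acts on the surface as \<open>\<rho>\<^sup>2\<^sup>a\<close>, which
  fixes no point over \<open>P\<close> unless 3 divides \<open>a\<close>.\<close>

lemma Lpt_eq_imp:
  assumes w: "w \<in> {0..1}" "w' \<in> {0..1}" and eq: "Lpt \<theta> w = Lpt \<theta>' w'"
  shows "w = w'" and "w \<in> {0<..<1} \<Longrightarrow> \<exists>k::int. \<theta>' = \<theta> + 6 * of_int k"
proof -
  have "cls Gamma_rel (\<theta>, w + 2 * \<theta>) = cls Gamma_rel (\<theta>', w' + 2 * \<theta>')"
    using eq proj_Lpt w by metis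
  then obtain a b :: int where ab: "(\<theta>' = \<theta> + 2 * of_int a \<and> w' + 2 * \<theta>' = w + 2 * \<theta> + 2 * of_int b) \<or>
      (\<theta>' = 2 * of_int a - \<theta> \<and> w' + 2 * \<theta>' = 2 * of_int b - (w + 2 * \<theta>))"
    using Gamma_orbit by blast
  define d where "d = b - 2 * a"
  from ab have c: "(w' = w + 2 * of_int d \<and> \<theta>' = \<theta> + 2 * of_int a) \<or> w' = 2 * of_int d - w"
    unfolding d_def by auto
  have "w = w' \<and> (w \<in> {0<..<1} \<longrightarrow> \<theta>' = \<theta> + 2 * of_int a)"
    using c
  proof
    assume *: "w' = w + 2 * of_int d \<and> \<theta>' = \<theta> + 2 * of_int a"
    then have "-1 \<le> 2 * real_of_int d" "2 * real_of_int d \<le> 1" using w by auto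
    then have "d = 0" by linarith
    with * show ?thesis by simp
  next
    assume *: "w' = 2 * of_int d - w"
    then have "0 \<le> 2 * real_of_int d" "2 * real_of_int d \<le> 2" using w by auto
    then have "d = 0 \<or> d = 1" by linarith
    then have "w' = - w \<or> w' = 2 - w" using * by auto
    then have "w = 0 \<and> w' = 0 \<or> w = 1 \<and> w' = 1" using w by auto
    then show ?thesis by auto
  qed
  then have ww: "w = w'" and tr: "w \<in> {0<..<1} \<Longrightarrow> \<theta>' = \<theta> + 2 * of_int a" by blast+
  show "w = w'" by (rule ww)
  assume w01: "w \<in> {0<..<1}"
  obtain \<phi> \<sigma> where \<sigma>: "\<sigma> \<in> {0..1}" and L: "\<forall>i::int. Lpt (\<theta> + of_int i) w = Fpt (\<phi> + of_int i) \<sigma>"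
    and G: "cls Gamma_rel (\<phi>, \<sigma>) = cls Gamma_rel (\<theta>, w + 2 * \<theta>)"
    using Lpt_Fpt[OF w(1)] by blast
  have "Fpt \<phi> \<sigma> = Fpt (\<phi> + of_int (2 * a)) \<sigma>"
    using eq ww tr[OF w01] L[rule_format, of 0] L[rule_format, of "2 * a"] by simp
  then have code: "F_code (\<phi>, \<sigma>) = F_code (\<phi> + of_int (2 * a), \<sigma>)"
    using Fpt_eq_iff_code[OF \<sigma>] by blast
  have "3 dvd a"
  proof (cases "\<sigma> \<in> {0, 1}")
    case False
    then have "cis (pi * \<phi> / 3) = cis (pi * (\<phi> + of_int (2 * a)) / 3)"
      using code \<sigma> by (auto simp: F_code_def)
    then obtain n :: int where "pi * \<phi> / 3 = pi * (\<phi> + of_int (2 * a)) / 3 + 2 * pi * of_int n"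
      unfolding cis_eq_cis_iff by blast
    then have "pi * of_int a = pi * of_int (3 * (- n))" by (simp add: field_simps)
    then have "a = 3 * (- n)" by (metis mult_cancel_left of_int_eq_iff pi_neq_zero)
    then show ?thesis by simp
  next
    case True
    have "sin (pi * \<phi>) \<noteq> 0"
    proof
      assume "sin (pi * \<phi>) = 0"
      then obtain i :: int where "pi * \<phi> = of_int i * pi" unfolding sin_zero_iff_int2 by blast
      then have i: "\<phi> = of_int i" by simp
      obtain l :: int where l: "\<sigma> = of_int l" using True by (metis empty_iff insert_iff of_int_0 of_int_1)
      obtain a b :: int where "(\<theta> = \<phi> + 2 * of_int a \<and> w + 2 * \<theta> = \<sigma> + 2 * of_int b) \<or>
          (\<theta> = 2 * of_int a - \<phi> \<and> w + 2 * \<theta> = 2 * of_int b - \<sigma>)"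
        using Gamma_orbit[OF G] by blast
      then have "w = of_int (l + 2 * b - 2 * (i + 2 * a)) \<or> w = of_int (2 * b - l - 2 * (2 * a - i))"
        using i l by auto
      then obtain n :: int where "w = of_int n" by blast
      then show False using w01 by auto
    qed
    moreover have "edge_code \<phi> = edge_code (\<phi> + of_int (2 * a))"
      using code by (simp add: F_code_def)
    moreover have "(sin (pi * (\<phi> + of_int (2 * a))))\<^sup>2 = (sin (pi * \<phi>))\<^sup>2" by (rule sin_pi_shift_int)
    ultimately have "cis (2 * pi * of_int \<lfloor>\<phi>\<rfloor> / 3) = cis (2 * pi * of_int \<lfloor>\<phi> + of_int (2 * a)\<rfloor> / 3)"
      unfolding edge_code_def by simp
    then obtain n :: int where "2 * pi * of_int \<lfloor>\<phi>\<rfloor> / 3 = 2 * pi * of_int \<lfloor>\<phi> + of_int (2 * a)\<rfloor> / 3 + 2 * pi * of_int n"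
      unfolding cis_eq_cis_iff by blast
    moreover have "\<lfloor>\<phi> + of_int (2 * a)\<rfloor> = \<lfloor>\<phi>\<rfloor> + 2 * a" by (rule floor_add_int[symmetric])
    ultimately have "pi * of_int (2 * a) = pi * of_int (- 3 * n)" by (simp add: field_simps)
    then have "2 * a = - 3 * n" by (metis mult_cancel_left of_int_eq_iff pi_neq_zero)
    then show ?thesis by presburger
  qed
  then obtain k where "a = 3 * k" by blast
  then show "\<exists>k::int. \<theta>' = \<theta> + 6 * of_int k" using tr[OF w01] by auto
qed

lemma continuous_Lpt: "continuous_map (top_of_set (UNIV \<times> {0..1})) F_surface (\<lambda>(\<theta>, w). Lpt \<theta> w)"
proof (rule continuous_map_slabs[of _ "\<lambda>(\<theta>, w). w + 2 * \<theta>"])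
  show "continuous_map (top_of_set (UNIV \<times> {0..1})) euclideanreal (\<lambda>(\<theta>, w). w + 2 * \<theta>)"
    unfolding case_prod_unfold continuous_map_iff_continuous by (intro continuous_intros)
  fix k :: int
  let ?X = "top_of_set (UNIV \<times> {0..1::real})"
  let ?S = "{x \<in> topspace ?X. of_int k \<le> (case x of (\<theta>, w) \<Rightarrow> w + 2 * \<theta>) \<and> (case x of (\<theta>, w) \<Rightarrow> w + 2 * \<theta>) \<le> real_of_int k + 1}"
  have X: "subtopology ?X ?S = top_of_set ?S"
    unfolding subtopology_subtopology by (rule arg_cong[of _ _ top_of_set]) auto
  have "\<exists>j. k = 2 * j \<or> k = 2 * j + 1" by presburger
  then obtain j where "k = 2 * j \<or> k = 2 * j + 1" by blast
  then show "continuous_map (subtopology ?X ?S) F_surface (\<lambda>(\<theta>, w). Lpt \<theta> w)"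
    unfolding X
  proof
    assume k: "k = 2 * j"
    have "continuous_map (top_of_set ?S) F_surface (\<lambda>p. cls F_glue ((\<lambda>(\<theta>, w). (\<theta>, w + 2 * \<theta> - 2 * of_int j)) p))"
      by (rule continuous_map_compose_on[OF continuous_Fpt])
        (use k in \<open>auto simp: case_prod_unfold intro!: continuous_intros\<close>)
    then show "continuous_map (top_of_set ?S) F_surface (\<lambda>(\<theta>, w). Lpt \<theta> w)"
    proof (rule continuous_map_eq)
      fix p assume "p \<in> topspace (top_of_set ?S)"
      then show "cls F_glue ((\<lambda>(\<theta>, w). (\<theta>, w + 2 * \<theta> - 2 * of_int j)) p) = (case p of (\<theta>, w) \<Rightarrow> Lpt \<theta> w)"
        using Lpt_even[of j "snd p" "fst p"] k by (auto simp: case_prod_unfold)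
    qed
  next
    assume k: "k = 2 * j + 1"
    have "continuous_map (top_of_set ?S) F_surface
        (\<lambda>p. cls F_glue ((\<lambda>(\<theta>, w). (4 + 2 * of_int j - \<theta>, 2 * of_int j + 2 - (w + 2 * \<theta>))) p))"
      by (rule continuous_map_compose_on[OF continuous_Fpt])
        (use k in \<open>auto simp: case_prod_unfold intro!: continuous_intros\<close>)
    then show "continuous_map (top_of_set ?S) F_surface (\<lambda>(\<theta>, w). Lpt \<theta> w)"
    proof (rule continuous_map_eq)
      fix p assume "p \<in> topspace (top_of_set ?S)"
      then show "cls F_glue ((\<lambda>(\<theta>, w). (4 + 2 * of_int j - \<theta>, 2 * of_int j + 2 - (w + 2 * \<theta>))) p) = (case p of (\<theta>, w) \<Rightarrow> Lpt \<theta> w)"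
        using Lpt_odd[of j "snd p" "fst p"] k by (auto simp: case_prod_unfold)
    qed
  qed
qed

lemma Lpt_surj:
  assumes "x \<in> topspace F_surface"
  obtains \<theta> w where "w \<in> {0..1}" "x = Lpt \<theta> w"
proof -
  obtain \<theta> s where s: "s \<in> {0..1}" and x: "x = Fpt \<theta> s" using assms unfolding topspace_F by blast
  define j where "j = \<lfloor>(s - 2 * \<theta>) / 2\<rfloor>"
  have "of_int j \<le> (s - 2 * \<theta>) / 2" "(s - 2 * \<theta>) / 2 \<le> of_int j + 1"
    unfolding j_def by linarith+
  then have j: "2 * of_int j \<le> s - 2 * \<theta>" "s - 2 * \<theta> \<le> 2 * of_int j + 2"
    by auto
  show thesis
  proof (cases "s - 2 * \<theta> \<le> 2 * of_int j + 1")
    case True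
    let ?w = "s - 2 * \<theta> - 2 * of_int j"
    have "Lpt \<theta> ?w = Fpt \<theta> s" using Lpt_even[of "- j" ?w \<theta>] s by simp
    then show thesis using that[of ?w \<theta>] True j x by simp
  next
    case False
    \<comment> \<open>The point lies on an odd piece of the strip; these values solve the formula of \<open>Lpt_odd\<close> for it.\<close>
    let ?w = "2 * of_int j + 2 - (s - 2 * \<theta>)" and ?i = "- j - 4"
    let ?\<theta> = "4 + 2 * of_int ?i - \<theta> :: real"
    have w: "?w \<in> {0..1}" using False j by simp
    have "Lpt ?\<theta> ?w = Fpt (4 + 2 * of_int ?i - ?\<theta>) (2 * of_int ?i + 2 - (?w + 2 * ?\<theta>))"
      using s by (intro Lpt_odd w) (simp_all add: algebra_simps)
    then have "Lpt ?\<theta> ?w = Fpt \<theta> s" by (simp add: algebra_simps)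
    then show thesis using that[OF w, of ?\<theta>] x by simp
  qed
qed

section \<open>Sheared coordinates on the mapping torus\<close>

text \<open>The point of \<open>M\<close> with coordinates \<open>(\<theta>, w, t)\<close>.  Every real \<open>t\<close> is admitted, the integer part of \<open>t\<close> being
  traded for an action of \<open>\<rho>\<close>.\<close>

definition Npt :: "real \<Rightarrow> real \<Rightarrow> real \<Rightarrow> ((real \<times> real) set \<times> real) set" where
  "Npt \<theta> w t = Mpt (Lpt (\<theta> + of_int \<lfloor>t\<rfloor>) w) (frac t)"

lemma Npt_slab:
  assumes "of_int k \<le> t" "t \<le> of_int k + 1" and w: "w \<in> {0..1}"
  shows "Npt \<theta> w t = Mpt (Lpt (\<theta> + of_int k) w) (t - of_int k)"
proof (cases "t = of_int k + 1")
  case True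
  then have "\<lfloor>t\<rfloor> = k + 1" by simp
  then have "Npt \<theta> w t = Mpt (Lpt (\<theta> + of_int k + 1) w) 0"
    using True by (simp add: Npt_def frac_def add.assoc)
  also have "\<dots> = Mpt (Lpt (\<theta> + of_int k) w) 1"
    using Mpt_1[OF Lpt_in_F[OF w]] rho_Lpt[OF w] by simp
  finally show ?thesis using True by simp
next
  case False
  then have "\<lfloor>t\<rfloor> = k" using assms by (simp add: floor_eq_iff)
  then show ?thesis by (simp add: Npt_def frac_def)
qed

lemma Npt_shift: "Npt \<theta> w (t + of_int j) = Npt (\<theta> + of_int j) w t"
  by (simp add: Npt_def frac_def algebra_simps)

lemma Npt_period: "w \<in> {0..1} \<Longrightarrow> Npt (\<theta> + 6 * of_int k) w t = Npt \<theta> w t"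
  using Lpt_period[of w "\<theta> + of_int \<lfloor>t\<rfloor>" k] by (simp add: Npt_def algebra_simps)

lemma Npt_in_M: "w \<in> {0..1} \<Longrightarrow> Npt \<theta> w t \<in> topspace M_space"
  unfolding topspace_M Npt_def using Lpt_in_F frac_lt_1[of t] frac_ge_0[of t] by force

lemma Npt_lattice: "w \<in> {0..1} \<Longrightarrow> lattice_equiv \<theta> t \<theta>' t' \<Longrightarrow> Npt \<theta> w t = Npt \<theta>' w t'"
  unfolding lattice_equiv_def using Npt_shift Npt_period by force

lemma Npt_eq_imp:
  assumes w: "w \<in> {0..1}" "w' \<in> {0..1}" and eq: "Npt \<theta> w t = Npt \<theta>' w' t'"
  obtains j :: int where "w' = w" "t' = t + of_int j"
    "Lpt (\<theta> + of_int \<lfloor>t\<rfloor>) w = Lpt (\<theta>' + of_int \<lfloor>t\<rfloor> + of_int j) w"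
proof
  let ?j = "\<lfloor>t'\<rfloor> - \<lfloor>t\<rfloor>"
  have *: "Lpt (\<theta> + of_int \<lfloor>t\<rfloor>) w = Lpt (\<theta>' + of_int \<lfloor>t'\<rfloor>) w'" "frac t = frac t'"
    using Mpt_inject[OF Lpt_in_F[OF w(1)] Lpt_in_F[OF w(2)]] eq frac_lt_1 frac_ge_0
    unfolding Npt_def by (metis atLeastLessThan_iff)+
  then show ww: "w' = w" using Lpt_eq_imp(1)[OF w *(1)] by simp
  show "Lpt (\<theta> + of_int \<lfloor>t\<rfloor>) w = Lpt (\<theta>' + of_int \<lfloor>t\<rfloor> + of_int ?j) w" using *(1) ww by simp
  show "t' = t + of_int ?j" using *(2) by (simp add: frac_def)
qed

text \<open>The vertical flow is well defined on all of \<open>M\<close>, including the levels \<open>w = 0\<close> and \<open>w = 1\<close> where the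
  coordinates fold.\<close>

lemma Npt_flow:
  assumes w: "w \<in> {0..1}" "w' \<in> {0..1}" and eq: "Npt \<theta> w t = Npt \<theta>' w' t'"
  shows "Npt \<theta> w (t + q) = Npt \<theta>' w' (t' + q)"
proof -
  obtain j :: int where j: "w' = w" "t' = t + of_int j"
    "Lpt (\<theta> + of_int \<lfloor>t\<rfloor>) w = Lpt (\<theta>' + of_int \<lfloor>t\<rfloor> + of_int j) w"
    using Npt_eq_imp[OF w eq] by blast
  have "Lpt (\<theta> + of_int \<lfloor>t + q\<rfloor>) w = Lpt (\<theta>' + of_int j + of_int \<lfloor>t + q\<rfloor>) w"
    using Lpt_shift[OF w(1) j(3), of "\<lfloor>t + q\<rfloor> - \<lfloor>t\<rfloor>"] by (simp add: algebra_simps)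
  then have "Npt \<theta> w (t + q) = Npt (\<theta>' + of_int j) w (t + q)" by (simp add: Npt_def)
  also have "\<dots> = Npt \<theta>' w (t + q + of_int j)" by (simp add: Npt_shift)
  finally show ?thesis using j by (simp add: algebra_simps)
qed

lemma Npt_inj:
  assumes w: "w \<in> {0<..<1}" "w' \<in> {0..1}" and eq: "Npt \<theta> w t = Npt \<theta>' w' t'"
  shows "w' = w" "lattice_equiv \<theta> t \<theta>' t'"
proof -
  have w01: "w \<in> {0..1}" using w by simp
  obtain j :: int where j: "w' = w" "t' = t + of_int j"
    "Lpt (\<theta> + of_int \<lfloor>t\<rfloor>) w = Lpt (\<theta>' + of_int \<lfloor>t\<rfloor> + of_int j) w"
    using Npt_eq_imp[OF w01 w(2) eq] by blast
  then show "w' = w" by simp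
  obtain k :: int where "\<theta>' + of_int \<lfloor>t\<rfloor> + of_int j = \<theta> + of_int \<lfloor>t\<rfloor> + 6 * of_int k"
    using Lpt_eq_imp(2)[OF w01 w01 j(3) w(1)] by blast
  then show "lattice_equiv \<theta> t \<theta>' t'"
    unfolding lattice_equiv_def using j(2) by (intro exI[of _ j] exI[of _ k]) simp
qed

lemma Npt_surj:
  assumes "m \<in> topspace M_space"
  obtains \<theta> w t where "\<theta> \<in> {0..6}" "w \<in> {0..1}" "t \<in> {0..1}" "m = Npt \<theta> w t"
proof -
  obtain x t where x: "x \<in> topspace F_surface" and t: "t \<in> {0..1}" and m: "m = Mpt x t"
    using assms unfolding topspace_M by blast
  obtain \<theta> w where w: "w \<in> {0..1}" "x = Lpt \<theta> w" using Lpt_surj[OF x] .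
  then have "m = Npt \<theta> w t" using Npt_slab[of 0 t w \<theta>] m t by simp
  moreover obtain \<theta>' t' where "\<theta>' \<in> {0..6}" "t' \<in> {0..1}" "lattice_equiv \<theta> t \<theta>' t'"
    by (rule lattice_equiv_box)
  ultimately show thesis using that[OF _ w(1)] Npt_lattice[OF w(1)] by metis
qed

lemma continuous_Npt: "continuous_map (top_of_set (UNIV \<times> {0..1} \<times> UNIV)) M_space (\<lambda>(\<theta>, w, t). Npt \<theta> w t)"
proof (rule continuous_map_slabs[of _ "\<lambda>p. snd (snd p)"])
  let ?X = "top_of_set (UNIV \<times> {0..1} \<times> UNIV) :: (real \<times> real \<times> real) topology"
  show "continuous_map ?X euclideanreal (\<lambda>p. snd (snd p))"
    unfolding continuous_map_iff_continuous by (intro continuous_intros)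
  fix k :: int
  let ?S = "{x \<in> topspace ?X. of_int k \<le> snd (snd x) \<and> snd (snd x) \<le> real_of_int k + 1}"
  have X: "subtopology ?X ?S = top_of_set ?S"
    unfolding subtopology_subtopology by (rule arg_cong[of _ _ top_of_set]) auto
  have 1: "continuous_map (top_of_set ?S) F_surface (\<lambda>p. (\<lambda>(\<theta>, w). Lpt \<theta> w) (fst p + of_int k, fst (snd p)))"
    by (rule continuous_map_compose_on[OF continuous_Lpt]) (auto intro!: continuous_intros)
  have 2: "continuous_map (top_of_set ?S) (top_of_set {0..1}) (\<lambda>p. snd (snd p) - of_int k)"
    unfolding continuous_map_in_subtopology continuous_map_iff_continuous
    by (intro conjI continuous_intros) auto
  have "continuous_map (top_of_set ?S) M_space (cls M_glue \<circ> (\<lambda>p. ((\<lambda>(\<theta>, w). Lpt \<theta> w) (fst p + of_int k, fst (snd p)),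
      snd (snd p) - of_int k)))"
    by (rule continuous_map_compose[OF continuous_map_pairedI[OF 1 2] continuous_Mpt])
  then show "continuous_map (subtopology ?X ?S) M_space (\<lambda>(\<theta>, w, t). Npt \<theta> w t)"
    unfolding X
  proof (rule continuous_map_eq)
    fix p assume "p \<in> topspace (top_of_set ?S)"
    then show "(cls M_glue \<circ> (\<lambda>p. ((\<lambda>(\<theta>, w). Lpt \<theta> w) (fst p + of_int k, fst (snd p)), snd (snd p) - of_int k))) p
        = (case p of (\<theta>, w, t) \<Rightarrow> Npt \<theta> w t)"
      using Npt_slab[of k "snd (snd p)" "fst (snd p)" "fst p"] by (auto simp: case_prod_unfold)
  qed
qed

lemma compact_M: "compact_space M_space"
proof -
  let ?Z = "{0..6::real} \<times> {0..1::real} \<times> {0..1::real}"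
  have "compactin (top_of_set (UNIV \<times> {0..1} \<times> UNIV)) ?Z"
    by (auto simp: compactin_subtopology intro!: compact_Times)
  from image_compactin[OF this continuous_Npt]
  have "compactin M_space ((\<lambda>(\<theta>, w, t). Npt \<theta> w t) ` ?Z)" .
  moreover have "(\<lambda>(\<theta>, w, t). Npt \<theta> w t) ` ?Z = topspace M_space"
  proof
    show "(\<lambda>(\<theta>, w, t). Npt \<theta> w t) ` ?Z \<subseteq> topspace M_space" using Npt_in_M by auto
    show "topspace M_space \<subseteq> (\<lambda>(\<theta>, w, t). Npt \<theta> w t) ` ?Z"
    proof
      fix m assume "m \<in> topspace M_space"
      then obtain \<theta> w t where "\<theta> \<in> {0..6}" "w \<in> {0..1}" "t \<in> {0..1}" "m = Npt \<theta> w t"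
        by (rule Npt_surj)
      then show "m \<in> (\<lambda>(\<theta>, w, t). Npt \<theta> w t) ` ?Z" by (intro image_eqI[of _ _ "(\<theta>, w, t)"]) auto
    qed
  qed
  ultimately show ?thesis by (simp add: compact_space_def)
qed

section \<open>The two sides of the torus\<close>

lemma cos_add_2pi_int: "cos (x + 2 * pi * of_int k) = cos x"
  using sin_cos_eq_iff[of "x + 2 * pi * of_int k" x] by blast

text \<open>In sheared coordinates this is \<open>cos (\<pi> w)\<close>.  It is invariant under \<open>\<Gamma>\<close>, vanishes exactly on the image of
  \<open>D\<close>, and is positive on the image of the inner side.\<close>

definition pillow_height :: "(real \<times> real) set \<Rightarrow> real" where
  "pillow_height c = the_elem ((\<lambda>(x, y). cos (pi * (y - 2 * x))) ` c)"

lemma pillow_height_cls: "pillow_height (cls Gamma_rel (x, y)) = cos (pi * (y - 2 * x))"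
proof -
  have "(\<lambda>(x, y). cos (pi * (y - 2 * x))) p = (\<lambda>(x, y). cos (pi * (y - 2 * x))) q" if "Gamma_rel p q" for p q
    using that
  proof cases
    case (1 x y a b)
    have "cos (pi * ((2 * of_int b - y) - 2 * (2 * of_int a - x))) =
        cos (- (pi * (y - 2 * x)) + 2 * pi * of_int (b - 2 * a))" by (simp add: algebra_simps)
    also have "\<dots> = cos (pi * (y - 2 * x))" by (simp only: cos_add_2pi_int cos_minus)
    finally show ?thesis using 1 by simp
  qed
  from the_elem_image_cls[of Gamma_rel, OF this] show ?thesis
    unfolding pillow_height_def by simp
qed

definition F_height :: "(real \<times> real) set \<Rightarrow> real" where
  "F_height x = pillow_height (proj x)"

lemma F_height_Fpt: "F_height (Fpt \<theta> s) = cos (pi * (s - 2 * \<theta>))"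
  by (simp add: F_height_def proj_Fpt pillow_height_cls)

lemma F_height_Lpt: "w \<in> {0..1} \<Longrightarrow> F_height (Lpt \<theta> w) = cos (pi * w)"
  by (simp add: F_height_def proj_Lpt pillow_height_cls)

lemma continuous_F_height: "continuous_map F_surface euclideanreal F_height"
  unfolding F_surface_def
proof (rule continuous_map_from_quotient)
  have "continuous_on S (\<lambda>p. cos (pi * (snd p - 2 * fst p)))" for S :: "(real \<times> real) set"
    by (intro continuous_intros)
  moreover have "F_height (cls F_glue p) = cos (pi * (snd p - 2 * fst p))" for p
    using F_height_Fpt[of "fst p" "snd p"] by simp
  ultimately show "continuous_map (top_of_set (UNIV \<times> {0..1})) euclideanreal (\<lambda>p. F_height (cls F_glue p))"
    by simp
qed

definition M_height :: "((real \<times> real) set \<times> real) set \<Rightarrow> real" where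
  "M_height m = the_elem ((\<lambda>(x, t). F_height x) ` m)"

lemma M_height_Mpt: "M_height (Mpt x t) = F_height x"
proof -
  have "(\<lambda>(x, t). F_height x) p = (\<lambda>(x, t). F_height x) q" if "M_glue p q" for p q
    using that
  proof cases
    case (1 x)
    then obtain \<theta> s where x: "x = Fpt \<theta> s" unfolding topspace_F by blast
    have "cos (pi * (s - 2 * (\<theta> + 1))) = cos (pi * (s - 2 * \<theta>) + 2 * pi * of_int (-1))"
      by (simp add: algebra_simps)
    then have "F_height (rho x) = F_height x"
      unfolding x rho_Fpt F_height_Fpt by (simp only: cos_add_2pi_int)
    then show ?thesis using 1 by simp
  qed
  from the_elem_image_cls[of M_glue, OF this] show ?thesis
    unfolding M_height_def by simp
qed

lemma M_height_Npt: "w \<in> {0..1} \<Longrightarrow> M_height (Npt \<theta> w t) = cos (pi * w)"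
  by (simp add: Npt_def M_height_Mpt F_height_Lpt)

lemma continuous_M_height: "continuous_map M_space euclideanreal M_height"
  unfolding M_space_def
proof (rule continuous_map_from_quotient)
  have "continuous_map (prod_topology F_surface (top_of_set {0..1::real})) euclideanreal (F_height \<circ> fst)"
    by (rule continuous_map_compose[OF continuous_map_fst continuous_F_height])
  moreover have "M_height (cls M_glue p) = (F_height \<circ> fst) p" for p
    using M_height_Mpt[of "fst p" "snd p"] by simp
  ultimately show "continuous_map (prod_topology F_surface (top_of_set {0..1})) euclideanreal (\<lambda>p. M_height (cls M_glue p))"
    by (simp add: o_def)
qed

lemma cos_pi_less_iff: "w \<in> {0..1} \<Longrightarrow> w' \<in> {0..1} \<Longrightarrow> cos (pi * w) < cos (pi * w') \<longleftrightarrow> w' < w"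
  using cos_mono_less_eq[of "pi * w" "pi * w'"] by simp

lemma cos_pi_pos_iff: "w \<in> {0..1} \<Longrightarrow> 0 < cos (pi * w) \<longleftrightarrow> w < 1/2"
  using cos_pi_less_iff[of "1/2" w] by simp

lemma cos_pi_neg_iff: "w \<in> {0..1} \<Longrightarrow> cos (pi * w) < 0 \<longleftrightarrow> 1/2 < w"
  using cos_pi_less_iff[of w "1/2"] by simp

lemma cos_pi_zero_iff: "w \<in> {0..1} \<Longrightarrow> cos (pi * w) = 0 \<longleftrightarrow> w = 1/2"
  using cos_pi_pos_iff[of w] cos_pi_neg_iff[of w] by auto

text \<open>In sheared coordinates the set is the image of a product of intervals.\<close>

lemma connected_height_range:
  assumes "is_interval R"
  shows "connectedin M_space {m \<in> topspace M_space. M_height m \<in> R}"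
proof -
  let ?W = "{w \<in> {0..1}. cos (pi * w) \<in> R}"
  have "is_interval ?W"
    unfolding is_interval_1
  proof (intro ballI allI impI)
    fix a b x assume a: "a \<in> ?W" and b: "b \<in> ?W" and x: "a \<le> x \<and> x \<le> b"
    then have x01: "x \<in> {0..1}" by auto
    have "cos (pi * b) \<le> cos (pi * x)" "cos (pi * x) \<le> cos (pi * a)"
      using x a b x01 by (auto intro!: cos_monotone_0_pi_le)
    then show "x \<in> ?W" using assms a b x01 unfolding is_interval_1 by blast
  qed
  then have "connected (UNIV \<times> ?W \<times> UNIV :: (real \<times> real \<times> real) set)"
    by (intro connected_Times connected_UNIV) (simp add: is_interval_connected_1)
  then have "connectedin (top_of_set (UNIV \<times> {0..1} \<times> UNIV)) (UNIV \<times> ?W \<times> UNIV :: (real \<times> real \<times> real) set)"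
    by (auto simp: connectedin_subtopology)
  from connectedin_continuous_map_image[OF continuous_Npt this]
  have "connectedin M_space ((\<lambda>(\<theta>, w, t). Npt \<theta> w t) ` (UNIV \<times> ?W \<times> UNIV))" .
  moreover have "(\<lambda>(\<theta>, w, t). Npt \<theta> w t) ` (UNIV \<times> ?W \<times> UNIV) = {m \<in> topspace M_space. M_height m \<in> R}"
  proof
    show "(\<lambda>(\<theta>, w, t). Npt \<theta> w t) ` (UNIV \<times> ?W \<times> UNIV) \<subseteq> {m \<in> topspace M_space. M_height m \<in> R}"
      using Npt_in_M M_height_Npt by auto
    show "{m \<in> topspace M_space. M_height m \<in> R} \<subseteq> (\<lambda>(\<theta>, w, t). Npt \<theta> w t) ` (UNIV \<times> ?W \<times> UNIV)"
    proof
      fix m assume m: "m \<in> {m \<in> topspace M_space. M_height m \<in> R}"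
      then obtain \<theta> w t where w: "w \<in> {0..1}" "m = Npt \<theta> w t" by (auto elim: Npt_surj)
      then have "cos (pi * w) \<in> R" using m M_height_Npt by simp
      with w show "m \<in> (\<lambda>(\<theta>, w, t). Npt \<theta> w t) ` (UNIV \<times> ?W \<times> UNIV)"
        by (intro image_eqI[of _ _ "(\<theta>, w, t)"]) auto
    qed
  qed
  ultimately show ?thesis by simp
qed

lemma D_curve_height: "D_curve = {x \<in> topspace F_surface. F_height x = 0}"
proof -
  have "proj x \<in> cls Gamma_rel ` {(\<theta>, s). s = 2 * \<theta> + 1/2} \<longleftrightarrow> F_height x = 0" if x: "x \<in> topspace F_surface" for x
  proof
    assume "proj x \<in> cls Gamma_rel ` {(\<theta>, s). s = 2 * \<theta> + 1/2}"
    then obtain \<theta> where "proj x = cls Gamma_rel (\<theta>, 2 * \<theta> + 1/2)" by auto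
    then have "F_height x = cos (pi * (1/2))" by (simp add: F_height_def pillow_height_cls)
    then show "F_height x = 0" by simp
  next
    assume h: "F_height x = 0"
    obtain \<theta> w where w: "w \<in> {0..1}" "x = Lpt \<theta> w" using Lpt_surj[OF x] .
    then have w2: "w = 1/2" using h F_height_Lpt cos_pi_zero_iff by simp
    have "x = Lpt \<theta> (1/2)" using w(2) unfolding w2 .
    then have "proj x = cls Gamma_rel (\<theta>, 2 * \<theta> + 1/2)"
      using proj_Lpt[of "1/2" \<theta>] by (simp add: add.commute)
    then show "proj x \<in> cls Gamma_rel ` {(\<theta>, s). s = 2 * \<theta> + 1/2}" by auto
  qed
  then show ?thesis unfolding D_curve_def by blast
qed

lemma D_curve_Lpt: "x \<in> D_curve \<longleftrightarrow> (\<exists>\<theta>. x = Lpt \<theta> (1/2))"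
proof
  assume "x \<in> D_curve"
  then have x: "x \<in> topspace F_surface" "F_height x = 0" by (auto simp: D_curve_height)
  obtain \<theta> w where w: "w \<in> {0..1}" "x = Lpt \<theta> w" using Lpt_surj[OF x(1)] .
  then have "w = 1/2" using x(2) F_height_Lpt cos_pi_zero_iff by simp
  then show "\<exists>\<theta>. x = Lpt \<theta> (1/2)" using w by blast
next
  assume "\<exists>\<theta>. x = Lpt \<theta> (1/2)"
  then show "x \<in> D_curve" using Lpt_in_F F_height_Lpt by (auto simp: D_curve_height)
qed

lemma T_torus_Npt: "T_torus = (\<lambda>(\<theta>, t). Npt \<theta> (1/2) t) ` (UNIV \<times> {0..1})"
proof (rule set_eqI)
  fix m
  have e: "Npt \<theta> (1/2) t = Mpt (Lpt \<theta> (1/2)) t" if "t \<in> {0..1}" for \<theta> t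
    using that Npt_slab[of 0 t "1/2" \<theta>] by simp
  have "m \<in> T_torus \<longleftrightarrow> (\<exists>\<theta> t. t \<in> {0..1} \<and> m = Mpt (Lpt \<theta> (1/2)) t)"
    unfolding T_torus_def mem_Collect_eq D_curve_Lpt by metis
  also have "\<dots> \<longleftrightarrow> (\<exists>\<theta> t. t \<in> {0..1} \<and> m = Npt \<theta> (1/2) t)"
    by (metis e)
  finally show "m \<in> T_torus \<longleftrightarrow> m \<in> (\<lambda>(\<theta>, t). Npt \<theta> (1/2) t) ` (UNIV \<times> {0..1})"
    by (simp add: image_iff Bex_def split_paired_Ex)
qed

lemma Npt_in_T: "Npt \<theta> (1/2) t \<in> T_torus"
proof -
  obtain \<theta>' t' where "t' \<in> {0..1}" "lattice_equiv \<theta> t \<theta>' t'" by (rule lattice_equiv_box)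
  then have "Npt \<theta> (1/2) t = Npt \<theta>' (1/2) t'" "t' \<in> {0..1}" using Npt_lattice by simp_all
  then show ?thesis unfolding T_torus_Npt by (intro image_eqI[of _ _ "(\<theta>', t')"]) auto
qed

text \<open>The height cannot change its sign on a connected set that avoids \<open>D\<close>.\<close>

lemma component_height:
  assumes x: "x \<in> connected_component_of_set (subtopology F_surface (topspace F_surface - D_curve)) v"
  shows "F_height x \<noteq> 0" "0 < F_height x \<longleftrightarrow> 0 < F_height v"
proof -
  let ?X = "subtopology F_surface (topspace F_surface - D_curve)"
  let ?C = "connected_component_of_set ?X v"
  have C: "connectedin ?X ?C" by (rule connectedin_connected_component_of)
  have v: "v \<in> ?C" using x by (metis connected_component_of_equiv connected_component_of_refl mem_Collect_eq)
  have "connectedin euclideanreal (F_height ` ?C)"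
    by (rule connectedin_continuous_map_image[OF continuous_map_from_subtopology[OF continuous_F_height] C])
  then have conn: "connected (F_height ` ?C)" by simp
  have nz: "F_height y \<noteq> 0" if "y \<in> ?C" for y
  proof -
    have "y \<in> topspace ?X" using C that connectedin_subset_topspace by blast
    then show ?thesis by (auto simp: D_curve_height)
  qed
  show "F_height x \<noteq> 0" using nz x by blast
  have "0 \<notin> F_height ` ?C" using nz by (metis imageE)
  then show "0 < F_height x \<longleftrightarrow> 0 < F_height v"
    using connectedD_interval[OF conn, of "F_height x" "F_height v" 0]
      connectedD_interval[OF conn, of "F_height v" "F_height x" 0] x v nz[OF x] nz[OF v]
    by (meson imageI linorder_neqE_linordered_idom less_imp_le)
qed

lemma inner_side_height: "m \<in> inner_side \<Longrightarrow> 0 < M_height m"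
  unfolding inner_side_def M_side_def using component_height(2)[of _ "Fpt 0 0"]
  by (auto simp: M_height_Mpt F_height_Fpt)

lemma outer_side_height: "m \<in> outer_side \<Longrightarrow> M_height m < 0"
proof -
  assume "m \<in> outer_side"
  then obtain x t where m: "m = Mpt x t"
    and x: "x \<in> connected_component_of_set (subtopology F_surface (topspace F_surface - D_curve)) (Fpt 0 1)"
    unfolding outer_side_def M_side_def by blast
  show ?thesis using component_height[OF x] unfolding m M_height_Mpt by (simp add: F_height_Fpt)
qed

section \<open>Independence of the collar\<close>

text \<open>The tube that sweeps out all of \<open>M\<close>, from the folded outer level \<open>w = 1\<close> to the folded inner level
  \<open>w = 0\<close>, in the direction in which the Dehn twist crosses its collar.\<close>

definition std_tube :: "real \<times> real \<times> real \<Rightarrow> ((real \<times> real) set \<times> real) set" where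
  "std_tube = (\<lambda>(\<theta>, t, r). Npt \<theta> (1 - r) t)"

lemma tube_std: "tube M_space std_tube"
  unfolding tube_def
proof (intro conjI allI impI)
  have "continuous_map (top_of_set (layers {0..1})) M_space
      (\<lambda>z. (\<lambda>(\<theta>, w, t). Npt \<theta> w t) ((\<lambda>(\<theta>, t, r). (\<theta>, 1 - r, t)) z))"
    by (rule continuous_map_compose_on[OF continuous_Npt]) (auto simp: case_prod_unfold intro!: continuous_intros)
  then show "continuous_map (top_of_set (layers {0..1})) M_space std_tube"
    by (simp add: std_tube_def case_prod_unfold)
  show "std_tube (\<theta>, t, r) = std_tube (\<theta>', t', r)" if "r \<in> {0..1}" "lattice_equiv \<theta> t \<theta>' t'" for \<theta> t \<theta>' t' r
    using that Npt_lattice[of "1 - r" \<theta> t \<theta>' t'] by (simp add: std_tube_def)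
  show "r = r'" "lattice_equiv \<theta> t \<theta>' t'"
    if "r \<in> {0<..<1}" "r' \<in> {0..1}" "std_tube (\<theta>, t, r) = std_tube (\<theta>', t', r')" for \<theta> t r \<theta>' t' r'
    using that Npt_inj[of "1 - r" "1 - r'" \<theta> t \<theta>' t'] by (auto simp: std_tube_def)
  have "std_tube ` (layers {0<..<1}) = {m \<in> topspace M_space. M_height m \<in> {-1<..<1}}"
  proof
    have "cos (pi * w) \<in> {-1<..<1} \<longleftrightarrow> w \<in> {0<..<1}" if "w \<in> {0..1}" for w
      using cos_pi_less_iff[of w 0] cos_pi_less_iff[of 1 w] that by auto
    note * = this
    show "std_tube ` (layers {0<..<1}) \<subseteq> {m \<in> topspace M_space. M_height m \<in> {-1<..<1}}"
    proof clarify
      fix \<theta> t r :: real assume "r \<in> {0<..<1}"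
      then show "std_tube (\<theta>, t, r) \<in> topspace M_space \<and> M_height (std_tube (\<theta>, t, r)) \<in> {-1<..<1}"
        using *[of "1 - r"] Npt_in_M[of "1 - r" \<theta> t] M_height_Npt[of "1 - r" \<theta> t] by (simp add: std_tube_def)
    qed
    show "{m \<in> topspace M_space. M_height m \<in> {-1<..<1}} \<subseteq> std_tube ` (layers {0<..<1})"
    proof
      fix m assume m: "m \<in> {m \<in> topspace M_space. M_height m \<in> {-1<..<1}}"
      then obtain \<theta> w t where w: "w \<in> {0..1}" "m = Npt \<theta> w t" by (auto elim: Npt_surj)
      then have "w \<in> {0<..<1}" using m * M_height_Npt by simp
      then show "m \<in> std_tube ` (layers {0<..<1})"
        using w by (intro image_eqI[of _ _ "(\<theta>, t, 1 - w)"]) (auto simp: std_tube_def)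
    qed
  qed
  moreover have "openin M_space {m \<in> topspace M_space. M_height m \<in> {-1<..<1}}"
    by (rule openin_continuous_map_preimage[OF continuous_M_height]) simp
  ultimately show "openin M_space (std_tube ` (layers {0<..<1}))" by simp
qed

definition collar_tube ::
  "(((real \<times> real) set \<times> real) set \<times> real \<Rightarrow> 'm) \<Rightarrow> real \<times> real \<times> real \<Rightarrow> 'm" where
  "collar_tube \<kappa> = (\<lambda>(\<theta>, t, r). \<kappa> (Npt \<theta> (1/2) t, r))"

lemma collar_tube_image: "collar_tube \<kappa> ` (layers R) = \<kappa> ` (T_torus \<times> R)"
proof
  show "collar_tube \<kappa> ` (layers R) \<subseteq> \<kappa> ` (T_torus \<times> R)"
    unfolding collar_tube_def using Npt_in_T by auto
  show "\<kappa> ` (T_torus \<times> R) \<subseteq> collar_tube \<kappa> ` (layers R)"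
  proof clarify
    fix y r assume "y \<in> T_torus" "r \<in> R"
    then obtain \<theta> t where "y = Npt \<theta> (1/2) t" unfolding T_torus_Npt by auto
    then show "\<kappa> (y, r) \<in> collar_tube \<kappa> ` (layers R)"
      using \<open>r \<in> R\<close> by (intro image_eqI[of _ _ "(\<theta>, t, r)"]) (auto simp: collar_tube_def)
  qed
qed

lemma tube_collar:
  assumes "T_collar \<kappa>"
  shows "tube M_space (collar_tube \<kappa>)"
  unfolding tube_def
proof (intro conjI allI impI)
  let ?X = "prod_topology (subtopology M_space T_torus) (top_of_set {0..1::real})"
  have emb: "embedding_map ?X M_space \<kappa>" and op: "openin M_space (\<kappa> ` (T_torus \<times> {0<..<1}))"
    using assms unfolding T_collar_def by blast+
  have hm: "homeomorphic_map ?X (subtopology M_space (\<kappa> ` topspace ?X)) \<kappa>"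
    using emb unfolding embedding_map_def .
  have contk: "continuous_map ?X M_space \<kappa>"
    by (rule continuous_map_into_fulltopology[OF homeomorphic_imp_continuous_map[OF hm]])
  have T: "T_torus \<subseteq> topspace M_space" unfolding T_torus_Npt using Npt_in_M by auto
  have "continuous_map (top_of_set (layers {0..1})) M_space
      (\<lambda>z. (\<lambda>(\<theta>, w, t). Npt \<theta> w t) ((\<lambda>(\<theta>, t, r). (\<theta>, 1/2, t)) z))"
    by (rule continuous_map_compose_on[OF continuous_Npt]) (auto simp: case_prod_unfold intro!: continuous_intros)
  then have "continuous_map (top_of_set (layers {0..1})) (subtopology M_space T_torus)
      (\<lambda>z. Npt (fst z) (1/2) (fst (snd z)))"
    using Npt_in_T by (auto simp: continuous_map_in_subtopology case_prod_unfold)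
  moreover have "continuous_map (top_of_set (layers {0..1})) (top_of_set {0..1})
      (\<lambda>z :: real \<times> real \<times> real. snd (snd z))"
    unfolding continuous_map_in_subtopology continuous_map_iff_continuous
    by (intro conjI continuous_intros) auto
  ultimately have "continuous_map (top_of_set (layers {0..1})) ?X
      (\<lambda>z. (Npt (fst z) (1/2) (fst (snd z)), snd (snd z)))"
    by (rule continuous_map_pairedI)
  from continuous_map_compose[OF this contk]
  show "continuous_map (top_of_set (layers {0..1})) M_space (collar_tube \<kappa>)"
    by (simp add: collar_tube_def o_def case_prod_unfold)
  show "collar_tube \<kappa> (\<theta>, t, r) = collar_tube \<kappa> (\<theta>', t', r)" if "lattice_equiv \<theta> t \<theta>' t'" for \<theta> t \<theta>' t' r
    using Npt_lattice[OF _ that, of "1/2"] by (simp add: collar_tube_def)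
  have "inj_on \<kappa> (T_torus \<times> {0..1})"
    using homeomorphic_imp_injective_map[OF hm] T by (simp add: Int_absorb1)
  note inj = inj_onD[OF this]
  show "r = r'" "lattice_equiv \<theta> t \<theta>' t'"
    if "r \<in> {0<..<1}" "r' \<in> {0..1}" "collar_tube \<kappa> (\<theta>, t, r) = collar_tube \<kappa> (\<theta>', t', r')" for \<theta> t r \<theta>' t' r'
  proof -
    have "(Npt \<theta> (1/2) t, r) = (Npt \<theta>' (1/2) t', r')"
      using that Npt_in_T by (intro inj) (auto simp: collar_tube_def)
    then show "r = r'" "lattice_equiv \<theta> t \<theta>' t'" using Npt_inj(2)[of "1/2" "1/2" \<theta> t \<theta>' t'] by auto
  qed
  show "openin M_space (collar_tube \<kappa> ` (layers {0<..<1}))"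
    unfolding collar_tube_image by (rule op)
qed

lemma twist_along_cong:
  assumes "\<And>\<theta> t r. r \<in> {0..1} \<Longrightarrow> K (\<theta>, t, r) = K' (\<theta>, t, r)"
  shows "twist_along K B q = twist_along K' B q"
proof
  fix m
  have 1: "K ` (layers {0..1}) = K' ` (layers {0..1})"
    using assms by (intro image_cong) auto
  have "(\<exists>\<theta> t r. r \<in> {0..1} \<and> m = K (\<theta>, t, r) \<and> y = K (B r \<theta>, t + q r, r)) \<longleftrightarrow>
      (\<exists>\<theta> t r. r \<in> {0..1} \<and> m = K' (\<theta>, t, r) \<and> y = K' (B r \<theta>, t + q r, r))" for y
    using assms by metis
  then show "twist_along K B q m = twist_along K' B q m"
    unfolding twist_along_def 1 by simp
qed

text \<open>A twist can be pushed through the torus: both tubes are parts of their join.\<close>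

lemma twist_along_sides_isotopic:
  assumes K: "tube M_space K" and K': "tube M_space K'"
    and T: "\<And>\<theta> t. K (\<theta>, t, 1) = Npt \<theta> (1/2) t" "\<And>\<theta> t. K' (\<theta>, t, 0) = Npt \<theta> (1/2) t"
    and out: "\<And>\<theta> t r. 0 \<le> r \<Longrightarrow> r < 1 \<Longrightarrow> M_height (K (\<theta>, t, r)) < 0"
    and inn: "\<And>\<theta> t r. 0 < r \<Longrightarrow> r \<le> 1 \<Longrightarrow> 0 < M_height (K' (\<theta>, t, r))"
    and P: "twist_path n B q" and P': "twist_path n B' q'" and V: "V \<subseteq> topspace M_space"
  shows "isotopic_in M_space (twist_along K B q ` V) (twist_along K' B' q' ` V)"
    and "isotopic_in M_space (twist_along K' B' q' ` V) (twist_along K B q ` V)"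
proof -
  let ?J = "\<lambda>(\<theta>, t, r). if r \<le> 1/2 then K (\<theta>, t, 2 * r) else K' (\<theta>, t, 2 * r - 1)"
  have J: "tube M_space ?J"
  proof (rule tube_join[OF Hausdorff_M K K' continuous_M_height])
    show "connectedin M_space {m \<in> topspace M_space. 0 < M_height m \<and> M_height m < e}" for e
      using connected_height_range[of "{0<..<e}"] by (simp add: is_interval_oo)
    have *: "0 < - x \<and> - x < e \<longleftrightarrow> x \<in> {-e<..<0}" for x e :: real by auto
    show "connectedin M_space {m \<in> topspace M_space. 0 < - M_height m \<and> - M_height m < e}" for e
      unfolding * by (rule connected_height_range) (simp add: is_interval_oo)
    show "\<exists>\<theta> t. m = K (\<theta>, t, 1)" if m: "m \<in> topspace M_space" "M_height m = 0" for m
    proof -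
      obtain \<theta> w t where w: "w \<in> {0..1}" "m = Npt \<theta> w t" using Npt_surj[OF m(1)] by metis
      then have "w = 1/2" using m(2) M_height_Npt cos_pi_zero_iff by simp
      then show ?thesis using w T by metis
    qed
    show "M_height (K (\<theta>, t, 1)) = 0" for \<theta> t using T M_height_Npt by simp
    show "lattice_equiv \<theta> t \<theta>' t'" if "K (\<theta>, t, 1) = K (\<theta>', t', 1)" for \<theta> t \<theta>' t'
      using that T Npt_inj(2)[of "1/2" "1/2"] by simp
  qed (use T out inn in auto)
  have 1: "twist_along (\<lambda>(\<theta>, t, r). ?J (\<theta>, t, 0 + (1/2 - 0) * r)) B q = twist_along K B q"
    by (rule twist_along_cong) auto
  have "?J (\<theta>, t, 1/2 + (1 - 1/2) * r) = K' (\<theta>, t, r)" if "r \<in> {0..1}" for \<theta> t r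
    using that T by (cases "r = 0") auto
  then have 2: "twist_along (\<lambda>(\<theta>, t, r). ?J (\<theta>, t, 1/2 + (1 - 1/2) * r)) B' q' = twist_along K' B' q'"
    by (intro twist_along_cong) auto
  have h: "(0::real) \<le> 0" "(0::real) < 1/2" "(1/2::real) \<le> 1" "(0::real) \<le> 1/2" "(1/2::real) < 1" "(1::real) \<le> 1" by auto
  have A: "isotopic_in M_space (twist_along ?J B q ` V) (twist_along K B q ` V)"
    "isotopic_in M_space (twist_along K B q ` V) (twist_along ?J B q ` V)"
    using twist_along_subtube_isotopic[OF compact_M Hausdorff_M J h(1-3) P P V] unfolding 1 by blast+
  have B: "isotopic_in M_space (twist_along ?J B q ` V) (twist_along K' B' q' ` V)"
    "isotopic_in M_space (twist_along K' B' q' ` V) (twist_along ?J B q ` V)"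
    using twist_along_subtube_isotopic[OF compact_M Hausdorff_M J h(4-6) P' P V] unfolding 2 by blast+
  show "isotopic_in M_space (twist_along K B q ` V) (twist_along K' B' q' ` V)"
    using isotopic_in_trans[OF A(2) B(1)] .
  show "isotopic_in M_space (twist_along K' B' q' ` V) (twist_along K B q ` V)"
    using isotopic_in_trans[OF B(2) A(1)] .
qed

text \<open>This is the uniqueness of the twist.  An arbitrary collar cannot easily be compared with the standard
  one on the same side of \<open>T\<close>, but it can be joined with the standard one on the other side.\<close>

lemma twist_along_collar_isotopic_std:
  assumes \<kappa>: "T_collar \<kappa>" and P: "twist_path n B q" and P': "twist_path n B' q'" and V: "V \<subseteq> topspace M_space"
  shows "isotopic_in M_space (twist_along (collar_tube \<kappa>) B q ` V) (twist_along std_tube B' q' ` V)"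
proof -
  let ?K = "collar_tube \<kappa>"
  have K: "tube M_space ?K" by (rule tube_collar[OF \<kappa>])
  obtain c where c: "c \<in> {0..1}" and mid: "\<forall>y\<in>T_torus. \<kappa> (y, c) = y"
    and out: "\<kappa> ` (T_torus \<times> {0..<c}) \<subseteq> outer_side" and inn: "\<kappa> ` (T_torus \<times> {c<..1}) \<subseteq> inner_side"
    using \<kappa> unfolding T_collar_def by (elim conjE bexE) simp
  have Kc: "?K (\<theta>, t, c) = Npt \<theta> (1/2) t" for \<theta> t
    using mid Npt_in_T[of \<theta> t] by (simp add: collar_tube_def)
  have Kout: "M_height (?K (\<theta>, t, r)) < 0" if "0 \<le> r" "r < c" for \<theta> t r
  proof -
    have "?K (\<theta>, t, r) \<in> \<kappa> ` (T_torus \<times> {0..<c})" using that Npt_in_T by (auto simp: collar_tube_def)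
    then show ?thesis using out outer_side_height by blast
  qed
  have Kinn: "0 < M_height (?K (\<theta>, t, r))" if "c < r" "r \<le> 1" for \<theta> t r
  proof -
    have "?K (\<theta>, t, r) \<in> \<kappa> ` (T_torus \<times> {c<..1})" using that Npt_in_T by (auto simp: collar_tube_def)
    then show ?thesis using inn inner_side_height by blast
  qed
  have S: "M_height (std_tube (\<theta>, t, r)) = cos (pi * (1 - r))" if "r \<in> {0..1}" for \<theta> t r
    using that M_height_Npt[of "1 - r"] by (simp add: std_tube_def)
  show ?thesis
  proof (cases "c = 0")
    case True
    \<comment> \<open>The whole collar lies on the inner side, and the outer half of the standard tube is joined to it.\<close>
    let ?S = "\<lambda>(\<theta>, t, r). std_tube (\<theta>, t, 0 + (1/2 - 0) * r)"
    have "isotopic_in M_space (twist_along ?K B q ` V) (twist_along ?S B q ` V)"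
    proof (rule twist_along_sides_isotopic(2)[OF _ K _ _ _ _ P P V])
      show "tube M_space ?S" by (rule subtube[OF tube_std Hausdorff_M]) auto
      show "M_height (?S (\<theta>, t, r)) < 0" if "0 \<le> r" "r < 1" for \<theta> t r
        using that S[of "r / 2" \<theta> t] cos_pi_neg_iff[of "1 - r / 2"] by simp
    qed (use Kc Kinn True in \<open>auto simp: std_tube_def\<close>)
    moreover have "isotopic_in M_space (twist_along ?S B q ` V) (twist_along std_tube B' q' ` V)"
      by (rule twist_along_subtube_isotopic(2)[OF compact_M Hausdorff_M tube_std _ _ _ P P' V]) auto
    ultimately show ?thesis by (rule isotopic_in_trans)
  next
    case False
    then have c0: "0 < c" using c by simp
    \<comment> \<open>The outer part of the collar is joined with the inner half of the standard tube.\<close>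
    let ?L = "\<lambda>(\<theta>, t, r). ?K (\<theta>, t, 0 + (c - 0) * r)"
    let ?S = "\<lambda>(\<theta>, t, r). std_tube (\<theta>, t, 1/2 + (1 - 1/2) * r)"
    have "isotopic_in M_space (twist_along ?K B q ` V) (twist_along ?L B q ` V)"
      using c c0 by (intro twist_along_subtube_isotopic(1)[OF compact_M Hausdorff_M K _ _ _ P P V]) auto
    moreover have "isotopic_in M_space (twist_along ?L B q ` V) (twist_along ?S B q ` V)"
    proof (rule twist_along_sides_isotopic(1)[OF _ _ _ _ _ _ P P V])
      show "tube M_space ?L" using c c0 by (intro subtube[OF K Hausdorff_M]) auto
      show "tube M_space ?S" by (rule subtube[OF tube_std Hausdorff_M]) auto
      show "M_height (?L (\<theta>, t, r)) < 0" if "0 \<le> r" "r < 1" for \<theta> t r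
        using that c0 Kout[of "c * r" \<theta> t] by simp
      show "0 < M_height (?S (\<theta>, t, r))" if "0 < r" "r \<le> 1" for \<theta> t r
        using that S[of "1/2 + r / 2" \<theta> t] cos_pi_pos_iff[of "1 - (1/2 + r / 2)"] by simp
    qed (use Kc in \<open>auto simp: std_tube_def\<close>)
    moreover have "isotopic_in M_space (twist_along ?S B q ` V) (twist_along std_tube B' q' ` V)"
      by (rule twist_along_subtube_isotopic(2)[OF compact_M Hausdorff_M tube_std _ _ _ P P' V]) auto
    ultimately show ?thesis using isotopic_in_trans by blast
  qed
qed

section \<open>Lifting the parametrization of D\<close>

lemma cis_third_eq_iff: "cis (pi / 3 * x) = cis (pi / 3 * y) \<longleftrightarrow> (\<exists>k::int. x = y + 6 * of_int k)"
proof -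
  have "pi / 3 * x = pi / 3 * y + 2 * pi * of_int k \<longleftrightarrow> x = y + 6 * of_int k" for k
  proof -
    have "pi / 3 * x = pi / 3 * y + 2 * pi * of_int k \<longleftrightarrow> pi * x = pi * (y + 6 * of_int k)"
      by (simp add: field_simps)
    then show ?thesis by simp
  qed
  then show ?thesis unfolding cis_eq_cis_iff by simp
qed

lemma Lpt_half_eq_iff: "Lpt \<theta> (1/2) = Lpt \<theta>' (1/2) \<longleftrightarrow> cis (pi / 3 * \<theta>) = cis (pi / 3 * \<theta>')"
proof
  assume "Lpt \<theta> (1/2) = Lpt \<theta>' (1/2)"
  then have "\<exists>k::int. \<theta>' = \<theta> + 6 * of_int k" using Lpt_eq_imp(2)[of "1/2" "1/2"] by simp
  then show "cis (pi / 3 * \<theta>) = cis (pi / 3 * \<theta>')" using cis_third_eq_iff by metis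
next
  assume "cis (pi / 3 * \<theta>) = cis (pi / 3 * \<theta>')"
  then obtain k :: int where "\<theta> = \<theta>' + 6 * of_int k" using cis_third_eq_iff by blast
  then show "Lpt \<theta> (1/2) = Lpt \<theta>' (1/2)" using Lpt_period[of "1/2" \<theta>' k] by simp
qed

text \<open>The coordinate on \<open>D\<close> that identifies \<open>\<theta>\<close> modulo 6 with an angle.\<close>

definition D_angle :: "(real \<times> real) set \<Rightarrow> complex" where
  "D_angle x = cis (pi / 3 * (SOME \<theta>. x = Lpt \<theta> (1/2)))"

lemma D_angle_Lpt: "D_angle (Lpt \<theta> (1/2)) = cis (pi / 3 * \<theta>)"
proof -
  have "Lpt \<theta> (1/2) = Lpt (SOME \<theta>'. Lpt \<theta> (1/2) = Lpt \<theta>' (1/2)) (1/2)" by (rule someI) (rule refl)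
  then show ?thesis unfolding D_angle_def using Lpt_half_eq_iff by metis
qed

lemma continuous_D_angle: "continuous_map (subtopology F_surface D_curve) euclidean D_angle"
proof (rule continuous_map_induced)
  show "compact_space (top_of_set {0..6::real})" by (simp add: compact_space_subtopology)
  show "Hausdorff_space (subtopology F_surface D_curve)" using Hausdorff_F by (rule Hausdorff_space_subtopology)
  have "continuous_map (top_of_set {0..6}) F_surface (\<lambda>\<theta>. (\<lambda>(\<theta>, w). Lpt \<theta> w) (\<theta>, 1/2))"
    by (rule continuous_map_compose_on[OF continuous_Lpt]) (auto intro!: continuous_intros)
  then show "continuous_map (top_of_set {0..6}) (subtopology F_surface D_curve) (\<lambda>\<theta>. Lpt \<theta> (1/2))"
    using D_curve_Lpt by (auto simp: continuous_map_in_subtopology)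
  show "(\<lambda>\<theta>. Lpt \<theta> (1/2)) ` topspace (top_of_set {0..6}) = topspace (subtopology F_surface D_curve)"
  proof
    show "(\<lambda>\<theta>. Lpt \<theta> (1/2)) ` topspace (top_of_set {0..6}) \<subseteq> topspace (subtopology F_surface D_curve)"
      using D_curve_Lpt Lpt_in_F by auto
    show "topspace (subtopology F_surface D_curve) \<subseteq> (\<lambda>\<theta>. Lpt \<theta> (1/2)) ` topspace (top_of_set {0..6})"
    proof
      fix x assume "x \<in> topspace (subtopology F_surface D_curve)"
      then obtain \<theta> where \<theta>: "x = Lpt \<theta> (1/2)" using D_curve_Lpt by auto
      define k where "k = \<lfloor>\<theta> / 6\<rfloor>"
      have "of_int k \<le> \<theta> / 6" "\<theta> / 6 \<le> of_int k + 1" unfolding k_def by linarith+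
      then have "\<theta> + 6 * of_int (- k) \<in> {0..6}" by auto
      moreover have "x = Lpt (\<theta> + 6 * of_int (- k)) (1/2)"
        unfolding \<theta> by (rule Lpt_period[symmetric]) simp
      ultimately show "x \<in> (\<lambda>\<theta>. Lpt \<theta> (1/2)) ` topspace (top_of_set {0..6})" by auto
    qed
  qed
  show "continuous_map (top_of_set {0..6}) euclidean (\<lambda>\<theta>. D_angle (Lpt \<theta> (1/2)))"
    unfolding D_angle_Lpt continuous_map_iff_continuous by (intro continuous_intros)
qed

text \<open>The lift \<open>\<psi>\<close> of \<open>\<delta>\<close> to the line exists because the line is contractible.  Equivariance gives
  \<open>\<psi> (x + 1) = \<psi> x + 1 + 6m\<close> with \<open>m\<close> constant, so \<open>\<psi>\<close> gains \<open>6 (1 + 6m)\<close> over a full period.  If \<open>m\<close> were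
  not 0, then \<open>\<psi>\<close> would pass through \<open>\<psi> 0 \<plusminus> 6\<close> within the period, against the injectivity of \<open>\<delta>\<close>.  In
  particular every admissible parametrization induces the orientation of \<open>D\<close> in which \<open>\<theta>\<close> increases.\<close>

lemma D_param_lift:
  assumes "D_param \<delta>"
  obtains \<psi> :: "real \<Rightarrow> real" where "continuous_on UNIV \<psi>" "strict_mono \<psi>" "\<And>x. \<psi> (x + 1) = \<psi> x + 1"
    "\<And>x. \<delta> (cis (pi / 3 * x)) = Lpt (\<psi> x) (1/2)"
proof -
  have hom: "homeomorphic_map (top_of_set (sphere 0 1)) (subtopology F_surface D_curve) \<delta>"
    and eq: "\<And>z. z \<in> sphere 0 1 \<Longrightarrow> rho (\<delta> z) = \<delta> (cis (pi / 3) * z)"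
    using assms unfolding D_param_def by blast+
  have cs: "cis x \<in> sphere 0 1" for x by simp
  have \<delta>D: "\<delta> (cis x) \<in> D_curve" for x
    using continuous_map_image_subset_topspace[OF homeomorphic_imp_continuous_map[OF hom]] by auto
  have \<delta>inj: "\<delta> (cis x) = \<delta> (cis y) \<Longrightarrow> cis x = cis y" for x y
    using homeomorphic_imp_injective_map[OF hom] cs by (simp add: inj_on_def)
  define f where "f x = D_angle (\<delta> (cis (pi / 3 * x)))" for x
  have "continuous_map euclidean (subtopology F_surface D_curve) (\<lambda>x::real. \<delta> (cis (pi / 3 * x)))"
    using continuous_map_compose_on[OF homeomorphic_imp_continuous_map[OF hom], of UNIV "\<lambda>x. cis (pi / 3 * x)"]
    by (simp add: continuous_intros image_subset_iff)
  from continuous_map_compose[OF this continuous_D_angle]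
  have "continuous_on UNIV f" by (simp add: o_def f_def[abs_def])
  moreover have f1: "cmod (f x) = 1" for x by (simp add: f_def D_angle_def)
  then have "f x \<noteq> 0" for x using norm_zero by (metis zero_neq_one)
  ultimately obtain g where g: "continuous_on UNIV g" "\<And>x. f x = exp (g x)"
    using continuous_logarithm_on_contractible[of UNIV f] contractible_UNIV by (metis UNIV_I)
  define \<psi> where "\<psi> x = 3 / pi * Im (g x)" for x
  have \<psi>c: "continuous_on UNIV \<psi>" unfolding \<psi>_def using g(1) by (intro continuous_intros) auto
  have fcis: "f x = cis (pi / 3 * \<psi> x)" for x
  proof -
    have "exp (Re (g x)) = 1" using f1[of x] unfolding g(2) by simp
    then show ?thesis unfolding g(2) by (simp add: exp_eq_polar \<psi>_def)
  qed
  have \<delta>\<psi>: "\<delta> (cis (pi / 3 * x)) = Lpt (\<psi> x) (1/2)" for x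
  proof -
    obtain \<theta> where \<theta>: "\<delta> (cis (pi / 3 * x)) = Lpt \<theta> (1/2)" using \<delta>D D_curve_Lpt by blast
    then have "cis (pi / 3 * \<theta>) = cis (pi / 3 * \<psi> x)" using fcis[of x] by (simp add: f_def D_angle_Lpt)
    then show ?thesis using \<theta> Lpt_half_eq_iff by simp
  qed
  have inj: "\<exists>k::int. x = y + 6 * of_int k" if "\<psi> x = \<psi> y + 6 * of_int i" for x y i
  proof -
    have "cis (pi / 3 * \<psi> x) = cis (pi / 3 * \<psi> y)" using that cis_third_eq_iff by blast
    then have "\<delta> (cis (pi / 3 * x)) = \<delta> (cis (pi / 3 * y))" using \<delta>\<psi> Lpt_half_eq_iff by simp
    then show ?thesis using \<delta>inj cis_third_eq_iff by blast
  qed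
  define d where "d x = (\<psi> (x + 1) - \<psi> x - 1) / 6" for x
  have dint: "\<exists>k::int. d x = of_int k" for x
  proof -
    have "pi / 3 * (x + 1) = pi / 3 + pi / 3 * x" by (simp add: field_simps)
    then have "cis (pi / 3 * (x + 1)) = cis (pi / 3) * cis (pi / 3 * x)" by (simp only: cis_mult)
    then have "\<delta> (cis (pi / 3 * (x + 1))) = rho (\<delta> (cis (pi / 3 * x)))" using eq[OF cs] by simp
    then have "Lpt (\<psi> (x + 1)) (1/2) = Lpt (\<psi> x + 1) (1/2)" using \<delta>\<psi> rho_Lpt[of "1/2"] by simp
    then obtain k :: int where "\<psi> (x + 1) = \<psi> x + 1 + 6 * of_int k"
      using Lpt_half_eq_iff cis_third_eq_iff by blast
    then show ?thesis by (intro exI[of _ k]) (simp add: d_def)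
  qed
  have "continuous_on UNIV (\<lambda>x. \<psi> (x + 1))"
    by (rule continuous_on_compose2[OF \<psi>c]) (auto intro!: continuous_intros)
  then have dc: "continuous_on UNIV d" unfolding d_def using \<psi>c by (intro continuous_intros) auto
  have "d constant_on UNIV"
  proof (rule continuous_discrete_range_constant[OF connected_UNIV dc])
    fix x
    have "1 \<le> norm (d y - d x)" if "d y \<noteq> d x" for y
    proof -
      obtain k l :: int where "d x = of_int k" "d y = of_int l" using dint by metis
      then show ?thesis using that by (simp flip: of_int_diff of_int_abs)
    qed
    then show "\<exists>e>0. \<forall>y. y \<in> UNIV \<and> d y \<noteq> d x \<longrightarrow> e \<le> norm (d y - d x)" by (intro exI[of _ 1]) auto
  qed
  then obtain m :: int where m: "d x = of_int m" for x
    using dint unfolding constant_on_def by (metis UNIV_I)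
  have shift: "\<psi> (x + 1) = \<psi> x + 1 + 6 * of_int m" for x using m[of x] by (simp add: d_def field_simps)
  have shiftn: "\<psi> (x + of_nat n) = \<psi> x + of_nat n * (1 + 6 * of_int m)" for x n
  proof (induction n)
    case (Suc n)
    have "\<psi> (x + of_nat (Suc n)) = \<psi> ((x + of_nat n) + 1)" by (simp add: algebra_simps)
    then show ?case using shift[of "x + of_nat n"] Suc by (simp add: algebra_simps)
  qed simp
  have \<psi>6: "\<psi> 6 = \<psi> 0 + 6 * (1 + 6 * of_int m)" using shiftn[of 0 6] by simp
  \<comment> \<open>This excludes orientation reversal as well: the gain \<open>-6\<close> is not of the form \<open>6 (1 + 6m)\<close>.\<close>
  have m0: "m = 0"
  proof (rule ccontr)
    assume "m \<noteq> 0"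
    then consider "1 \<le> m" | "m \<le> -1" by linarith
    then have "\<exists>x\<in>{0<..<6}. \<exists>i::int. \<psi> x = \<psi> 0 + 6 * of_int i"
    proof cases
      case 1
      then have 2: "\<psi> 0 + 6 < \<psi> 6" using \<psi>6 by simp
      have "\<exists>x\<ge>0. x \<le> 6 \<and> \<psi> x = \<psi> 0 + 6"
        by (rule IVT') (use 2 in \<open>auto intro: continuous_on_subset[OF \<psi>c]\<close>)
      then obtain x where x: "0 \<le> x" "x \<le> 6" "\<psi> x = \<psi> 0 + 6" by blast
      moreover have "x \<noteq> 0" "x \<noteq> 6" using x(3) 2 by auto
      ultimately show ?thesis by (intro bexI[of _ x] exI[of _ 1]) auto
    next
      case 2
      then have 3: "\<psi> 6 < \<psi> 0 - 6" using \<psi>6 by simp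
      have "\<exists>x\<ge>0. x \<le> 6 \<and> \<psi> x = \<psi> 0 - 6"
        by (rule IVT2') (use 3 in \<open>auto intro: continuous_on_subset[OF \<psi>c]\<close>)
      then obtain x where x: "0 \<le> x" "x \<le> 6" "\<psi> x = \<psi> 0 - 6" by blast
      moreover have "x \<noteq> 0" "x \<noteq> 6" using x(3) 3 by auto
      ultimately show ?thesis by (intro bexI[of _ x] exI[of _ "-1"]) auto
    qed
    then obtain x k where "x \<in> {0<..<6}" "x = 6 * real_of_int k" using inj by force
    then have "0 < k" "k < 1" by auto
    then show False by simp
  qed
  have inj\<psi>: "inj \<psi>"
  proof (rule injI)
    fix x y assume "\<psi> x = \<psi> y"
    then obtain k :: int where k: "x = y + 6 * of_int k" using inj[of x y 0] by auto
    have "\<psi> (y + of_nat n) \<noteq> \<psi> y" if "n > 0" for y n using shiftn[of y n] that m0 by simp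
    note * = this
    show "x = y"
    proof (rule ccontr)
      assume "x \<noteq> y"
      then consider "0 < k" | "k < 0" using k by force
      then show False
      proof cases
        case 1
        then have "x = y + of_nat (nat (6 * k))" using k by simp
        then show False using *[of "nat (6 * k)" y] 1 \<open>\<psi> x = \<psi> y\<close> by simp
      next
        case 2
        then have "y = x + of_nat (nat (- 6 * k))" using k by simp
        then show False using *[of "nat (- 6 * k)" x] 2 \<open>\<psi> x = \<psi> y\<close> by simp
      qed
    qed
  qed
  have "strict_mono \<psi>"
  proof (rule strict_monoI)
    fix x y :: real assume xy: "x < y"
    obtain n :: nat where n: "y - x < of_nat n" using reals_Archimedean2 by blast
    then have "\<psi> x < \<psi> (x + of_nat n)" using shiftn[of x n] m0 xy by simp
    moreover have "(\<psi> x < \<psi> y \<and> \<psi> y < \<psi> (x + of_nat n)) \<or> (\<psi> (x + of_nat n) < \<psi> y \<and> \<psi> y < \<psi> x)"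
      using xy n by (intro continuous_inj_imp_mono continuous_on_subset[OF \<psi>c] inj_on_subset[OF inj\<psi>]) auto
    ultimately show "\<psi> x < \<psi> y" by linarith
  qed
  then show thesis using that[OF \<psi>c _ _ \<delta>\<psi>] shift m0 by simp
qed

section \<open>Powers of the Dehn twist as twists along a tube\<close>

text \<open>The lift of the path along \<open>\<alpha>\<close>.  The second half of \<open>\<alpha>\<close> leads from \<open>\<rho> x\<close> back to \<open>x\<close>; lifting the vertical
  first half to an increase of \<open>t\<close> at constant \<open>\<theta>\<close>, the return lowers \<open>\<theta>\<close> by 1 in the end.\<close>

lemma dehn_twist_path:
  fixes \<psi> :: "real \<Rightarrow> real"
  assumes c: "continuous_on UNIV \<psi>" and mono: "strict_mono \<psi>" and sh: "\<And>x. \<psi> (x + 1) = \<psi> x + 1"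
  shows "bij \<psi>"
    and "twist_path 1 (\<lambda>r \<theta>. \<psi> (inv \<psi> \<theta> + min 1 (2 - 2 * r)) - 1) (\<lambda>r. min 1 (2 * r))"
proof -
  have nsh: "\<psi> (x + of_nat n) = \<psi> x + of_nat n" for x n
  proof (induction n)
    case (Suc n)
    then show ?case using sh[of "x + of_nat n"] by (simp add: algebra_simps)
  qed simp
  have "\<exists>x. \<psi> x = y" for y
  proof -
    obtain n :: nat where n: "\<bar>y - \<psi> 0\<bar> < of_nat n" using reals_Archimedean2 by blast
    have "\<psi> (of_nat n) = \<psi> 0 + of_nat n" "\<psi> 0 = \<psi> (- of_nat n) + of_nat n"
      using nsh[of 0 n] nsh[of "- of_nat n" n] by simp_all
    then have "\<exists>x\<ge>- of_nat n. x \<le> of_nat n \<and> \<psi> x = y"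
      using n by (intro IVT' continuous_on_subset[OF c]) auto
    then show ?thesis by blast
  qed
  then have "surj \<psi>" by (metis surjI)
  then show bij: "bij \<psi>" using strict_mono_imp_inj_on[OF mono] by (simp add: bij_def)
  let ?\<phi> = "inv \<psi>"
  have \<psi>\<phi>: "\<psi> (?\<phi> y) = y" for y using bij by (meson bij_inv_eq_iff)
  have \<phi>less: "?\<phi> x < ?\<phi> y \<longleftrightarrow> x < y" for x y
    using strict_mono_less[OF mono, of "?\<phi> x" "?\<phi> y"] \<psi>\<phi> by simp
  have \<phi>1: "?\<phi> (\<theta> + 1) = ?\<phi> \<theta> + 1" for \<theta>
    using bij sh[of "?\<phi> \<theta>"] \<psi>\<phi> by (metis bij_inv_eq_iff)
  have "continuous_on UNIV ?\<phi>"
  proof (rule continuous_onI_mono)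
    show "open (range ?\<phi>)" using bij by (simp add: bij_is_surj bij_imp_bij_inv)
    show "?\<phi> x \<le> ?\<phi> y" if "x \<le> y" for x y using that \<phi>less by (meson not_le)
  qed
  then have "continuous_on ({0..1} \<times> UNIV) (\<lambda>p :: real \<times> real. ?\<phi> (snd p))"
    by (rule continuous_on_compose2) (auto intro!: continuous_intros)
  then have "continuous_on ({0..1} \<times> UNIV) (\<lambda>p. ?\<phi> (snd p) + min 1 (2 - 2 * fst p))"
    by (intro continuous_intros)
  then have "continuous_on ({0..1} \<times> UNIV) (\<lambda>p. \<psi> (?\<phi> (snd p) + min 1 (2 - 2 * fst p)))"
    by (rule continuous_on_compose2[OF c]) auto
  then have "continuous_on ({0..1} \<times> UNIV) (\<lambda>(r, \<theta>). \<psi> (?\<phi> \<theta> + min 1 (2 - 2 * r)) - 1)"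
    unfolding case_prod_unfold by (intro continuous_intros)
  moreover have "continuous_on {0..1} (\<lambda>r::real. min 1 (2 * r))" by (intro continuous_intros)
  moreover have "strict_mono (\<lambda>\<theta>. \<psi> (?\<phi> \<theta> + min 1 (2 - 2 * r)) - 1)" for r
    using \<phi>less strict_mono_less[OF mono] by (simp add: strict_mono_def)
  moreover have "\<psi> (?\<phi> (\<theta> + 1) + a) - 1 = \<psi> (?\<phi> \<theta> + a) - 1 + 1" for \<theta> a
  proof -
    have "?\<phi> (\<theta> + 1) + a = (?\<phi> \<theta> + a) + 1" by (simp add: \<phi>1)
    then show ?thesis by (simp only: sh)
  qed
  moreover have "\<psi> (?\<phi> \<theta> + 1) - 1 = \<theta>" for \<theta> using sh \<psi>\<phi> by simp
  ultimately show "twist_path 1 (\<lambda>r \<theta>. \<psi> (?\<phi> \<theta> + min 1 (2 - 2 * r)) - 1) (\<lambda>r. min 1 (2 * r))"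
    unfolding twist_path_def using \<psi>\<phi> by simp
qed

lemma alpha_Npt:
  assumes \<psi>: "bij \<psi>" "\<And>x. \<psi> (x + 1) = \<psi> x + 1" "\<And>x. \<delta> (cis (pi / 3 * x)) = Lpt (\<psi> x) (1/2)"
    and t: "t \<in> {0..1}" and r: "r \<in> {0..1}"
  shows "alpha \<delta> (cis (pi / 3 * inv \<psi> \<theta>)) t r =
    Npt (\<psi> (inv \<psi> \<theta> + min 1 (2 - 2 * r)) - 1) (1/2) (t + min 1 (2 * r))"
proof -
  let ?x = "inv \<psi> \<theta>"
  have \<psi>\<phi>: "\<psi> ?x = \<theta>" using \<psi>(1) by (meson bij_inv_eq_iff)
  have h: "(1/2::real) \<in> {0..1}" by simp
  have d: "\<delta> (cis (pi / 3 * ?x)) = Lpt \<theta> (1/2)" using \<psi>(3)[of ?x] \<psi>\<phi> by simp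
  show ?thesis
  proof (cases "r \<le> 1/2")
    case True
    then have m: "min 1 (2 - 2 * r) = 1" "min 1 (2 * r) = 2 * r" by auto
    have B: "\<psi> (?x + 1) - 1 = \<theta>" using \<psi>(2) \<psi>\<phi> by simp
    have "alpha \<delta> (cis (pi / 3 * ?x)) t r = Npt \<theta> (1/2) (t + 2 * r)"
    proof (cases "t + 2 * r \<le> 1")
      case 1: True
      then show ?thesis using True d Npt_slab[of 0 "t + 2 * r" "1/2" \<theta>] t r by (simp add: alpha_def)
    next
      case False
      then show ?thesis using True d Npt_slab[of 1 "t + 2 * r" "1/2" \<theta>] t r rho_Lpt[OF h, of \<theta>]
        by (simp add: alpha_def)
    qed
    then show ?thesis unfolding m B .
  next
    case False
    then have m: "min 1 (2 - 2 * r) = 2 - 2 * r" "min 1 (2 * r) = 1" by auto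
    have "pi / 3 * (?x + (2 - 2 * r)) = pi / 3 * (2 - 2 * r) + pi / 3 * ?x" by (simp add: field_simps)
    then have "cis (pi / 3 * (2 - 2 * r)) * cis (pi / 3 * ?x) = cis (pi / 3 * (?x + (2 - 2 * r)))"
      by (simp only: cis_mult)
    then have "alpha \<delta> (cis (pi / 3 * ?x)) t r = Mpt (Lpt (\<psi> (?x + (2 - 2 * r))) (1/2)) t"
      using False \<psi>(3) by (simp add: alpha_def)
    also have "\<dots> = Npt (\<psi> (?x + (2 - 2 * r))) (1/2) t"
      using Npt_slab[of 0 t "1/2"] t by simp
    also have "\<dots> = Npt (\<psi> (?x + (2 - 2 * r)) - 1) (1/2) (t + 1)"
      using Npt_shift[of "\<psi> (?x + (2 - 2 * r)) - 1" "1/2" t 1] by simp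
    finally show ?thesis unfolding m .
  qed
qed

lemma dehn_twist_twist_along:
  assumes "dehn_twist h"
  obtains \<kappa> B q where "T_collar \<kappa>" "twist_path 1 B q"
    "\<And>m. m \<in> topspace M_space \<Longrightarrow> h m = twist_along (collar_tube \<kappa>) B q m"
proof -
  obtain \<delta> \<kappa> where \<delta>: "D_param \<delta>" and \<kappa>: "T_collar \<kappa>"
    and h1: "\<And>z t r. z \<in> sphere 0 1 \<Longrightarrow> t \<in> {0..1} \<Longrightarrow> r \<in> {0..1} \<Longrightarrow> h (\<kappa> (Mpt (\<delta> z) t, r)) = \<kappa> (alpha \<delta> z t r, r)"
    and h2: "\<And>m. m \<in> topspace M_space - \<kappa> ` (T_torus \<times> {0..1}) \<Longrightarrow> h m = m"
    using assms unfolding dehn_twist_def by (elim exE conjE) simp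
  obtain \<psi> :: "real \<Rightarrow> real" where \<psi>: "continuous_on UNIV \<psi>" "strict_mono \<psi>" "\<And>x. \<psi> (x + 1) = \<psi> x + 1"
    "\<And>x. \<delta> (cis (pi / 3 * x)) = Lpt (\<psi> x) (1/2)"
    using D_param_lift[OF \<delta>] by metis
  let ?B = "\<lambda>r \<theta>. \<psi> (inv \<psi> \<theta> + min 1 (2 - 2 * r)) - 1" and ?q = "\<lambda>r::real. min 1 (2 * r)"
  have bij: "bij \<psi>" and P: "twist_path 1 ?B ?q" using dehn_twist_path[OF \<psi>(1-3)] by blast+
  have K: "tube M_space (collar_tube \<kappa>)" by (rule tube_collar[OF \<kappa>])
  have "h m = twist_along (collar_tube \<kappa>) ?B ?q m" if m: "m \<in> topspace M_space" for m
  proof (cases "m \<in> collar_tube \<kappa> ` (layers {0..1})")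
    case True
    then obtain \<theta>' t' r where r: "r \<in> {0..1}" and m: "m = collar_tube \<kappa> (\<theta>', t', r)" by auto
    obtain \<theta> t where t: "t \<in> {0..1}" and lat: "lattice_equiv \<theta>' t' \<theta> t" by (rule lattice_equiv_box)
    have m': "m = collar_tube \<kappa> (\<theta>, t, r)" unfolding m by (rule tube_lattice[OF K r lat])
    let ?z = "cis (pi / 3 * inv \<psi> \<theta>)"
    have "\<psi> (inv \<psi> \<theta>) = \<theta>" using bij by (meson bij_inv_eq_iff)
    then have "Mpt (\<delta> ?z) t = Npt \<theta> (1/2) t"
      using \<psi>(4)[of "inv \<psi> \<theta>"] Npt_slab[of 0 t "1/2" \<theta>] t by simp
    then have "m = \<kappa> (Mpt (\<delta> ?z) t, r)" unfolding m' by (simp add: collar_tube_def)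
    then have "h m = \<kappa> (alpha \<delta> ?z t r, r)" using h1[of ?z t r] t r by simp
    also have "\<dots> = collar_tube \<kappa> (?B r \<theta>, t + ?q r, r)"
      unfolding alpha_Npt[OF bij \<psi>(3,4) t r] by (simp add: collar_tube_def)
    also have "\<dots> = twist_along (collar_tube \<kappa>) ?B ?q m"
      unfolding m' by (rule twist_along_tube[OF K P r, symmetric])
    finally show ?thesis .
  next
    case False
    then have "h m = m" using m h2 unfolding collar_tube_image by blast
    then show ?thesis using False by (simp add: twist_along_def)
  qed
  with that[OF \<kappa> P] show thesis .
qed

lemma twist_along_compose:
  assumes K: "tube M K" and P: "twist_path n B q" and P': "twist_path n' B' q'"
  shows "twist_along K B q (twist_along K B' q' m) = twist_along K (\<lambda>r \<theta>. B r (B' r \<theta>)) (\<lambda>r. q r + q' r) m"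
proof (cases "m \<in> K ` (layers {0..1})")
  case True
  then obtain \<theta> t r where r: "r \<in> {0..1}" and m: "m = K (\<theta>, t, r)" by auto
  show ?thesis
    unfolding m twist_along_tube[OF K P' r] twist_along_tube[OF K P r]
      twist_along_tube[OF K twist_path_compose[OF P P'] r] by (simp add: ac_simps)
qed (simp add: twist_along_def)

text \<open>Twist paths compose levelwise and their degrees add.\<close>

lemma twist_along_iterate:
  assumes K: "tube M K" and P: "twist_path 1 B q"
  shows "\<exists>B' q'. twist_path (int n) B' q' \<and> (\<forall>m. (twist_along K B q ^^ n) m = twist_along K B' q' m)"
proof (induction n)
  case 0
  have id: "twist_path 0 (\<lambda>r \<theta>. \<theta>) (\<lambda>r. 0)"
    by (auto simp: twist_path_def strict_mono_def case_prod_unfold intro!: continuous_intros)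
  have "twist_along K (\<lambda>r \<theta>. \<theta>) (\<lambda>r. 0) m = m" for m
  proof (cases "m \<in> K ` (layers {0..1})")
    case True
    then obtain \<theta> t r where "r \<in> {0..1}" "m = K (\<theta>, t, r)" by auto
    then show ?thesis using twist_along_tube[OF K id, of r \<theta> t] by simp
  qed (simp add: twist_along_def)
  with id show ?case by (intro exI[of _ "\<lambda>r \<theta>. \<theta>"] exI[of _ "\<lambda>r. 0"]) simp
next
  case (Suc n)
  then obtain B' q' where P': "twist_path (int n) B' q'" and eq: "\<And>m. (twist_along K B q ^^ n) m = twist_along K B' q' m"
    by blast
  have "twist_path (int (Suc n)) (\<lambda>r \<theta>. B r (B' r \<theta>)) (\<lambda>r. q r + q' r)"
    using twist_path_compose[OF P P'] by simp
  moreover have "(twist_along K B q ^^ Suc n) m = twist_along K (\<lambda>r \<theta>. B r (B' r \<theta>)) (\<lambda>r. q r + q' r) m" for m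
    using eq twist_along_compose[OF K P P'] by simp
  ultimately show ?case by blast
qed

lemma dehn_twist_power:
  assumes "dehn_twist h"
  obtains \<kappa> B q where "T_collar \<kappa>" "twist_path (int n) B q"
    "\<And>m. m \<in> topspace M_space \<Longrightarrow> (h ^^ n) m = twist_along (collar_tube \<kappa>) B q m"
proof -
  obtain \<kappa> B q where \<kappa>: "T_collar \<kappa>" and P: "twist_path 1 B q"
    and h: "\<And>m. m \<in> topspace M_space \<Longrightarrow> h m = twist_along (collar_tube \<kappa>) B q m"
    using dehn_twist_twist_along[OF assms] by metis
  let ?h = "twist_along (collar_tube \<kappa>) B q"
  have K: "tube M_space (collar_tube \<kappa>)" by (rule tube_collar[OF \<kappa>])
  have inM: "?h m \<in> topspace M_space" if "m \<in> topspace M_space" for m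
    using twist_along_bij[OF K P] that by (meson bij_betwE)
  have "(h ^^ n) m = (?h ^^ n) m \<and> (h ^^ n) m \<in> topspace M_space" if "m \<in> topspace M_space" for m n
  proof (induction n)
    case (Suc n)
    then have e: "(h ^^ n) m = (?h ^^ n) m" and M: "(h ^^ n) m \<in> topspace M_space" by auto
    have "(h ^^ Suc n) m = ?h ((h ^^ n) m)" using h[OF M] by simp
    then show ?case using e inM[OF M] by simp
  qed (use that in simp)
  then show thesis using twist_along_iterate[OF K P, of n] that[OF \<kappa>] by metis
qed

section \<open>Undoing the vertical displacement\<close>

text \<open>The vertical flow for the time \<open>u (1 - w)\<close>, which vanishes on the outermost level.\<close>

definition vertical_shear :: "real \<Rightarrow> ((real \<times> real) set \<times> real) set \<Rightarrow> ((real \<times> real) set \<times> real) set" where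
  "vertical_shear u m = (SOME y. \<exists>\<theta> w t. w \<in> {0..1} \<and> m = Npt \<theta> w t \<and> y = Npt \<theta> w (t + u * (1 - w)))"

lemma vertical_shear_Npt:
  assumes w: "w \<in> {0..1}"
  shows "vertical_shear u (Npt \<theta> w t) = Npt \<theta> w (t + u * (1 - w))"
  unfolding vertical_shear_def
proof (rule some_equality)
  show "\<exists>\<theta>' w' t'. w' \<in> {0..1} \<and> Npt \<theta> w t = Npt \<theta>' w' t' \<and> Npt \<theta> w (t + u * (1 - w)) = Npt \<theta>' w' (t' + u * (1 - w'))"
    using w by blast
  fix y assume "\<exists>\<theta>' w' t'. w' \<in> {0..1} \<and> Npt \<theta> w t = Npt \<theta>' w' t' \<and> y = Npt \<theta>' w' (t' + u * (1 - w'))"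
  then obtain \<theta>' w' t' where w': "w' \<in> {0..1}" and eq: "Npt \<theta> w t = Npt \<theta>' w' t'"
    and y: "y = Npt \<theta>' w' (t' + u * (1 - w'))" by blast
  have "w' = w" using Npt_eq_imp[OF w w' eq] by blast
  then show "y = Npt \<theta> w (t + u * (1 - w))" using Npt_flow[OF w w' eq, of "u * (1 - w)"] y by simp
qed

lemma vertical_shear_isotopic:
  assumes A: "A \<subseteq> topspace M_space"
  shows "isotopic_in M_space A (vertical_shear u ` A)"
proof -
  let ?I = "top_of_set {0..1::real}"
  have inv: "vertical_shear (- v) (vertical_shear v m) = m" "vertical_shear v m \<in> topspace M_space" if m: "m \<in> topspace M_space" for v m
  proof -
    obtain \<theta> w t where w: "w \<in> {0..1}" "m = Npt \<theta> w t" using Npt_surj[OF m] by metis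
    then show "vertical_shear (- v) (vertical_shear v m) = m" "vertical_shear v m \<in> topspace M_space"
      by (simp_all add: vertical_shear_Npt Npt_in_M)
  qed
  have bij: "bij_betw (vertical_shear (s * u)) (topspace M_space) (topspace M_space)" for s
    by (rule bij_betw_byWitness[where f' = "vertical_shear (- (s * u))"])
      (use inv(1)[of _ "s * u"] inv(1)[of _ "- (s * u)"] inv(2) in auto)
  have cont: "continuous_map (prod_topology ?I M_space) M_space (\<lambda>(s, m). vertical_shear (s * u) m)"
  proof (rule continuous_map_induced)
    let ?Z = "{0..1::real} \<times> {0..6::real} \<times> {0..1::real} \<times> {0..1::real}"
    let ?k = "\<lambda>(s, \<theta>, w, t). (s, Npt \<theta> w t)"
    show "compact_space (top_of_set ?Z)"
      by (simp add: compact_space_subtopology compact_Times)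
    show "Hausdorff_space (prod_topology ?I M_space)"
      using Hausdorff_M by (simp add: Hausdorff_space_subtopology Hausdorff_space_prod_topology)
    have 1: "continuous_map (top_of_set ?Z) ?I fst"
      by (simp add: continuous_map_in_subtopology continuous_on_fst Pi_iff)
    have "continuous_map (top_of_set ?Z) M_space (\<lambda>z. (\<lambda>(\<theta>, w, t). Npt \<theta> w t) (snd z))"
      by (rule continuous_map_compose_on[OF continuous_Npt]) (auto intro!: continuous_intros)
    from continuous_map_pairedI[OF 1 this]
    show "continuous_map (top_of_set ?Z) (prod_topology ?I M_space) ?k"
      by (simp add: case_prod_unfold)
    show "?k ` topspace (top_of_set ?Z) = topspace (prod_topology ?I M_space)"
    proof
      show "?k ` topspace (top_of_set ?Z) \<subseteq> topspace (prod_topology ?I M_space)" using Npt_in_M by auto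
      show "topspace (prod_topology ?I M_space) \<subseteq> ?k ` topspace (top_of_set ?Z)"
      proof clarify
        fix s m assume "(s, m) \<in> topspace (prod_topology ?I M_space)"
        then have s: "s \<in> {0..1}" and m: "m \<in> topspace M_space" by auto
        obtain \<theta> w t where "\<theta> \<in> {0..6}" "w \<in> {0..1}" "t \<in> {0..1}" "m = Npt \<theta> w t" using Npt_surj[OF m] .
        then show "(s, m) \<in> ?k ` topspace (top_of_set ?Z)"
          using s by (intro image_eqI[of _ _ "(s, \<theta>, w, t)"]) auto
      qed
    qed
    have "continuous_map (top_of_set ?Z) M_space
        (\<lambda>z. (\<lambda>(\<theta>, w, t). Npt \<theta> w t) ((\<lambda>(s, \<theta>, w, t). (\<theta>, w, t + s * u * (1 - w))) z))"
      by (rule continuous_map_compose_on[OF continuous_Npt])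
        (auto simp: case_prod_unfold intro!: continuous_intros)
    then show "continuous_map (top_of_set ?Z) M_space (\<lambda>z. (\<lambda>(s, m). vertical_shear (s * u) m) (?k z))"
      by (rule continuous_map_eq) (auto simp: vertical_shear_Npt)
  qed
  have "vertical_shear 0 m = m" if m: "m \<in> topspace M_space" for m
  proof -
    obtain \<theta> w t where "w \<in> {0..1}" "m = Npt \<theta> w t" using Npt_surj[OF m] by metis
    then show ?thesis by (simp add: vertical_shear_Npt)
  qed
  then have "vertical_shear (0 * u) ` A = A" using A by (force simp: subset_iff)
  with isotopic_in_family[OF compact_M Hausdorff_M cont bij A] show ?thesis by simp
qed

section \<open>The resulting curve in a fibre\<close>

text \<open>The shear preserves vertical lines, so \<open>V\<^sub>0\<close> has the same description in both coordinate systems.  Each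
  sheared arc is made of two halves of the original arcs.\<close>

lemma Lpt_V0: "{Fpt \<theta> s | \<theta> s. \<theta> \<in> {1/4, 15/4} \<and> s \<in> {0..1}} = {Lpt \<theta> w | \<theta> w. \<theta> \<in> {1/4, 15/4} \<and> w \<in> {0..1}}"
proof -
  have q1: "Lpt (1/4) w = Fpt (1/4) (w + 1/2)" if "0 \<le> w" "w \<le> 1/2" for w
    using that Lpt_even[of 0 w "1/4"] by simp
  have q2: "Lpt (1/4) w = Fpt (15/4) (3/2 - w)" if "1/2 \<le> w" "w \<le> 1" for w
    using that Lpt_odd[of 0 w "1/4"] by simp
  have q3: "Lpt (15/4) w = Fpt (1/4) (1/2 - w)" if "0 \<le> w" "w \<le> 1/2" for w
    using that Lpt_odd[of 3 w "15/4"] Fpt_annulus[of "1/4" 1 "1/2 - w"] by simp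
  have q4: "Lpt (15/4) w = Fpt (15/4) (w - 1/2)" if "1/2 \<le> w" "w \<le> 1" for w
    using that Lpt_even[of 4 w "15/4"] by simp
  show ?thesis
  proof (intro equalityI subsetI)
    fix x assume "x \<in> {Fpt \<theta> s | \<theta> s. \<theta> \<in> {1/4, 15/4} \<and> s \<in> {0..1}}"
    then obtain \<theta> s where "x = Fpt \<theta> s" "\<theta> = 1/4 \<or> \<theta> = 15/4" and s: "0 \<le> s" "s \<le> 1" by auto
    then have x: "x = Fpt (1/4) s \<or> x = Fpt (15/4) s" by blast
    consider "x = Fpt (1/4) s" "1/2 \<le> s" | "x = Fpt (1/4) s" "s \<le> 1/2"
      | "x = Fpt (15/4) s" "1/2 \<le> s" | "x = Fpt (15/4) s" "s \<le> 1/2" using x linear[of s "1/2"] by blast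
    then have "\<exists>\<theta>' w. \<theta>' \<in> {1/4, 15/4} \<and> w \<in> {0..1} \<and> x = Lpt \<theta>' w"
    proof cases
      case 1
      then show ?thesis using s q1[of "s - 1/2"]
        by (intro exI[of _ "1/4"] exI[of _ "s - 1/2"]) simp
    next
      case 2
      then show ?thesis using s q3[of "1/2 - s"] by (intro exI[of _ "15/4"] exI[of _ "1/2 - s"]) simp
    next
      case 3
      then show ?thesis using s q2[of "3/2 - s"]
        by (intro exI[of _ "1/4"] exI[of _ "3/2 - s"]) simp
    next
      case 4
      then show ?thesis using s q4[of "s + 1/2"]
        by (intro exI[of _ "15/4"] exI[of _ "s + 1/2"]) simp
    qed
    then show "x \<in> {Lpt \<theta> w | \<theta> w. \<theta> \<in> {1/4, 15/4} \<and> w \<in> {0..1}}" by blast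
  next
    fix x assume "x \<in> {Lpt \<theta> w | \<theta> w. \<theta> \<in> {1/4, 15/4} \<and> w \<in> {0..1}}"
    then obtain \<theta> w where "x = Lpt \<theta> w" "\<theta> = 1/4 \<or> \<theta> = 15/4" and w: "0 \<le> w" "w \<le> 1" by auto
    then have x: "x = Lpt (1/4) w \<or> x = Lpt (15/4) w" by blast
    have "x \<in> {Fpt (1/4) (w + 1/2), Fpt (1/4) (1/2 - w)}" if "w \<le> 1/2"
      using x q1[OF w(1) that] q3[OF w(1) that] by auto
    moreover have "x \<in> {Fpt (15/4) (3/2 - w), Fpt (15/4) (w - 1/2)}" if "1/2 \<le> w"
      using x q2[OF that w(2)] q4[OF that w(2)] by auto
    moreover have "w + 1/2 \<in> {0..1} \<and> 1/2 - w \<in> {0..1}" if "w \<le> 1/2" using that w by simp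
    moreover have "3/2 - w \<in> {0..1} \<and> w - 1/2 \<in> {0..1}" if "1/2 \<le> w" using that w by simp
    ultimately have "\<exists>\<theta>' s. \<theta>' \<in> {1/4, 15/4} \<and> s \<in> {0..1} \<and> x = Fpt \<theta>' s"
      using linear[of w "1/2"] by blast
    then show "x \<in> {Fpt \<theta> s | \<theta> s. \<theta> \<in> {1/4, 15/4} \<and> s \<in> {0..1}}" by blast
  qed
qed

lemma V0_Npt: "V0 = (\<lambda>(\<theta>, w). Npt \<theta> w (1/2)) ` ({1/4, 15/4} \<times> {0..1})"
proof -
  have "V0 = (\<lambda>x. Mpt x (1/2)) ` {Fpt \<theta> s | \<theta> s. \<theta> \<in> {1/4, 15/4} \<and> s \<in> {0..1}}"
    unfolding V0_def by blast
  also have "\<dots> = (\<lambda>(\<theta>, w). Mpt (Lpt \<theta> w) (1/2)) ` ({1/4, 15/4} \<times> {0..1})"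
    unfolding Lpt_V0 by force
  also have "\<dots> = (\<lambda>(\<theta>, w). Npt \<theta> w (1/2)) ` ({1/4, 15/4} \<times> {0..1})"
    using Npt_slab[of 0 "1/2"] by (intro image_cong) auto
  finally show ?thesis .
qed

text \<open>The image of a vertical arc under the shear of the fibre that is left of the \<open>n\<close>-fold twist.\<close>

definition twisted_arc :: "nat \<Rightarrow> real \<Rightarrow> real \<Rightarrow> (real \<times> real) set" where
  "twisted_arc n \<theta> w = Lpt (\<theta> - of_nat n * (1 - w)) w"

definition fibre_curve :: "nat \<Rightarrow> (real \<times> real) set set" where
  "fibre_curve n = (\<lambda>(\<theta>, w). twisted_arc n \<theta> w) ` ({1/4, 15/4} \<times> {0..1})"

lemma fibre_curve_in_F: "fibre_curve n \<subseteq> topspace F_surface"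
  unfolding fibre_curve_def twisted_arc_def using Lpt_in_F by auto

text \<open>The twist is replaced by the one with linear path along \<open>std_tube\<close>, whose vertical displacement on the
  level \<open>w\<close> is \<open>n (1 - w)\<close>, and this displacement is then flowed back.\<close>

lemma V0_isotopic_fibre_curve:
  assumes "dehn_twist h"
  shows "isotopic_in M_space ((h ^^ n) ` V0) {Mpt x (1/2) | x. x \<in> fibre_curve n}"
proof -
  obtain \<kappa> B q where \<kappa>: "T_collar \<kappa>" and P: "twist_path (int n) B q"
    and h: "\<And>m. m \<in> topspace M_space \<Longrightarrow> (h ^^ n) m = twist_along (collar_tube \<kappa>) B q m"
    using dehn_twist_power[OF assms, of n] by metis
  have V0: "V0 \<subseteq> topspace M_space" unfolding V0_Npt using Npt_in_M by auto
  let ?B = "\<lambda>r \<theta>. \<theta> - real n * r" and ?q = "\<lambda>r. real n * r"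
  have P': "twist_path (int n) ?B ?q"
    by (auto simp: twist_path_def strict_mono_def case_prod_unfold intro!: continuous_intros)
  let ?A = "twist_along std_tube ?B ?q ` V0"
  have A: "?A = (\<lambda>(\<theta>, w). Npt (\<theta> - real n * (1 - w)) w (1/2 + real n * (1 - w))) ` ({1/4, 15/4} \<times> {0..1})"
    unfolding V0_Npt image_image
  proof (intro image_cong refl)
    fix p :: "real \<times> real" assume "p \<in> {1/4, 15/4} \<times> {0..1}"
    then have "1 - snd p \<in> {0..1}" by auto
    from twist_along_tube[OF tube_std P' this, of "fst p" "1/2"]
    show "twist_along std_tube ?B ?q (case p of (\<theta>, w) \<Rightarrow> Npt \<theta> w (1/2)) =
        (case p of (\<theta>, w) \<Rightarrow> Npt (\<theta> - real n * (1 - w)) w (1/2 + real n * (1 - w)))"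
      by (simp add: std_tube_def case_prod_unfold)
  qed
  have "(h ^^ n) ` V0 = twist_along (collar_tube \<kappa>) B q ` V0"
    using h V0 by (intro image_cong) auto
  then have i1: "isotopic_in M_space ((h ^^ n) ` V0) ?A"
    using twist_along_collar_isotopic_std[OF \<kappa> P P' V0] by simp
  have "?A \<subseteq> topspace M_space" unfolding A using Npt_in_M by auto
  then have i2: "isotopic_in M_space ?A (vertical_shear (- real n) ` ?A)" by (rule vertical_shear_isotopic)
  have e1: "vertical_shear (- real n) ` ?A = (\<lambda>(\<theta>, w). Mpt (twisted_arc n \<theta> w) (1/2)) ` ({1/4, 15/4} \<times> {0..1})"
    unfolding A image_image
  proof (intro image_cong refl)
    fix p :: "real \<times> real" assume "p \<in> {1/4, 15/4} \<times> {0..1}"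
    then have w: "snd p \<in> {0..1}" by auto
    show "vertical_shear (- real n) (case p of (\<theta>, w) \<Rightarrow> Npt (\<theta> - real n * (1 - w)) w (1/2 + real n * (1 - w))) =
        (case p of (\<theta>, w) \<Rightarrow> Mpt (twisted_arc n \<theta> w) (1/2))"
      using w Npt_slab[of 0 "1/2" "snd p"] by (simp add: case_prod_unfold vertical_shear_Npt twisted_arc_def)
  qed
  have e2: "(\<lambda>(\<theta>, w). Mpt (twisted_arc n \<theta> w) (1/2)) ` ({1/4, 15/4} \<times> {0..1}) = {Mpt x (1/2) | x. x \<in> fibre_curve n}"
    unfolding fibre_curve_def by force
  show ?thesis using isotopic_in_trans[OF i1 i2] unfolding e1 e2 .
qed

text \<open>The line on which the curve projects.  The slope is such that \<open>r\<close> is the coordinate \<open>y - 2x\<close>.\<close>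

definition line_pt :: "nat \<Rightarrow> real \<Rightarrow> real \<times> real" where
  "line_pt n r = (1/4 - of_nat n + r * of_nat n, 1/2 - 2 * of_nat n + r * (2 * of_nat n + 1))"

text \<open>The two arcs of the curve as one closed path on \<open>[-1, 1]\<close>, developing to the segment of the line with
  the same parameters.\<close>

definition curve_param :: "nat \<Rightarrow> real \<Rightarrow> (real \<times> real) set" where
  "curve_param n r = (if 0 \<le> r then twisted_arc n (1/4) r else twisted_arc n (15/4) (- r))"

text \<open>A rotation in \<open>\<Gamma>\<close> cannot map the line to itself: its effect on the first coordinate would make 1
  divisible by 4.\<close>

lemma line_pt_orbit: "cls Gamma_rel (line_pt n r) = cls Gamma_rel (line_pt n r') \<longleftrightarrow> (\<exists>k::int. r' = r + 2 * of_int k)"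
proof
  assume "cls Gamma_rel (line_pt n r) = cls Gamma_rel (line_pt n r')"
  then obtain a b :: int where
    "(1/4 - of_nat n + r' * of_nat n = 1/4 - of_nat n + r * of_nat n + 2 * of_int a \<and>
      1/2 - 2 * of_nat n + r' * (2 * of_nat n + 1) = 1/2 - 2 * of_nat n + r * (2 * of_nat n + 1) + 2 * of_int b) \<or>
     (1/4 - of_nat n + r' * of_nat n = 2 * of_int a - (1/4 - of_nat n + r * of_nat n) \<and>
      1/2 - 2 * of_nat n + r' * (2 * of_nat n + 1) = 2 * of_int b - (1/2 - 2 * of_nat n + r * (2 * of_nat n + 1)))"
    using Gamma_orbit unfolding line_pt_def by blast
  then show "\<exists>k::int. r' = r + 2 * of_int k"
  proof
    assume *: "1/4 - of_nat n + r' * of_nat n = 1/4 - of_nat n + r * of_nat n + 2 * of_int a \<and>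
      1/2 - 2 * of_nat n + r' * (2 * of_nat n + 1) = 1/2 - 2 * of_nat n + r * (2 * of_nat n + 1) + 2 * of_int b"
    then have "r' = r + 2 * of_int (b - 2 * a)" by (simp add: algebra_simps)
    then show ?thesis by blast
  next
    assume *: "1/4 - of_nat n + r' * of_nat n = 2 * of_int a - (1/4 - of_nat n + r * of_nat n) \<and>
      1/2 - 2 * of_nat n + r' * (2 * of_nat n + 1) = 2 * of_int b - (1/2 - 2 * of_nat n + r * (2 * of_nat n + 1))"
    then have "r + r' = 2 * of_int (b - 2 * a)" by (simp add: algebra_simps)
    then have "(r + r') * of_nat n = 2 * of_int ((b - 2 * a) * int n)" by simp
    moreover have "1/2 - 2 * of_nat n + (r + r') * of_nat n = 2 * of_int a" using * by (simp add: algebra_simps)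
    ultimately have "1 = real_of_int (4 * a + 4 * int n - 4 * ((b - 2 * a) * int n))" by (simp add: algebra_simps)
    then have "1 = 4 * a + 4 * int n - 4 * ((b - 2 * a) * int n)" by (metis of_int_1 of_int_eq_iff)
    then show ?thesis by presburger
  qed
next
  assume "\<exists>k::int. r' = r + 2 * of_int k"
  then obtain k :: int where k: "r' = r + 2 * of_int k" by blast
  have "line_pt n r' = (fst (line_pt n r) + 2 * of_int (k * int n), snd (line_pt n r) + 2 * of_int (k * (2 * int n + 1)))"
    unfolding line_pt_def k by (simp add: algebra_simps)
  then show "cls Gamma_rel (line_pt n r) = cls Gamma_rel (line_pt n r')"
    using Gamma_translate[of "fst (line_pt n r)" "k * int n" "snd (line_pt n r)" "k * (2 * int n + 1)"] by simp
qed

lemma line_pt_not_lattice: "cls Gamma_rel (line_pt n r) \<notin> cls Gamma_rel ` (\<int> \<times> \<int>)"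
proof
  assume "cls Gamma_rel (line_pt n r) \<in> cls Gamma_rel ` (\<int> \<times> \<int>)"
  then obtain i j :: int where "cls Gamma_rel (of_int i, of_int j) = cls Gamma_rel (line_pt n r)"
    by (auto elim!: Ints_cases)
  then obtain a b :: int where
    "(fst (line_pt n r) = of_int i + 2 * of_int a \<and> snd (line_pt n r) = of_int j + 2 * of_int b) \<or>
     (fst (line_pt n r) = 2 * of_int a - of_int i \<and> snd (line_pt n r) = 2 * of_int b - of_int j)"
    using Gamma_orbit[of "of_int i" "of_int j" "fst (line_pt n r)" "snd (line_pt n r)"] by auto
  then have "(fst (line_pt n r) = of_int (i + 2 * a) \<and> snd (line_pt n r) = of_int (j + 2 * b)) \<or>
     (fst (line_pt n r) = of_int (2 * a - i) \<and> snd (line_pt n r) = of_int (2 * b - j))"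
    by simp
  then have "\<exists>a b::int. fst (line_pt n r) = of_int a \<and> snd (line_pt n r) = of_int b" by blast
  then obtain a b :: int where ab: "1/4 - of_nat n + r * of_nat n = real_of_int a"
      "1/2 - 2 * of_nat n + r * (2 * of_nat n + 1) = real_of_int b"
    by (auto simp: line_pt_def)
  then have "r = of_int (b - 2 * a)" by (simp add: algebra_simps)
  define c where "c = (b - 2 * a) * int n"
  have "r * of_nat n = of_int c" unfolding c_def \<open>r = of_int (b - 2 * a)\<close> by simp
  then have "1 = 4 * real_of_int (a + int n - c)" using ab(1) by simp
  then have "1 = 4 * (a + int n - c)" by linarith
  then show False by presburger
qed

lemma proj_curve_param:
  assumes r: "r \<in> {-1..1}"
  shows "proj (curve_param n r) = cls Gamma_rel (line_pt n r)"
proof (cases "0 \<le> r")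
  case True
  then have w: "r \<in> {0..1}" using r by simp
  have "(1/4 - of_nat n * (1 - r), r + 2 * (1/4 - of_nat n * (1 - r))) = line_pt n r"
    by (simp add: line_pt_def algebra_simps)
  then show ?thesis using True proj_Lpt[OF w] by (simp add: curve_param_def twisted_arc_def)
next
  case False
  then have w: "- r \<in> {0..1}" using r by simp
  let ?x = "15/4 - real n * (1 + r)"
  have "(2 * of_int (2 - int n) - ?x, 2 * of_int (4 - 2 * int n) - (- r + 2 * ?x)) = line_pt n r"
    by (simp add: line_pt_def algebra_simps)
  then have "cls Gamma_rel (?x, - r + 2 * ?x) = cls Gamma_rel (line_pt n r)"
    using Gamma_rotate[of "2 - int n" ?x "4 - 2 * int n" "- r + 2 * ?x"] by simp
  then show ?thesis using False proj_Lpt[OF w, of ?x] by (simp add: curve_param_def twisted_arc_def)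
qed

lemma Lpt_quarter: "Lpt (1/4 - of_nat n) 0 = Lpt (15/4 - of_nat n) 0" "Lpt (1/4) 1 = Lpt (15/4) 1"
proof -
  have "Lpt (1/4) 0 = Fpt (1/4) (1/2)" using Lpt_even[of 0 0 "1/4"] by simp
  moreover have "Lpt (15/4) 0 = Fpt (1/4) (1/2)"
    using Lpt_odd[of 3 0 "15/4"] Fpt_annulus[of "1/4" 1 "1/2"] by simp
  ultimately show "Lpt (1/4 - of_nat n) 0 = Lpt (15/4 - of_nat n) 0"
    using Lpt_shift[of 0 "1/4" "15/4" "- int n"] by simp
  show "Lpt (1/4) 1 = Lpt (15/4) 1"
    using Lpt_odd[of 0 1 "1/4"] Lpt_even[of 4 1 "15/4"] by simp
qed

lemma continuous_curve_param: "continuous_map (top_of_set {-1..1}) F_surface (curve_param n)"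
proof (rule continuous_map_union_closed)
  let ?X = "top_of_set {-1..1::real}"
  show "closedin ?X {-1..0}" "closedin ?X {0..1}" by (auto intro!: closed_subset)
  show "topspace ?X \<subseteq> {-1..0} \<union> {0..1}" by auto
  have "continuous_map (top_of_set {0..1}) F_surface (\<lambda>r. (\<lambda>(\<theta>, w). Lpt \<theta> w) (1/4 - of_nat n * (1 - r), r))"
    by (rule continuous_map_compose_on[OF continuous_Lpt]) (auto intro!: continuous_intros)
  then have "continuous_map (top_of_set {0..1}) F_surface (curve_param n)"
    by (rule continuous_map_eq) (auto simp: curve_param_def twisted_arc_def)
  then show "continuous_map (subtopology ?X {0..1}) F_surface (curve_param n)"
    by (simp add: subtopology_subtopology Int_absorb1)
  have "continuous_map (top_of_set {-1..0}) F_surface (\<lambda>r. (\<lambda>(\<theta>, w). Lpt \<theta> w) (15/4 - of_nat n * (1 - (- r)), - r))"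
    by (rule continuous_map_compose_on[OF continuous_Lpt]) (auto intro!: continuous_intros)
  then have "continuous_map (top_of_set {-1..0}) F_surface (curve_param n)"
  proof (rule continuous_map_eq)
    fix r assume "r \<in> topspace (top_of_set {-1..0::real})"
    then show "(\<lambda>(\<theta>, w). Lpt \<theta> w) (15/4 - of_nat n * (1 - (- r)), - r) = curve_param n r"
      using Lpt_quarter(1)[of n] by (cases "r = 0") (auto simp: curve_param_def twisted_arc_def)
  qed
  then show "continuous_map (subtopology ?X {-1..0}) F_surface (curve_param n)"
    by (simp add: subtopology_subtopology Int_absorb1)
qed

lemma curve_param_eq_iff:
  assumes r: "r \<in> {-1..1}" "r' \<in> {-1..1}"
  shows "curve_param n r = curve_param n r' \<longleftrightarrow> (\<exists>k::int. r' = r + 2 * of_int k)"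
proof
  assume "curve_param n r = curve_param n r'"
  then show "\<exists>k::int. r' = r + 2 * of_int k" using proj_curve_param r line_pt_orbit by metis
next
  assume "\<exists>k::int. r' = r + 2 * of_int k"
  then obtain k :: int where k: "r' = r + 2 * of_int k" by blast
  then have "-1 \<le> real_of_int k" "real_of_int k \<le> 1" using r by auto
  then have "k = 0 \<or> k = 1 \<or> k = -1" by linarith
  then have "r' = r \<or> r = -1 \<and> r' = 1 \<or> r = 1 \<and> r' = -1" using k r by auto
  moreover have "curve_param n 1 = curve_param n (-1)"
    using Lpt_quarter(2) by (simp add: curve_param_def twisted_arc_def)
  ultimately show "curve_param n r = curve_param n r'" by auto
qed

lemma fibre_curve_param: "fibre_curve n = curve_param n ` {-1..1}"
proof (intro equalityI subsetI)
  fix x assume "x \<in> fibre_curve n"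
  then obtain w where w: "w \<in> {0..1}" and x: "x = twisted_arc n (1/4) w \<or> x = twisted_arc n (15/4) w"
    unfolding fibre_curve_def by auto
  show "x \<in> curve_param n ` {-1..1}"
  proof (cases "x = twisted_arc n (1/4) w")
    case True
    then show ?thesis using w by (intro image_eqI[of _ _ w]) (auto simp: curve_param_def)
  next
    case False
    then have x: "x = twisted_arc n (15/4) w" using x by simp
    show ?thesis
    proof (cases "w = 0")
      case True
      then have "x = curve_param n 0" using x Lpt_quarter(1)[of n] by (simp add: curve_param_def twisted_arc_def)
      then show ?thesis by auto
    next
      case False
      then show ?thesis using w x by (intro image_eqI[of _ _ "- w"]) (auto simp: curve_param_def)
    qed
  qed
next
  fix x assume "x \<in> curve_param n ` {-1..1}"
  then obtain r where r: "r \<in> {-1..1}" and x: "x = curve_param n r" by blast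
  show "x \<in> fibre_curve n"
  proof (cases "0 \<le> r")
    case True
    then show ?thesis unfolding fibre_curve_def
      using r x by (intro image_eqI[of _ _ "(1/4, r)"]) (auto simp: curve_param_def)
  next
    case False
    then show ?thesis unfolding fibre_curve_def
      using r x by (intro image_eqI[of _ _ "(15/4, - r)"]) (auto simp: curve_param_def)
  qed
qed

lemma cis_pi_eq_iff: "cis (pi * r) = cis (pi * r') \<longleftrightarrow> (\<exists>k::int. r' = r + 2 * of_int k)"
proof -
  have "pi * r' = pi * r + 2 * pi * of_int k \<longleftrightarrow> r' = r + 2 * of_int k" for k
  proof -
    have "pi * r' = pi * r + 2 * pi * of_int k \<longleftrightarrow> pi * r' = pi * (r + 2 * of_int k)" by (simp add: algebra_simps)
    then show ?thesis by simp
  qed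
  moreover have "cis (pi * r) = cis (pi * r') \<longleftrightarrow> (\<exists>k::int. pi * r' = pi * r + 2 * pi * of_int k)"
    using cis_eq_cis_iff[of "pi * r'" "pi * r"] by auto
  ultimately show ?thesis by simp
qed

lemma fibre_curve_circle: "subtopology F_surface (fibre_curve n) homeomorphic_space top_of_set (sphere (0::complex) 1)"
proof (rule homeomorphic_space_same_fibres)
  show "compact_space (top_of_set {-1..1::real})" by (simp add: compact_space_subtopology)
  show "Hausdorff_space (subtopology F_surface (fibre_curve n))" using Hausdorff_F by (rule Hausdorff_space_subtopology)
  show "continuous_map (top_of_set {-1..1}) (subtopology F_surface (fibre_curve n)) (curve_param n)"
    using continuous_curve_param by (auto simp: continuous_map_in_subtopology fibre_curve_param)
  show "curve_param n ` topspace (top_of_set {-1..1}) = topspace (subtopology F_surface (fibre_curve n))"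
    using fibre_curve_in_F[of n] by (simp add: fibre_curve_param Int_absorb1)
  show "Hausdorff_space (top_of_set (sphere (0::complex) 1))" by (simp add: Hausdorff_space_subtopology)
  show "continuous_map (top_of_set {-1..1}) (top_of_set (sphere 0 1)) (\<lambda>r. cis (pi * r))"
    by (auto simp: continuous_map_in_subtopology intro!: continuous_intros)
  show "(\<lambda>r. cis (pi * r)) ` topspace (top_of_set {-1..1}) = topspace (top_of_set (sphere 0 1))"
  proof
    show "topspace (top_of_set (sphere 0 1)) \<subseteq> (\<lambda>r. cis (pi * r)) ` topspace (top_of_set {-1..1})"
    proof
      fix z :: complex assume "z \<in> topspace (top_of_set (sphere 0 1))"
      then have "cmod z = 1" by simp
      then have "z = cis (Arg z)" using rcis_cmod_Arg[of z] by (simp add: rcis_def)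
      moreover have "Arg z / pi \<in> {-1..1}" using Arg_bounded[of z] by (auto simp: field_simps)
      ultimately show "z \<in> (\<lambda>r. cis (pi * r)) ` topspace (top_of_set {-1..1})"
        by (intro image_eqI[of _ _ "Arg z / pi"]) auto
    qed
  qed auto
  show "curve_param n r = curve_param n r' \<longleftrightarrow> cis (pi * r) = cis (pi * r')"
    if "r \<in> topspace (top_of_set {-1..1})" "r' \<in> topspace (top_of_set {-1..1})" for r r'
    using that curve_param_eq_iff cis_pi_eq_iff by simp
qed

section \<open>Projection of the curve to the pillowcase\<close>

lemma sin_pi_translate: "sin (pi * (u + 2 * of_int a)) = sin (pi * u)" for a :: int
proof -
  have "\<exists>k::int. pi * (u + 2 * of_int a) = pi * u + 2 * pi * of_int k"
    by (intro exI[of _ a]) (simp add: algebra_simps)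
  then show ?thesis by (simp only: sin_cos_eq_iff[symmetric])
qed

lemma sin_cos_pi_reflect:
  fixes a :: int
  shows "sin (pi * (2 * of_int a - u)) = - sin (pi * u)" "cos (pi * (2 * of_int a - u)) = cos (pi * u)"
proof -
  have "\<exists>k::int. pi * (2 * of_int a - u) = - (pi * u) + 2 * pi * of_int k"
    by (intro exI[of _ a]) (simp add: algebra_simps)
  then have "sin (pi * (2 * of_int a - u)) = sin (- (pi * u)) \<and> cos (pi * (2 * of_int a - u)) = cos (- (pi * u))"
    by (simp only: sin_cos_eq_iff)
  then show "sin (pi * (2 * of_int a - u)) = - sin (pi * u)" "cos (pi * (2 * of_int a - u)) = cos (pi * u)"
    by simp_all
qed

text \<open>The functions \<open>cos (\<pi> x)\<close>, \<open>cos (\<pi> y)\<close> and \<open>sin (\<pi> x) sin (\<pi> y)\<close> separate the orbits of \<open>\<Gamma>\<close>: the first two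
  determine the coordinates up to signs and even integers, the third couples the signs.\<close>

lemma Hausdorff_pillowcase: "Hausdorff_space pillowcase"
  unfolding pillowcase_def
proof (rule Hausdorff_space_quotient_by)
  let ?f = "\<lambda>p :: real \<times> real. (cos (pi * fst p), cos (pi * snd p), sin (pi * fst p) * sin (pi * snd p))"
  show "continuous_map euclidean euclidean ?f"
    unfolding continuous_map_iff_continuous2 by (intro continuous_intros)
  show "Hausdorff_space (euclidean :: (real \<times> real \<times> real) topology)" by simp
  show "?f p = ?f q" if "Gamma_rel p q" for p q
    using that
  proof cases
    case (1 x y a b)
    show ?thesis using 1 by (simp add: sin_cos_pi_reflect)
  qed
  show "cls Gamma_rel p = cls Gamma_rel q" if "?f p = ?f q" for p q
  proof -
    obtain x y x' y' where p: "p = (x, y)" and q: "q = (x', y')" by (metis surj_pair)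
    have co: "\<exists>a::int. v = u + 2 * of_int a \<or> v = 2 * of_int a - u" if uv: "cos (pi * u) = cos (pi * v)" for u v
    proof -
      obtain m :: int where "pi * v = pi * u + 2 * of_int m * pi \<or> pi * v = - (pi * u) + 2 * of_int m * pi"
        using uv[symmetric] unfolding cos_eq by (auto elim!: Ints_cases)
      then have "pi * v = pi * (u + 2 * of_int m) \<or> pi * v = pi * (2 * of_int m - u)" by (auto simp: algebra_simps)
      then have "v = u + 2 * of_int m \<or> v = 2 * of_int m - u" by simp
      then show ?thesis by blast
    qed
    have zero: "\<exists>i::int. u = of_int i" if u: "sin (pi * u) = 0" for u
    proof -
      obtain i :: int where "pi * u = of_int i * pi" using u unfolding sin_zero_iff_int2 by blast
      then have "u = of_int i" by simp
      then show ?thesis ..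
    qed
    have eq: "cos (pi * x) = cos (pi * x')" "cos (pi * y) = cos (pi * y')"
      "sin (pi * x) * sin (pi * y) = sin (pi * x') * sin (pi * y')"
      using that unfolding p q by auto
    obtain a :: int where a: "x' = x + 2 * of_int a \<or> x' = 2 * of_int a - x" using co[OF eq(1)] by blast
    obtain b :: int where b: "y' = y + 2 * of_int b \<or> y' = 2 * of_int b - y" using co[OF eq(2)] by blast
    have fin: "\<exists>a b::int. (x' = x + 2 * of_int a \<and> y' = y + 2 * of_int b) \<or> (x' = 2 * of_int a - x \<and> y' = 2 * of_int b - y)"
    proof (cases "sin (pi * x) * sin (pi * y) = 0")
      case True
      then consider i :: int where "x = of_int i" | j :: int where "y = of_int j" using zero by (metis mult_eq_0_iff)
      then show ?thesis
      proof cases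
        case 1
        then have "\<exists>a::int. x' = x + 2 * of_int a" "\<exists>a::int. x' = 2 * of_int a - x"
          using a by (auto intro: exI[of _ a] exI[of _ "a - i"] exI[of _ "a + i"])
        then show ?thesis using b by blast
      next
        case 2
        then have "\<exists>b::int. y' = y + 2 * of_int b" "\<exists>b::int. y' = 2 * of_int b - y"
          using b by (auto intro: exI[of _ b] exI[of _ "b - j"] exI[of _ "b + j"])
        then show ?thesis using a by blast
      qed
    next
      case False
      then show ?thesis using a b eq(3) by (auto simp: sin_cos_pi_reflect sin_pi_translate)
    qed
    then show ?thesis
      unfolding p q using Gamma_translate Gamma_rotate by metis
  qed
qed

lemma topspace_P: "topspace P_space = range (cls Gamma_rel) - cls Gamma_rel ` (\<int> \<times> \<int>)"
  by (auto simp: P_space_def pillowcase_def topspace_quotient_by)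

lemma continuous_proj: "continuous_map F_surface pillowcase proj"
  unfolding F_surface_def
proof (rule continuous_map_from_quotient)
  have "continuous_map (top_of_set (UNIV \<times> {0..1})) pillowcase (cls Gamma_rel)"
    unfolding pillowcase_def by (intro continuous_map_from_subtopology continuous_map_cls)
  moreover have "proj (cls F_glue p) = cls Gamma_rel p" for p using proj_Fpt[of "fst p" "snd p"] by simp
  ultimately show "continuous_map (top_of_set (UNIV \<times> {0..1})) pillowcase (\<lambda>p. proj (cls F_glue p))" by simp
qed

lemma proj_fibre_curve: "proj ` fibre_curve n = (\<lambda>r. cls Gamma_rel (line_pt n r)) ` {-1..1}"
  unfolding fibre_curve_param image_image using proj_curve_param by (intro image_cong) auto

lemma proj_fibre_curve_line:
  "proj ` fibre_curve n = cls Gamma_rel ` line_through (line_pt n 0) (of_int (int n), of_int (2 * int n + 1))"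
proof -
  have lp: "line_pt n 0 + r *\<^sub>R (of_int (int n), of_int (2 * int n + 1)) = line_pt n r" for r
    by (simp add: line_pt_def)
  have "cls Gamma_rel ` line_through (line_pt n 0) (of_int (int n), of_int (2 * int n + 1)) = range (\<lambda>r. cls Gamma_rel (line_pt n r))"
    unfolding line_through_def lp image_image ..
  moreover have "range (\<lambda>r. cls Gamma_rel (line_pt n r)) = (\<lambda>r. cls Gamma_rel (line_pt n r)) ` {-1..1}"
  proof (intro equalityI subsetI)
    fix c assume "c \<in> range (\<lambda>r. cls Gamma_rel (line_pt n r))"
    then obtain r where c: "c = cls Gamma_rel (line_pt n r)" by blast
    \<comment> \<open>The even translate of \<open>r\<close> that lies in \<open>[-1, 1]\<close>.\<close>
    let ?k = "- \<lfloor>(r + 1) / 2\<rfloor>"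
    have "of_int \<lfloor>(r + 1) / 2\<rfloor> \<le> (r + 1) / 2" "(r + 1) / 2 \<le> of_int \<lfloor>(r + 1) / 2\<rfloor> + 1" by linarith+
    then have "r + 2 * of_int ?k \<in> {-1..1}" by (simp add: field_simps)
    moreover have "c = cls Gamma_rel (line_pt n (r + 2 * of_int ?k))" unfolding c line_pt_orbit by blast
    ultimately show "c \<in> (\<lambda>r. cls Gamma_rel (line_pt n r)) ` {-1..1}" by blast
  qed auto
  ultimately show ?thesis unfolding proj_fibre_curve by simp
qed

lemma proj_fibre_curve_in_P: "proj ` fibre_curve n \<subseteq> topspace P_space"
  unfolding proj_fibre_curve topspace_P using line_pt_not_lattice by blast

lemma proj_fibre_curve_homeomorphic:
  "homeomorphic_map (subtopology F_surface (fibre_curve n)) (subtopology P_space (proj ` fibre_curve n)) proj"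
proof (rule continuous_imp_homeomorphic_map)
  have P: "subtopology P_space (proj ` fibre_curve n) = subtopology pillowcase (proj ` fibre_curve n)"
    using proj_fibre_curve_in_P[of n] unfolding P_space_def subtopology_subtopology
    by (simp add: Int_absorb1)
  show "continuous_map (subtopology F_surface (fibre_curve n)) (subtopology P_space (proj ` fibre_curve n)) proj"
    unfolding P continuous_map_in_subtopology using continuous_map_from_subtopology[OF continuous_proj] by auto
  have "compactin F_surface (curve_param n ` {-1..1})"
    by (rule image_compactin[OF _ continuous_curve_param]) (simp add: compactin_subtopology)
  then show "compact_space (subtopology F_surface (fibre_curve n))"
    by (simp add: fibre_curve_param compact_space_subtopology)
  show "Hausdorff_space (subtopology P_space (proj ` fibre_curve n))"
    unfolding P using Hausdorff_pillowcase by (rule Hausdorff_space_subtopology)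
  show "proj ` topspace (subtopology F_surface (fibre_curve n)) = topspace (subtopology P_space (proj ` fibre_curve n))"
    using fibre_curve_in_F[of n] proj_fibre_curve_in_P[of n] by (simp add: Int_absorb1)
  have "inj_on proj (fibre_curve n)"
    unfolding fibre_curve_param
  proof (rule inj_onI, clarify)
    fix r r' :: real assume r: "r \<in> {-1..1}" "r' \<in> {-1..1}" and "proj (curve_param n r) = proj (curve_param n r')"
    then have "\<exists>k::int. r' = r + 2 * of_int k" using proj_curve_param line_pt_orbit by metis
    then show "curve_param n r = curve_param n r'" using curve_param_eq_iff r by blast
  qed
  then show "inj_on proj (topspace (subtopology F_surface (fibre_curve n)))"
    using fibre_curve_in_F[of n] by (simp add: Int_absorb1)
qed

lemma isotopic_in_refl: "isotopic_in X A A"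
  unfolding isotopic_in_def
proof (intro exI[of _ "\<lambda>t x. x"] conjI)
  show "continuous_map (prod_topology (top_of_set {0..1}) X) X (\<lambda>(t, x). x)"
    using continuous_map_snd by (simp add: case_prod_unfold)
  show "\<forall>t\<in>{0..1::real}. homeomorphic_map X X (\<lambda>x. x)"
    using homeomorphic_map_id[of X X] by (simp add: id_def)
qed auto

lemma has_index_fibre_curve: "has_index (proj ` fibre_curve n) (int n) (2 * int n + 1)"
  unfolding has_index_def
proof (intro conjI exI[of _ "line_pt n 0"])
  have "subtopology P_space (proj ` fibre_curve n) homeomorphic_space subtopology F_surface (fibre_curve n)"
    using proj_fibre_curve_homeomorphic homeomorphic_map_imp_homeomorphic_space homeomorphic_space_sym by blast
  then show "simple_closed_curve P_space (proj ` fibre_curve n)"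
    unfolding simple_closed_curve_def using proj_fibre_curve_in_P fibre_curve_circle homeomorphic_space_trans by blast
  show "coprime (int n) (2 * int n + 1)"
  proof (rule coprimeI)
    fix c assume "c dvd int n" "c dvd 2 * int n + 1"
    then have "c dvd 2 * int n" by simp
    then show "is_unit c" using \<open>c dvd 2 * int n + 1\<close> by (simp add: dvd_add_right_iff)
  qed
  let ?l = "line_through (line_pt n 0) (of_int (int n), of_int (2 * int n + 1))"
  show "?l \<inter> \<int> \<times> \<int> = {}"
  proof (rule ccontr)
    assume "?l \<inter> \<int> \<times> \<int> \<noteq> {}"
    then obtain p where "p \<in> ?l" "p \<in> \<int> \<times> \<int>" by blast
    then have "cls Gamma_rel p \<in> proj ` fibre_curve n" "cls Gamma_rel p \<in> cls Gamma_rel ` (\<int> \<times> \<int>)"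
      unfolding proj_fibre_curve_line by blast+
    then show False using proj_fibre_curve_in_P unfolding topspace_P by blast
  qed
  show "isotopic_in P_space (proj ` fibre_curve n) (cls Gamma_rel ` ?l)"
    unfolding proj_fibre_curve_line by (rule isotopic_in_refl)
qed

theorem theorem4p1:
  fixes h :: "((real \<times> real) set \<times> real) set \<Rightarrow> ((real \<times> real) set \<times> real) set"
    and n :: nat
  assumes "dehn_twist h"
  shows "\<exists>C. simple_closed_curve F_surface C \<and>
             isotopic_in M_space ((h ^^ n) ` V0) {Mpt x (1/2) | x. x \<in> C} \<and>
             homeomorphic_map (subtopology F_surface C) (subtopology P_space (proj ` C)) proj \<and>
             has_index (proj ` C) (int n) (2 * int n + 1)"
proof (intro exI[of _ "fibre_curve n"] conjI)
  show "simple_closed_curve F_surface (fibre_curve n)"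
    unfolding simple_closed_curve_def using fibre_curve_in_F fibre_curve_circle by blast
qed (use V0_isotopic_fibre_curve[OF assms] proj_fibre_curve_homeomorphic has_index_fibre_curve in auto)

end
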